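(* The quadruple $c\mathcal{A}_\infty := (\mathrm{cA}_\infty, d_{\mathrm{cA}_\infty}, \mu_0, \langle \mu_i\rangle_{i>0})$, where $\mathrm{cA}_\infty$ is the (shifted) curved A-infinity dg operad and $\langle \mu_i\rangle_{i>0}$ is the graded sub-operad generated by the $\mu_i$ with $i>0$, is the initial object of the category $\mathrm{Curv}$.
   Context: Conventions. "Operad" means non-unital non-symmetric operad in graded $\mathbb{Z}$-modules (arities $n\ge 0$, partial compositions $\circ_i$, no identity element required); "dg operad" means the same in differential graded $\mathbb{Z}$-modules; homological degree conventions, so differentials have degree $-1$. $\vee$ denotes the coproduct of operads. $[\kappa]$ denotes the operad freely generated by a single operation $\kappa$ of arity $0$. For an operad $\mathrm{P}$, the coproduct $\mathrm{P}\vee[\kappa]$ has a weight grading, by the number of $\kappa$'s appearing in an expression. The category $\mathrm{Curv}$. Objects are quadruples $(\mathrm{Q}, d_{\mathrm{Q}}, \kappa, \mathrm{Q}_0)$ where $(\mathrm{Q}, d_{\mathrm{Q}})$ is a dg operad, $\mathrm{Q}_0$ is a sub-operad of the underlying graded (not dg) operad $\mathrm{Q}$, and $\kappa\in \mathrm{Q}\setminus\mathrm{Q}_0$ is an element of arity $0$ and degree $-1$, such that: (1) the natural morphism $\mathrm{Q}_0\vee[\kappa]\to\mathrm{Q}$ is an isomorphism; (2) for the resulting weight grading $\mathrm{Q}=\bigoplus_i \mathrm{Q}_i$ (number of $\kappa$'s), writing $d_{\mathrm{Q}}=\sum_i d_i$ with $d_i(\mathrm{Q}_j)\subset \mathrm{Q}_{i+j}$,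 all $d_i$ vanish except $d_0,d_1$; (3) $d_1\kappa=0$. Morphisms $(\mathrm{Q}, d_{\mathrm{Q}}, \kappa, \mathrm{Q}_0)\to(\mathrm{Q}', d_{\mathrm{Q}'}, \kappa', \mathrm{Q}'_0)$ are maps of dg operads $\Phi:(\mathrm{Q},d_{\mathrm{Q}})\to(\mathrm{Q}',d_{\mathrm{Q}'})$ with $\Phi(\kappa)=\kappa'$ and $\Phi(\mathrm{Q}_0)\subset\mathrm{Q}'_0$. The dg operad $\mathrm{cA}_\infty$ is the free operad on generators $\mu_n$, $n\ge 0$, of arity $n$ and degree $-1$, with differential $$d_{\mathrm{cA}_\infty}(\mu_n) = -\sum_{p,q,r\ge 0,\ p+q+r=n}\mu_{p+1+r}\circ_{p+1}\mu_q.$$ *)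

theory Defs
  imports "HOL-Algebra.Coset" "HOL-Algebra.FiniteProduct"
begin

section \<open>Graded operads\<close>

text \<open>
  A graded operad is a family of abelian groups indexed by arity (a natural number) and homological
  degree (an integer). As everywhere in HOL-Algebra, the abelian groups are written
  multiplicatively: \<open>\<otimes>\<close> is addition, \<open>\<one>\<close> is zero and \<open>inv\<close> is negation.
  Carriers of different components may overlap, so all structure maps carry the arities and degrees
  of their arguments: \<open>pcomp P m a n b i x y\<close> is the partial composition of \<open>x\<close> (arity \<open>m\<close>,
  degree \<open>a\<close>) with \<open>y\<close> (arity \<open>n\<close>, degree \<open>b\<close>) at the input \<open>i\<close>, for \<open>1 \<le> i \<le> m\<close>.
\<close>

record 'a goperad =
  cpt :: "nat \<Rightarrow> int \<Rightarrow> 'a monoid"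
  pcomp :: "nat \<Rightarrow> int \<Rightarrow> nat \<Rightarrow> int \<Rightarrow> nat \<Rightarrow> 'a \<Rightarrow> 'a \<Rightarrow> 'a"

abbreviation carr :: "('a, 'm) goperad_scheme \<Rightarrow> nat \<Rightarrow> int \<Rightarrow> 'a set" where
  "carr P n d \<equiv> carrier (cpt P n d)"

definition signed :: "'a monoid \<Rightarrow> int \<Rightarrow> 'a \<Rightarrow> 'a" where
  "signed G k x = (if even k then x else inv\<^bsub>G\<^esub> x)"

text \<open>Non-unital and non-symmetric: there is no identity operation and no permutation action.\<close>

locale graded_operad =
  fixes P :: "('a, 'm) goperad_scheme"
  assumes comm_group_cpt: "comm_group (cpt P n d)"
    and pcomp_hom_left: "\<lbrakk>1 \<le> i; i \<le> m; y \<in> carr P n b\<rbrakk> \<Longrightarrow>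
      (\<lambda>x. pcomp P m a n b i x y) \<in> hom (cpt P m a) (cpt P (m + n - 1) (a + b))"
    and pcomp_hom_right: "\<lbrakk>1 \<le> i; i \<le> m; x \<in> carr P m a\<rbrakk> \<Longrightarrow>
      (\<lambda>y. pcomp P m a n b i x y) \<in> hom (cpt P n b) (cpt P (m + n - 1) (a + b))"
    and pcomp_seq: "\<lbrakk>1 \<le> i; i \<le> m; 1 \<le> j; j \<le> n;
        x \<in> carr P m a; y \<in> carr P n b; z \<in> carr P l c\<rbrakk> \<Longrightarrow>
      pcomp P (m + n - 1) (a + b) l c (i - 1 + j) (pcomp P m a n b i x y) z =
      pcomp P m a (n + l - 1) (b + c) i x (pcomp P n b l c j y z)"
    and pcomp_par: "\<lbrakk>1 \<le> i; i < k; k \<le> m;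
        x \<in> carr P m a; y \<in> carr P n b; z \<in> carr P l c\<rbrakk> \<Longrightarrow>
      pcomp P (m + n - 1) (a + b) l c (k - 1 + n) (pcomp P m a n b i x y) z =
      signed (cpt P (m + n + l - 2) (a + b + c)) (b * c)
        (pcomp P (m + l - 1) (a + c) n b i (pcomp P m a l c k x z) y)"

definition operad_hom ::
  "('a, 'm) goperad_scheme \<Rightarrow> ('b, 'k) goperad_scheme \<Rightarrow> (nat \<Rightarrow> int \<Rightarrow> 'a \<Rightarrow> 'b) \<Rightarrow> bool" where
  "operad_hom P R f \<longleftrightarrow>
     (\<forall>n d. f n d \<in> hom (cpt P n d) (cpt R n d)) \<and>
     (\<forall>m a n b i x y. 1 \<le> i \<and> i \<le> m \<and> x \<in> carr P m a \<and> y \<in> carr P n b \<longrightarrow>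
        f (m + n - 1) (a + b) (pcomp P m a n b i x y) =
        pcomp R m a n b i (f m a x) (f n b y))"

definition operad_iso ::
  "('a, 'm) goperad_scheme \<Rightarrow> ('b, 'k) goperad_scheme \<Rightarrow> (nat \<Rightarrow> int \<Rightarrow> 'a \<Rightarrow> 'b) \<Rightarrow> bool" where
  "operad_iso P R f \<longleftrightarrow>
     operad_hom P R f \<and> (\<forall>n d. bij_betw (f n d) (carr P n d) (carr R n d))"

definition suboperad :: "(nat \<Rightarrow> int \<Rightarrow> 'a set) \<Rightarrow> ('a, 'm) goperad_scheme \<Rightarrow> bool" where
  "suboperad S P \<longleftrightarrow>
     (\<forall>n d. subgroup (S n d) (cpt P n d)) \<and>
     (\<forall>m a n b i x y. 1 \<le> i \<and> i \<le> m \<and> x \<in> S m a \<and> y \<in> S n b \<longrightarrow>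
        pcomp P m a n b i x y \<in> S (m + n - 1) (a + b))"

definition restrict_operad ::
  "('a, 'm) goperad_scheme \<Rightarrow> (nat \<Rightarrow> int \<Rightarrow> 'a set) \<Rightarrow> 'a goperad" where
  "restrict_operad P S =
     \<lparr>cpt = (\<lambda>n d. (cpt P n d)\<lparr>carrier := S n d\<rparr>), pcomp = pcomp P\<rparr>"

definition generated_suboperad ::
  "('a, 'm) goperad_scheme \<Rightarrow> (nat \<Rightarrow> int \<Rightarrow> 'a set) \<Rightarrow> nat \<Rightarrow> int \<Rightarrow> 'a set" where
  "generated_suboperad P X n d =
     \<Inter>{S n d | S. suboperad S P \<and> (\<forall>m a. X m a \<subseteq> S m a)}"


section \<open>Operads presented by generators and relations\<close>

text \<open>
  For a graded collection of generators \<open>G\<close>, formal expressions in the generators are built from the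
  abelian group operations and partial compositions. The operad presented by \<open>G\<close> and a family \<open>E\<close>
  of relations is their quotient by the smallest congruence containing \<open>E\<close> and the operad axioms;
  the free operad on \<open>G\<close> is the case without relations.
\<close>

datatype 'g expr =
    Gen nat int 'g
  | Zero nat int
  | Add "'g expr" "'g expr"
  | Neg "'g expr"
  | Comp nat "'g expr" "'g expr"

fun edeg :: "'g expr \<Rightarrow> int" where
  "edeg (Gen n d g) = d"
| "edeg (Zero n d) = d"
| "edeg (Add s t) = edeg s"
| "edeg (Neg s) = edeg s"
| "edeg (Comp i s t) = edeg s + edeg t"

definition esigned :: "int \<Rightarrow> 'g expr \<Rightarrow> 'g expr" where
  "esigned k t = (if even k then t else Neg t)"

inductive wf_expr :: "(nat \<Rightarrow> int \<Rightarrow> 'g set) \<Rightarrow> nat \<Rightarrow> int \<Rightarrow> 'g expr \<Rightarrow> bool"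
  for G where
  wf_Gen: "g \<in> G n d \<Longrightarrow> wf_expr G n d (Gen n d g)"
| wf_Zero: "wf_expr G n d (Zero n d)"
| wf_Add: "\<lbrakk>wf_expr G n d s; wf_expr G n d t\<rbrakk> \<Longrightarrow> wf_expr G n d (Add s t)"
| wf_Neg: "wf_expr G n d s \<Longrightarrow> wf_expr G n d (Neg s)"
| wf_Comp: "\<lbrakk>wf_expr G m a s; wf_expr G n b t; 1 \<le> i; i \<le> m\<rbrakk> \<Longrightarrow>
    wf_expr G (m + n - 1) (a + b) (Comp i s t)"

inductive ocong ::
  "(nat \<Rightarrow> int \<Rightarrow> 'g set) \<Rightarrow> (nat \<Rightarrow> int \<Rightarrow> 'g expr \<Rightarrow> 'g expr \<Rightarrow> bool) \<Rightarrow>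
   nat \<Rightarrow> int \<Rightarrow> 'g expr \<Rightarrow> 'g expr \<Rightarrow> bool"
  for G E where
  oc_refl: "wf_expr G n d s \<Longrightarrow> ocong G E n d s s"
| oc_sym: "ocong G E n d s t \<Longrightarrow> ocong G E n d t s"
| oc_trans: "\<lbrakk>ocong G E n d s t; ocong G E n d t u\<rbrakk> \<Longrightarrow> ocong G E n d s u"
| oc_Add: "\<lbrakk>ocong G E n d s s'; ocong G E n d t t'\<rbrakk> \<Longrightarrow> ocong G E n d (Add s t) (Add s' t')"
| oc_Neg: "ocong G E n d s s' \<Longrightarrow> ocong G E n d (Neg s) (Neg s')"
| oc_Comp: "\<lbrakk>ocong G E m a s s'; ocong G E n b t t'; 1 \<le> i; i \<le> m\<rbrakk> \<Longrightarrow>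
    ocong G E (m + n - 1) (a + b) (Comp i s t) (Comp i s' t')"
| oc_rel: "\<lbrakk>E n d s t; wf_expr G n d s; wf_expr G n d t\<rbrakk> \<Longrightarrow> ocong G E n d s t"
| oc_add_assoc: "\<lbrakk>wf_expr G n d s; wf_expr G n d t; wf_expr G n d u\<rbrakk> \<Longrightarrow>
    ocong G E n d (Add (Add s t) u) (Add s (Add t u))"
| oc_add_comm: "\<lbrakk>wf_expr G n d s; wf_expr G n d t\<rbrakk> \<Longrightarrow> ocong G E n d (Add s t) (Add t s)"
| oc_add_zero: "wf_expr G n d s \<Longrightarrow> ocong G E n d (Add (Zero n d) s) s"
| oc_add_neg: "wf_expr G n d s \<Longrightarrow> ocong G E n d (Add (Neg s) s) (Zero n d)"
| oc_comp_add_left: "\<lbrakk>wf_expr G m a s; wf_expr G m a t; wf_expr G n b u; 1 \<le> i; i \<le> m\<rbrakk> \<Longrightarrow>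
    ocong G E (m + n - 1) (a + b) (Comp i (Add s t) u) (Add (Comp i s u) (Comp i t u))"
| oc_comp_add_right: "\<lbrakk>wf_expr G m a s; wf_expr G n b t; wf_expr G n b u; 1 \<le> i; i \<le> m\<rbrakk> \<Longrightarrow>
    ocong G E (m + n - 1) (a + b) (Comp i s (Add t u)) (Add (Comp i s t) (Comp i s u))"
| oc_comp_seq: "\<lbrakk>wf_expr G m a s; wf_expr G n b t; wf_expr G l c u;
      1 \<le> i; i \<le> m; 1 \<le> j; j \<le> n\<rbrakk> \<Longrightarrow>
    ocong G E (m + n + l - 2) (a + b + c)
      (Comp (i - 1 + j) (Comp i s t) u) (Comp i s (Comp j t u))"
| oc_comp_par: "\<lbrakk>wf_expr G m a s; wf_expr G n b t; wf_expr G l c u; 1 \<le> i; i < k; k \<le> m\<rbrakk> \<Longrightarrow>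
    ocong G E (m + n + l - 2) (a + b + c)
      (Comp (k - 1 + n) (Comp i s t) u) (esigned (b * c) (Comp i (Comp k s u) t))"

definition oclass ::
  "(nat \<Rightarrow> int \<Rightarrow> 'g set) \<Rightarrow> (nat \<Rightarrow> int \<Rightarrow> 'g expr \<Rightarrow> 'g expr \<Rightarrow> bool) \<Rightarrow>
   nat \<Rightarrow> int \<Rightarrow> 'g expr \<Rightarrow> 'g expr set" where
  "oclass G E n d t = {s. ocong G E n d t s}"

definition presented_operad ::
  "(nat \<Rightarrow> int \<Rightarrow> 'g set) \<Rightarrow> (nat \<Rightarrow> int \<Rightarrow> 'g expr \<Rightarrow> 'g expr \<Rightarrow> bool) \<Rightarrow>
   'g expr set goperad" where
  "presented_operad G E =
     \<lparr>cpt = (\<lambda>n d. \<lparr>carrier = oclass G E n d ` {t. wf_expr G n d t},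
                    mult = (\<lambda>X Y. \<Union>s\<in>X. \<Union>t\<in>Y. oclass G E n d (Add s t)),
                    one = oclass G E n d (Zero n d)\<rparr>),
      pcomp = (\<lambda>m a n b i X Y.
        \<Union>s\<in>X. \<Union>t\<in>Y. oclass G E (m + n - 1) (a + b) (Comp i s t))\<rparr>"

abbreviation no_rel :: "nat \<Rightarrow> int \<Rightarrow> 'g expr \<Rightarrow> 'g expr \<Rightarrow> bool" where
  "no_rel \<equiv> (\<lambda>n d s t. False)"

definition free_operad :: "(nat \<Rightarrow> int \<Rightarrow> 'g set) \<Rightarrow> 'g expr set goperad" where
  "free_operad G = presented_operad G no_rel"

definition free_gen :: "(nat \<Rightarrow> int \<Rightarrow> 'g set) \<Rightarrow> nat \<Rightarrow> int \<Rightarrow> 'g \<Rightarrow> 'g expr set" where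
  "free_gen G n d g = oclass G no_rel n d (Gen n d g)"

text \<open>The derivation of degree \<open>-1\<close> extending \<open>\<delta>\<close> on generators, first on expressions and then on
  the free operad.\<close>

fun ederiv :: "(nat \<Rightarrow> int \<Rightarrow> 'g \<Rightarrow> 'g expr) \<Rightarrow> 'g expr \<Rightarrow> 'g expr" where
  "ederiv \<delta> (Gen n d g) = \<delta> n d g"
| "ederiv \<delta> (Zero n d) = Zero n (d - 1)"
| "ederiv \<delta> (Add s t) = Add (ederiv \<delta> s) (ederiv \<delta> t)"
| "ederiv \<delta> (Neg s) = Neg (ederiv \<delta> s)"
| "ederiv \<delta> (Comp i s t) =
     Add (Comp i (ederiv \<delta> s) t) (esigned (edeg s) (Comp i s (ederiv \<delta> t)))"

definition free_deriv ::
  "(nat \<Rightarrow> int \<Rightarrow> 'g set) \<Rightarrow> (nat \<Rightarrow> int \<Rightarrow> 'g \<Rightarrow> 'g expr) \<Rightarrow>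
   nat \<Rightarrow> int \<Rightarrow> 'g expr set \<Rightarrow> 'g expr set" where
  "free_deriv G \<delta> n d X = (\<Union>s\<in>X. oclass G no_rel n (d - 1) (ederiv \<delta> s))"


section \<open>Coproducts and adjoining an operation of arity zero\<close>

text \<open>The coproduct of two operads is generated by the elements of both, subject to the relations
  making the two injections operad morphisms.\<close>

inductive coprod_rel ::
  "('a, 'm) goperad_scheme \<Rightarrow> ('b, 'k) goperad_scheme \<Rightarrow>
   nat \<Rightarrow> int \<Rightarrow> ('a + 'b) expr \<Rightarrow> ('a + 'b) expr \<Rightarrow> bool"
  for P R where
  Inl_add: "\<lbrakk>x \<in> carr P n d; y \<in> carr P n d\<rbrakk> \<Longrightarrow>
    coprod_rel P R n d
      (Add (Gen n d (Inl x)) (Gen n d (Inl y))) (Gen n d (Inl (x \<otimes>\<^bsub>cpt P n d\<^esub> y)))"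
| Inr_add: "\<lbrakk>x \<in> carr R n d; y \<in> carr R n d\<rbrakk> \<Longrightarrow>
    coprod_rel P R n d
      (Add (Gen n d (Inr x)) (Gen n d (Inr y))) (Gen n d (Inr (x \<otimes>\<^bsub>cpt R n d\<^esub> y)))"
| Inl_comp: "\<lbrakk>x \<in> carr P m a; y \<in> carr P n b; 1 \<le> i; i \<le> m\<rbrakk> \<Longrightarrow>
    coprod_rel P R (m + n - 1) (a + b)
      (Comp i (Gen m a (Inl x)) (Gen n b (Inl y)))
      (Gen (m + n - 1) (a + b) (Inl (pcomp P m a n b i x y)))"
| Inr_comp: "\<lbrakk>x \<in> carr R m a; y \<in> carr R n b; 1 \<le> i; i \<le> m\<rbrakk> \<Longrightarrow>
    coprod_rel P R (m + n - 1) (a + b)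
      (Comp i (Gen m a (Inr x)) (Gen n b (Inr y)))
      (Gen (m + n - 1) (a + b) (Inr (pcomp R m a n b i x y)))"

definition coprod_gens ::
  "('a, 'm) goperad_scheme \<Rightarrow> ('b, 'k) goperad_scheme \<Rightarrow> nat \<Rightarrow> int \<Rightarrow> ('a + 'b) set" where
  "coprod_gens P R n d = carr P n d <+> carr R n d"

definition coprod_operad ::
  "('a, 'm) goperad_scheme \<Rightarrow> ('b, 'k) goperad_scheme \<Rightarrow> ('a + 'b) expr set goperad" where
  "coprod_operad P R = presented_operad (coprod_gens P R) (coprod_rel P R)"

definition coprod_inl ::
  "('a, 'm) goperad_scheme \<Rightarrow> ('b, 'k) goperad_scheme \<Rightarrow>
   nat \<Rightarrow> int \<Rightarrow> 'a \<Rightarrow> ('a + 'b) expr set" where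
  "coprod_inl P R n d x = oclass (coprod_gens P R) (coprod_rel P R) n d (Gen n d (Inl x))"

definition coprod_inr ::
  "('a, 'm) goperad_scheme \<Rightarrow> ('b, 'k) goperad_scheme \<Rightarrow>
   nat \<Rightarrow> int \<Rightarrow> 'b \<Rightarrow> ('a + 'b) expr set" where
  "coprod_inr P R n d x = oclass (coprod_gens P R) (coprod_rel P R) n d (Gen n d (Inr x))"

definition kappa_gens :: "nat \<Rightarrow> int \<Rightarrow> unit set" where
  "kappa_gens n d = (if n = 0 \<and> d = -1 then {()} else {})"

text \<open>\<open>kappa_operad\<close> is \<open>[\<kappa>]\<close>, with \<open>\<kappa>\<close> of degree \<open>-1\<close>, and \<open>kappa_gen\<close> is \<open>\<kappa>\<close> itself.\<close>

definition kappa_operad :: "unit expr set goperad" where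
  "kappa_operad = free_operad kappa_gens"

definition kappa_gen :: "unit expr set" where
  "kappa_gen = free_gen kappa_gens 0 (-1) ()"

text \<open>The natural morphism from \<open>P\<^sub>0 \<or> [\<kappa>]\<close> to \<open>P\<close> is the only morphism which is the
  inclusion on \<open>P\<^sub>0 = S\<close> and sends \<open>\<kappa>\<close> to \<open>k\<close>.\<close>

definition natural_iso ::
  "('a, 'm) goperad_scheme \<Rightarrow> (nat \<Rightarrow> int \<Rightarrow> 'a set) \<Rightarrow> 'a \<Rightarrow> bool" where
  "natural_iso P S k \<longleftrightarrow>
     (\<exists>h. operad_iso (coprod_operad (restrict_operad P S) kappa_operad) P h \<and>
          (\<forall>n d. \<forall>x\<in>S n d. h n d (coprod_inl (restrict_operad P S) kappa_operad n d x) = x) \<and>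
          h 0 (-1) (coprod_inr (restrict_operad P S) kappa_operad 0 (-1) kappa_gen) = k)"

text \<open>\<open>weight_part P S k w n d\<close> consists of the elements of arity \<open>n\<close> and degree \<open>d\<close> that are sums of
  expressions in elements of \<open>S\<close> and exactly \<open>w\<close> copies of \<open>k\<close>. Weights are integers so that they
  can be shifted freely; in negative weight only the zero element occurs.\<close>

inductive weight_part ::
  "('a, 'm) goperad_scheme \<Rightarrow> (nat \<Rightarrow> int \<Rightarrow> 'a set) \<Rightarrow> 'a \<Rightarrow> int \<Rightarrow> nat \<Rightarrow> int \<Rightarrow> 'a \<Rightarrow> bool"
  for P S k where
  wp_base: "x \<in> S n d \<Longrightarrow> weight_part P S k 0 n d x"
| wp_kappa: "weight_part P S k 1 0 (-1) k"
| wp_zero: "weight_part P S k w n d \<one>\<^bsub>cpt P n d\<^esub>"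
| wp_add: "\<lbrakk>weight_part P S k w n d x; weight_part P S k w n d y\<rbrakk> \<Longrightarrow>
    weight_part P S k w n d (x \<otimes>\<^bsub>cpt P n d\<^esub> y)"
| wp_neg: "weight_part P S k w n d x \<Longrightarrow> weight_part P S k w n d (inv\<^bsub>cpt P n d\<^esub> x)"
| wp_comp: "\<lbrakk>weight_part P S k v m a x; weight_part P S k w n b y; 1 \<le> i; i \<le> m\<rbrakk> \<Longrightarrow>
    weight_part P S k (v + w) (m + n - 1) (a + b) (pcomp P m a n b i x y)"


section \<open>Dg operads and curved operads\<close>

record 'a dgoperad = "'a goperad" +
  odiff :: "nat \<Rightarrow> int \<Rightarrow> 'a \<Rightarrow> 'a"

locale dg_operad = graded_operad Q for Q :: "('a, 'm) dgoperad_scheme" +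
  assumes odiff_hom: "odiff Q n d \<in> hom (cpt Q n d) (cpt Q n (d - 1))"
    and odiff_odiff: "x \<in> carr Q n d \<Longrightarrow>
      odiff Q n (d - 1) (odiff Q n d x) = \<one>\<^bsub>cpt Q n (d - 2)\<^esub>"
    and odiff_pcomp: "\<lbrakk>1 \<le> i; i \<le> m; x \<in> carr Q m a; y \<in> carr Q n b\<rbrakk> \<Longrightarrow>
      odiff Q (m + n - 1) (a + b) (pcomp Q m a n b i x y) =
      pcomp Q m (a - 1) n b i (odiff Q m a x) y
      \<otimes>\<^bsub>cpt Q (m + n - 1) (a + b - 1)\<^esub>
      signed (cpt Q (m + n - 1) (a + b - 1)) a (pcomp Q m a n (b - 1) i x (odiff Q n b y))"

text \<open>The quadruples \<open>(Q, d, \<kappa>, Q\<^sub>0)\<close>, with \<open>kappa\<close> for \<open>\<kappa>\<close> and \<open>base\<close> for \<open>Q\<^sub>0\<close>.\<close>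

record 'a curved = "'a dgoperad" +
  kappa :: 'a
  base :: "nat \<Rightarrow> int \<Rightarrow> 'a set"

text \<open>\<open>diff_decomp Q D\<close> states that the differential is the sum of the maps \<open>D w\<close>, where \<open>D w\<close>
  raises weights by \<open>w\<close>. If the weight parts form a direct sum decomposition, then the \<open>D w\<close> are
  uniquely determined.\<close>

definition diff_decomp ::
  "('a, 'm) curved_scheme \<Rightarrow> (int \<Rightarrow> nat \<Rightarrow> int \<Rightarrow> 'a \<Rightarrow> 'a) \<Rightarrow> bool" where
  "diff_decomp Q D \<longleftrightarrow>
     (\<forall>w n d. D w n d \<in> hom (cpt Q n d) (cpt Q n (d - 1))) \<and>
     (\<forall>w v n d x. weight_part Q (base Q) (kappa Q) v n d x \<longrightarrow>
        weight_part Q (base Q) (kappa Q) (v + w) n (d - 1) (D w n d x)) \<and>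
     (\<forall>n d. \<forall>x\<in>carr Q n d.
        finite {w. D w n d x \<noteq> \<one>\<^bsub>cpt Q n (d - 1)\<^esub>} \<and>
        odiff Q n d x =
          finprod (cpt Q n (d - 1)) (\<lambda>w. D w n d x) {w. D w n d x \<noteq> \<one>\<^bsub>cpt Q n (d - 1)\<^esub>})"

locale curv_object = dg_operad Q for Q :: "('a, 'm) curved_scheme" +
  assumes base_suboperad: "suboperad (base Q) Q"
    and kappa_in: "kappa Q \<in> carr Q 0 (-1)"
    and kappa_notin: "kappa Q \<notin> base Q 0 (-1)"
    and base_kappa_iso: "natural_iso Q (base Q) (kappa Q)"
    and diff_weights: "\<exists>D. diff_decomp Q D \<and>
      (\<forall>w n d. \<forall>x\<in>carr Q n d. w \<notin> {0, 1} \<longrightarrow> D w n d x = \<one>\<^bsub>cpt Q n (d - 1)\<^esub>) \<and>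
      D 1 0 (-1) (kappa Q) = \<one>\<^bsub>cpt Q 0 (-2)\<^esub>"

definition curv_morphism ::
  "('a, 'm) curved_scheme \<Rightarrow> ('b, 'k) curved_scheme \<Rightarrow> (nat \<Rightarrow> int \<Rightarrow> 'a \<Rightarrow> 'b) \<Rightarrow> bool" where
  "curv_morphism Q R f \<longleftrightarrow>
     operad_hom Q R f \<and>
     (\<forall>n d. \<forall>x\<in>carr Q n d. f n (d - 1) (odiff Q n d x) = odiff R n d (f n d x)) \<and>
     f 0 (-1) (kappa Q) = kappa R \<and>
     (\<forall>n d. f n d ` base Q n d \<subseteq> base R n d)"


section \<open>The curved A-infinity operad\<close>

definition mu_gens :: "nat \<Rightarrow> int \<Rightarrow> unit set" where
  "mu_gens n d = (if d = -1 then {()} else {})"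

definition mu_expr :: "nat \<Rightarrow> unit expr" where
  "mu_expr n = Gen n (-1) ()"

definition mu :: "nat \<Rightarrow> unit expr set" where
  "mu n = free_gen mu_gens n (-1) ()"

definition mu_diff :: "nat \<Rightarrow> int \<Rightarrow> unit \<Rightarrow> unit expr" where
  "mu_diff n d g =
     Neg (foldr Add
       [Comp (p + 1) (mu_expr (p + 1 + r)) (mu_expr q).
          p \<leftarrow> [0..<n + 1], q \<leftarrow> [0..<n + 1], r \<leftarrow> [0..<n + 1], p + q + r = n]
       (Zero n (-2)))"

definition cA_inf :: "unit expr set curved" where
  "cA_inf =
     \<lparr>cpt = cpt (free_operad mu_gens),
      pcomp = pcomp (free_operad mu_gens),
      odiff = free_deriv mu_gens mu_diff,
      kappa = mu 0,
      base = generated_suboperad (free_operad mu_gens)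
               (\<lambda>n d. if n > 0 \<and> d = -1 then {mu n} else {})\<rparr>"

end

theory Submission
  imports Defs
begin

text \<open>
  Groups are written multiplicatively below, but the comments use additive notation, with
  \<open>\<circ>\<^sub>i\<close> for partial composition and \<open>\<kappa>\<close> for the distinguished operation of a curved operad \<open>Q\<close>
  with base \<open>Q\<^sub>0\<close>.

  By freeness, a morphism out of the curved A-infinity operad is the same as a choice of images
  \<open>m\<^sub>n\<close> of the generators \<open>\<mu>\<^sub>n\<close>. It is a morphism of curved operads exactly when
  \<open>m\<^sub>0 = \<kappa>\<close>, when \<open>m\<^sub>n\<close> lies in \<open>Q\<^sub>0\<close> for \<open>n > 0\<close>, and when every
  curvature \<open>R\<^sub>n = d m\<^sub>n + \<Sum> m\<^sub>p\<^sub>+\<^sub>1\<^sub>+\<^sub>r \<circ>\<^sub>p\<^sub>+\<^sub>1 m\<^sub>q\<close> vanishes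
  (lemma \<open>curv_morphism_from_cA_inf\<close>). Initiality therefore means that every curved operad
  contains exactly one such sequence. Two facts make this work.

  The first is the Bianchi identity \<open>d (\<Sum> m \<circ> m) = \<Sum> (R \<circ> m - m \<circ> R)\<close> (lemma \<open>bianchi\<close>). It holds for
  any sequence of operations of degree \<open>-1\<close>, because the cubic terms cancel by the sequential and
  parallel axioms of an operad (lemma \<open>mc_sum_jacobi\<close>). For the generators \<open>\<mu>\<^sub>n\<close>, whose
  curvature is zero by definition of the differential, it yields \<open>d\<^sup>2 = 0\<close>.

  The second is that insertions of \<open>\<kappa>\<close> are independent (theorem \<open>kappa_insertions_independent\<close>):
  for \<open>x\<close> and \<open>z\<^sub>j\<close> in \<open>Q\<^sub>0\<close>, the equation
  \<open>\<Sum>\<^sub>i (x + \<Sum>\<^sub>j z\<^sub>j \<circ>\<^sub>j \<kappa>) \<circ>\<^sub>i \<kappa> = 0\<close> forces \<open>x = 0\<close> and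
  all \<open>z\<^sub>j\<close> to be equal. Indeed \<open>Q\<close> is the coproduct of \<open>Q\<^sub>0\<close> and the free operad on
  \<open>\<kappa>\<close>, and since \<open>\<kappa>\<close> is odd, filling two inputs \<open>a < b\<close> in the two possible orders gives
  opposite signs, so the part with \<open>\<kappa>\<close> in both inputs is \<open>z\<^sub>b - z\<^sub>a\<close>. To make this precise, the
  coproduct is mapped to a concrete operad of normal forms, whose monomials are operations of
  \<open>Q\<^sub>0\<close> with some inputs marked as filled by \<open>\<kappa>\<close> (\<open>normal_form_operad\<close>).

  A sequence is now built by induction. Since \<open>d\<^sub>1 \<kappa> = 0\<close>, the element \<open>d \<kappa>\<close> has weight one and
  hence equals \<open>- m\<^sub>1 \<circ>\<^sub>1 \<kappa>\<close> for some \<open>m\<^sub>1\<close> in \<open>Q\<^sub>0\<close>. If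
  \<open>m\<^sub>0, \<dots>, m\<^sub>n\<^sub>+\<^sub>1\<close> are found with \<open>R\<^sub>0 = \<dots> = R\<^sub>n = 0\<close>, then
  continuing the sequence by zero, the Bianchi identity reduces to
  \<open>\<Sum>\<^sub>i R\<^sub>n\<^sub>+\<^sub>1 \<circ>\<^sub>i \<kappa> = 0\<close>. As the differential raises weights by at
  most one, \<open>R\<^sub>n\<^sub>+\<^sub>1\<close> has the form \<open>x + \<Sum>\<^sub>j z\<^sub>j \<circ>\<^sub>j \<kappa>\<close>, so it equals
  \<open>\<Sum>\<^sub>j z \<circ>\<^sub>j \<kappa>\<close> for a single \<open>z\<close>, and \<open>m\<^sub>n\<^sub>+\<^sub>2 = - z\<close> makes it vanish. Uniqueness
  uses the same independence: \<open>R\<^sub>n = 0\<close> determines \<open>\<Sum>\<^sub>i m\<^sub>n\<^sub>+\<^sub>1 \<circ>\<^sub>i \<kappa>\<close>, and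
  thereby \<open>m\<^sub>n\<^sub>+\<^sub>1\<close>, in terms of the earlier operations.

  It remains to see that the curved A-infinity operad is itself a curved operad. The map from the
  coproduct is inverted by a map out of the free operad, and the differential splits into the terms
  which contain a new \<open>\<mu>\<^sub>0\<close> and those which do not.
\<close>


section \<open>Signs and finite products in abelian groups\<close>

lemma hom_inv:
  assumes "f \<in> hom G H" "comm_group G" "comm_group H" "x \<in> carrier G"
  shows "f (inv\<^bsub>G\<^esub> x) = inv\<^bsub>H\<^esub> (f x)"
proof -
  interpret group_hom G H f
    using assms by (simp add: group_hom_def group_hom_axioms_def comm_group_def)
  show ?thesis using assms(4) by simp
qed

lemma hom_signed:
  assumes "f \<in> hom G H" "comm_group G" "comm_group H" "x \<in> carrier G"
  shows "f (signed G k x) = signed H k (f x)"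
  using hom_inv[OF assms] by (simp add: signed_def)

lemma hom_to_one:
  assumes "f \<in> hom G H" "comm_group G" "comm_group H"
  shows "f \<one>\<^bsub>G\<^esub> = \<one>\<^bsub>H\<^esub>"
  using assms by (simp add: hom_one comm_group_def)

lemma hom_finprod:
  assumes "f \<in> hom G H" "comm_group G" "comm_group H" "\<And>i. i \<in> I \<Longrightarrow> t i \<in> carrier G"
  shows "f (finprod G t I) = finprod H (\<lambda>i. f (t i)) I"
proof -
  interpret G: comm_group G by fact
  interpret H: comm_group H by fact
  show ?thesis
  proof (cases "finite I")
    case True
    then show ?thesis using assms(4)
    proof (induction I)
      case empty
      then show ?case using hom_to_one[OF assms(1-3)] by simp
    next
      case (insert j I)
      have "f (t i) \<in> carrier H" if "i \<in> insert j I" for i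
        using hom_in_carrier[OF assms(1)] insert.prems that by blast
      then have ft: "(\<lambda>i. f (t i)) \<in> I \<rightarrow> carrier H" "f (t j) \<in> carrier H" by auto
      have t: "t \<in> I \<rightarrow> carrier G" "t j \<in> carrier G" using insert.prems by auto
      show ?case
        using insert t ft hom_mult[OF assms(1) t(2) G.finprod_closed[OF t(1)]]
        by (simp add: G.finprod_insert H.finprod_insert)
    qed
  next
    case False
    then show ?thesis using hom_to_one[OF assms(1-3)]
      by (simp add: G.finprod_infinite H.finprod_infinite)
  qed
qed

lemma hom_compose_apply: "f \<in> hom G H \<Longrightarrow> g \<in> hom H K \<Longrightarrow> (\<lambda>x. g (f x)) \<in> hom G K"
  by (auto simp: hom_def Pi_def)

lemma signed_closed [simp]: "comm_group G \<Longrightarrow> x \<in> carrier G \<Longrightarrow> signed G k x \<in> carrier G"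
  by (simp add: signed_def comm_group_def)

lemma signed_one [simp]: "comm_group G \<Longrightarrow> signed G k \<one>\<^bsub>G\<^esub> = \<one>\<^bsub>G\<^esub>"
  by (simp add: signed_def comm_group_def group.is_monoid monoid.inv_one)

lemma signed_mult:
  "comm_group G \<Longrightarrow> x \<in> carrier G \<Longrightarrow> y \<in> carrier G \<Longrightarrow>
    signed G k (x \<otimes>\<^bsub>G\<^esub> y) = signed G k x \<otimes>\<^bsub>G\<^esub> signed G k y"
  by (simp add: signed_def comm_group.inv_mult)

lemma signed_signed:
  "comm_group G \<Longrightarrow> x \<in> carrier G \<Longrightarrow> signed G j (signed G k x) = signed G (j + k) x"
  by (auto simp: signed_def comm_group_def)

context comm_group
begin

lemma finprod_in_carrier: "(\<And>i. i \<in> I \<Longrightarrow> f i \<in> carrier G) \<Longrightarrow> finprod G f I \<in> carrier G"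
  by (rule finprod_closed) auto

lemma finprod_eq:
  assumes "\<And>i. i \<in> I \<Longrightarrow> f i = g i" "\<And>i. i \<in> I \<Longrightarrow> g i \<in> carrier G"
  shows "finprod G f I = finprod G g I"
  using assms by (intro finprod_cong') auto

lemma inv_hom: "(\<lambda>x. inv x) \<in> hom G G"
  by (auto simp: hom_def inv_mult)

lemma finprod_inverse:
  assumes "\<And>i. i \<in> I \<Longrightarrow> f i \<in> carrier G"
  shows "finprod G (\<lambda>i. inv (f i)) I = inv (finprod G f I)"
  using hom_finprod[OF inv_hom, of I f] assms by (simp add: comm_group_axioms)

lemma finprod_mult:
  assumes "\<And>i. i \<in> I \<Longrightarrow> f i \<in> carrier G" "\<And>i. i \<in> I \<Longrightarrow> g i \<in> carrier G"
  shows "finprod G (\<lambda>i. f i \<otimes> g i) I = finprod G f I \<otimes> finprod G g I"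
  using assms by (intro finprod_multf) auto

lemma div_cancel_right:
  assumes "x \<in> carrier G" "y \<in> carrier G" "z \<in> carrier G"
  shows "x \<otimes> inv y = (x \<otimes> z) \<otimes> inv (y \<otimes> z)"
proof -
  have "(x \<otimes> z) \<otimes> inv (y \<otimes> z) = (x \<otimes> inv y) \<otimes> (z \<otimes> inv z)"
    unfolding inv_mult[OF assms(2,3)] using assms inv_closed[OF assms(2)] inv_closed[OF assms(3)]
    by (simp only: m_ac m_closed)
  then show ?thesis using assms by simp
qed

lemma finprod_delta:
  assumes "finite I" "a \<in> I" "x \<in> carrier G"
  shows "finprod G (\<lambda>i. if i = a then x else \<one>) I = x"
  using finprod_singleton[of a I "\<lambda>_. x"] assms by (simp add: eq_commute Pi_def)

lemma finprod_Sigma: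
  assumes "finite A" "\<And>a. a \<in> A \<Longrightarrow> finite (B a)"
    and "\<And>a b. a \<in> A \<Longrightarrow> b \<in> B a \<Longrightarrow> f (a, b) \<in> carrier G"
  shows "finprod G f (Sigma A B) = finprod G (\<lambda>a. finprod G (\<lambda>b. f (a, b)) (B a)) A"
proof -
  have eq: "finprod G f ({a} \<times> B a) = finprod G (\<lambda>b. f (a, b)) (B a)" if "a \<in> A" for a
  proof -
    have "finprod G f (Pair a ` B a) = finprod G (\<lambda>b. f (a, b)) (B a)"
      using assms(3)[OF that] by (intro finprod_reindex) (auto simp: inj_on_def)
    moreover have "Pair a ` B a = {a} \<times> B a" by auto
    ultimately show ?thesis by simp
  qed
  have "finprod G f (\<Union>a\<in>A. {a} \<times> B a) = finprod G (\<lambda>a. finprod G f ({a} \<times> B a)) A"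
    using assms by (intro finprod_UN_disjoint) (auto simp: pairwise_def disjnt_def)
  also have "\<dots> = finprod G (\<lambda>a. finprod G (\<lambda>b. f (a, b)) (B a)) A"
    using assms(3) by (intro finprod_eq) (auto simp: eq intro!: finprod_in_carrier)
  also have "(\<Union>a\<in>A. {a} \<times> B a) = Sigma A B" by auto
  finally show ?thesis .
qed

lemma finprod_bij:
  assumes "bij_betw h I J" "\<And>j. j \<in> J \<Longrightarrow> f j \<in> carrier G"
  shows "finprod G f J = finprod G (\<lambda>i. f (h i)) I"
proof -
  have "finprod G f (h ` I) = finprod G (\<lambda>i. f (h i)) I"
    using assms by (intro finprod_reindex) (auto simp: bij_betw_def)
  then show ?thesis using assms(1) by (simp add: bij_betw_def)
qed

end


section \<open>Elementary properties of graded operads\<close>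

lemma graded_operad_cong:
  assumes "graded_operad P" "cpt P = cpt R" "pcomp P = pcomp R"
  shows "graded_operad R"
  using assms unfolding graded_operad_def by simp

context graded_operad
begin

lemma pcomp_closed:
  assumes "1 \<le> i" "i \<le> m" "x \<in> carr P m a" "y \<in> carr P n b" "N = m + n - 1" "d = a + b"
  shows "pcomp P m a n b i x y \<in> carr P N d"
  using hom_in_carrier[OF pcomp_hom_left[OF assms(1,2,4)] assms(3)] assms(5,6) by simp

lemma pcomp_hom_left':
  assumes "1 \<le> i" "i \<le> m" "y \<in> carr P n b" "N = m + n - 1" "d = a + b"
  shows "(\<lambda>x. pcomp P m a n b i x y) \<in> hom (cpt P m a) (cpt P N d)"
  using pcomp_hom_left[OF assms(1-3)] assms(4,5) by simp

lemma pcomp_hom_right':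
  assumes "1 \<le> i" "i \<le> m" "x \<in> carr P m a" "N = m + n - 1" "d = a + b"
  shows "(\<lambda>y. pcomp P m a n b i x y) \<in> hom (cpt P n b) (cpt P N d)"
  using pcomp_hom_right[OF assms(1-3)] assms(4,5) by simp

lemma pcomp_mult_left:
  assumes "1 \<le> i" "i \<le> m" "x \<in> carr P m a" "x' \<in> carr P m a" "y \<in> carr P n b"
    "N = m + n - 1" "d = a + b"
  shows "pcomp P m a n b i (x \<otimes>\<^bsub>cpt P m a\<^esub> x') y =
    pcomp P m a n b i x y \<otimes>\<^bsub>cpt P N d\<^esub> pcomp P m a n b i x' y"
  using hom_mult[OF pcomp_hom_left'[OF assms(1,2,5,6,7)] assms(3,4)] .

lemma pcomp_mult_right:
  assumes "1 \<le> i" "i \<le> m" "x \<in> carr P m a" "y \<in> carr P n b" "y' \<in> carr P n b"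
    "N = m + n - 1" "d = a + b"
  shows "pcomp P m a n b i x (y \<otimes>\<^bsub>cpt P n b\<^esub> y') =
    pcomp P m a n b i x y \<otimes>\<^bsub>cpt P N d\<^esub> pcomp P m a n b i x y'"
  using hom_mult[OF pcomp_hom_right'[OF assms(1,2,3,6,7)] assms(4,5)] .

lemma pcomp_signed_left:
  assumes "1 \<le> i" "i \<le> m" "x \<in> carr P m a" "y \<in> carr P n b" "N = m + n - 1" "d = a + b"
  shows "pcomp P m a n b i (signed (cpt P m a) k x) y =
    signed (cpt P N d) k (pcomp P m a n b i x y)"
  using hom_signed[OF pcomp_hom_left'[OF assms(1,2,4,5,6)] comm_group_cpt comm_group_cpt assms(3)] .

lemma pcomp_signed_right:
  assumes "1 \<le> i" "i \<le> m" "x \<in> carr P m a" "y \<in> carr P n b" "N = m + n - 1" "d = a + b"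
  shows "pcomp P m a n b i x (signed (cpt P n b) k y) =
    signed (cpt P N d) k (pcomp P m a n b i x y)"
  using hom_signed[OF pcomp_hom_right'[OF assms(1,2,3,5,6)] comm_group_cpt comm_group_cpt assms(4)] .

lemma pcomp_inv_left:
  assumes "1 \<le> i" "i \<le> m" "x \<in> carr P m a" "y \<in> carr P n b" "N = m + n - 1" "d = a + b"
  shows "pcomp P m a n b i (inv\<^bsub>cpt P m a\<^esub> x) y =
    inv\<^bsub>cpt P N d\<^esub> (pcomp P m a n b i x y)"
  using pcomp_signed_left[OF assms, of 1] by (simp add: signed_def)

lemma pcomp_inv_right:
  assumes "1 \<le> i" "i \<le> m" "x \<in> carr P m a" "y \<in> carr P n b" "N = m + n - 1" "d = a + b"
  shows "pcomp P m a n b i x (inv\<^bsub>cpt P n b\<^esub> y) =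
    inv\<^bsub>cpt P N d\<^esub> (pcomp P m a n b i x y)"
  using pcomp_signed_right[OF assms, of 1] by (simp add: signed_def)

lemma pcomp_one_left:
  assumes "1 \<le> i" "i \<le> m" "y \<in> carr P n b" "N = m + n - 1" "d = a + b"
  shows "pcomp P m a n b i \<one>\<^bsub>cpt P m a\<^esub> y = \<one>\<^bsub>cpt P N d\<^esub>"
  using hom_to_one[OF pcomp_hom_left'[OF assms] comm_group_cpt comm_group_cpt] .

lemma pcomp_one_right:
  assumes "1 \<le> i" "i \<le> m" "x \<in> carr P m a" "N = m + n - 1" "d = a + b"
  shows "pcomp P m a n b i x \<one>\<^bsub>cpt P n b\<^esub> = \<one>\<^bsub>cpt P N d\<^esub>"
  using hom_to_one[OF pcomp_hom_right'[OF assms] comm_group_cpt comm_group_cpt] .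

lemma pcomp_finprod_left:
  assumes "1 \<le> i" "i \<le> m" "\<And>j. j \<in> J \<Longrightarrow> f j \<in> carr P m a" "y \<in> carr P n b"
    "N = m + n - 1" "d = a + b"
  shows "pcomp P m a n b i (finprod (cpt P m a) f J) y =
    finprod (cpt P N d) (\<lambda>j. pcomp P m a n b i (f j) y) J"
  using hom_finprod[OF pcomp_hom_left'[OF assms(1,2,4,5,6)] comm_group_cpt comm_group_cpt assms(3)] .

lemma pcomp_finprod_right:
  assumes "1 \<le> i" "i \<le> m" "x \<in> carr P m a" "\<And>j. j \<in> J \<Longrightarrow> f j \<in> carr P n b"
    "N = m + n - 1" "d = a + b"
  shows "pcomp P m a n b i x (finprod (cpt P n b) f J) =
    finprod (cpt P N d) (\<lambda>j. pcomp P m a n b i x (f j)) J"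
  using hom_finprod[OF pcomp_hom_right'[OF assms(1,2,3,5,6)] comm_group_cpt comm_group_cpt assms(4)] .

lemma pcomp_seq':
  assumes "1 \<le> i" "i \<le> m" "1 \<le> j" "j \<le> n" "x \<in> carr P m a" "y \<in> carr P n b" "z \<in> carr P l c"
    "M = m + n - 1" "e = a + b" "k = i - 1 + j" "N = n + l - 1" "f = b + c"
  shows "pcomp P M e l c k (pcomp P m a n b i x y) z = pcomp P m a N f i x (pcomp P n b l c j y z)"
  using pcomp_seq[OF assms(1-7)] assms(8-) by simp

lemma pcomp_par':
  assumes "1 \<le> i" "i < k" "k \<le> m" "x \<in> carr P m a" "y \<in> carr P n b" "z \<in> carr P l c"
    "M = m + n - 1" "e = a + b" "k' = k - 1 + n" "N = m + l - 1" "f = a + c"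
    "L = m + n + l - 2" "g = a + b + c"
  shows "pcomp P M e l c k' (pcomp P m a n b i x y) z =
    signed (cpt P L g) (b * c) (pcomp P N f n b i (pcomp P m a l c k x z) y)"
  using pcomp_par[OF assms(1-6)] assms(7-) by simp

lemma cpt_group [simp]: "group (cpt P n d)" "comm_group (cpt P n d)" "comm_monoid (cpt P n d)" "monoid (cpt P n d)"
  using comm_group_cpt[of n d] by (simp_all add: comm_group_def comm_monoid_def group_def)

lemmas
  mult_closed = monoid.m_closed[OF cpt_group(4)] and
  inv_in_carr = group.inv_closed[OF cpt_group(1)] and
  one_in_carr = monoid.one_closed[OF cpt_group(4)] and
  signed_in_carr = signed_closed[OF cpt_group(2)] and
  finprod_in_carr = comm_group.finprod_in_carrier[OF cpt_group(2)]

end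

lemma suboperadD:
  assumes "suboperad S P"
  shows "subgroup (S n d) (cpt P n d)"
    and "1 \<le> i \<Longrightarrow> i \<le> m \<Longrightarrow> x \<in> S m a \<Longrightarrow> y \<in> S n b \<Longrightarrow> N = m + n - 1 \<Longrightarrow> e = a + b
      \<Longrightarrow> pcomp P m a n b i x y \<in> S N e"
    and "x \<in> S n d \<Longrightarrow> x \<in> carr P n d"
  using assms subgroup.mem_carrier unfolding suboperad_def by fast+

lemma operad_homD:
  assumes "operad_hom P R f"
  shows "f n d \<in> hom (cpt P n d) (cpt R n d)"
    and "1 \<le> i \<Longrightarrow> i \<le> m \<Longrightarrow> x \<in> carr P m a \<Longrightarrow> y \<in> carr P n b \<Longrightarrow> N = m + n - 1 \<Longrightarrow> e = a + b
      \<Longrightarrow> f N e (pcomp P m a n b i x y) = pcomp R m a n b i (f m a x) (f n b y)"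
    and "x \<in> carr P n d \<Longrightarrow> f n d x \<in> carr R n d"
  using assms hom_in_carrier unfolding operad_hom_def by fast+

lemma operad_hom_comp:
  assumes "operad_hom P R f" "operad_hom R T g"
  shows "operad_hom P T (\<lambda>n d x. g n d (f n d x))"
proof -
  have "(\<lambda>x. g n d (f n d x)) \<in> hom (cpt P n d) (cpt T n d)" for n d
    using operad_homD(1)[OF assms(1)] operad_homD(1)[OF assms(2)] by (rule hom_compose_apply)
  moreover have "g (m + n - 1) (a + b) (f (m + n - 1) (a + b) (pcomp P m a n b i x y)) =
      pcomp T m a n b i (g m a (f m a x)) (g n b (f n b y))"
    if "1 \<le> i" "i \<le> m" "x \<in> carr P m a" "y \<in> carr P n b" for m a n b i x y
    using operad_homD(2)[OF assms(1) that refl refl] operad_homD(3)[OF assms(1)] that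
      operad_homD(2)[OF assms(2) that(1,2) _ _ refl refl] by metis
  ultimately show ?thesis
    unfolding operad_hom_def by blast
qed

lemma subgroup_finprod:
  assumes "comm_group G" "subgroup H G" "\<And>i. i \<in> I \<Longrightarrow> f i \<in> H"
  shows "finprod G f I \<in> H"
proof -
  interpret comm_group G by fact
  show ?thesis
  proof (cases "finite I")
    case True
    then show ?thesis using assms(3)
    proof (induction I)
      case empty then show ?case using assms(2) by (simp add: subgroup.one_closed)
    next
      case (insert j I)
      then have "f \<in> I \<rightarrow> carrier G" "f j \<in> carrier G"
        using subgroup.mem_carrier[OF assms(2)] by auto
      then show ?case using insert assms(2) by (simp add: finprod_insert subgroup.m_closed)
    qed
  next
    case False then show ?thesis using assms(2) by (simp add: finprod_infinite subgroup.one_closed)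
  qed
qed

section \<open>Presented operads and their universal property\<close>

fun earity :: "'g expr \<Rightarrow> nat" where
  "earity (Gen n d g) = n"
| "earity (Zero n d) = n"
| "earity (Add s t) = earity s"
| "earity (Neg s) = earity s"
| "earity (Comp i s t) = earity s + earity t - 1"

lemma wf_expr_type: "wf_expr G n d t \<Longrightarrow> earity t = n \<and> edeg t = d"
  by (induction rule: wf_expr.induct) auto

lemma wf_Comp':
  "wf_expr G m a s \<Longrightarrow> wf_expr G n b t \<Longrightarrow> 1 \<le> i \<Longrightarrow> i \<le> m \<Longrightarrow> N = m + n - 1 \<Longrightarrow> d = a + b \<Longrightarrow>
    wf_expr G N d (Comp i s t)"
  using wf_Comp by blast

lemma wf_esigned: "wf_expr G n d t \<Longrightarrow> wf_expr G n d (esigned k t)"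
  by (simp add: esigned_def wf_Neg)

lemma ocong_wf: "ocong G E n d s t \<Longrightarrow> wf_expr G n d s \<and> wf_expr G n d t"
proof (induction rule: ocong.induct)
  case (oc_comp_seq m a s n b t l c u i j)
  have "wf_expr G (m + n + l - 2) (a + b + c) (Comp (i - 1 + j) (Comp i s t) u)"
    using oc_comp_seq(4-7) by (intro wf_Comp'[OF wf_Comp[OF oc_comp_seq(1,2,4,5)] oc_comp_seq(3)]) auto
  moreover have "wf_expr G (m + n + l - 2) (a + b + c) (Comp i s (Comp j t u))"
    using oc_comp_seq(4-7) by (intro wf_Comp'[OF oc_comp_seq(1) wf_Comp[OF oc_comp_seq(2,3,6,7)]]) auto
  ultimately show ?case ..
next
  case (oc_comp_par m a s n b t l c u i k)
  have ik: "i \<le> m" "1 \<le> k" using oc_comp_par by auto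
  have "wf_expr G (m + n + l - 2) (a + b + c) (Comp (k - 1 + n) (Comp i s t) u)"
    using oc_comp_par(4-6) by (intro wf_Comp'[OF wf_Comp[OF oc_comp_par(1,2,4) ik(1)] oc_comp_par(3)]) auto
  moreover have "wf_expr G (m + n + l - 2) (a + b + c) (Comp i (Comp k s u) t)"
    using oc_comp_par(4-6) by (intro wf_Comp'[OF wf_Comp[OF oc_comp_par(1,3) ik(2) oc_comp_par(6)] oc_comp_par(2)]) auto
  ultimately show ?case by (simp add: wf_esigned)
qed (auto intro: wf_expr.intros simp del: One_nat_def)

lemma mem_oclass: "s \<in> oclass G E n d t \<longleftrightarrow> ocong G E n d t s"
  by (simp add: oclass_def)

lemma oclass_self: "wf_expr G n d t \<Longrightarrow> t \<in> oclass G E n d t"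
  by (simp add: mem_oclass oc_refl)

lemma oclass_eqI: "ocong G E n d s t \<Longrightarrow> oclass G E n d s = oclass G E n d t"
  unfolding oclass_def by (blast intro: oc_sym oc_trans)

lemma UN_oclass_const:
  assumes "wf_expr G n d s" "\<And>s'. ocong G E n d s s' \<Longrightarrow> f s' = c"
  shows "(\<Union>s'\<in>oclass G E n d s. f s') = c"
  using assms oclass_self[OF assms(1), of E] by (auto simp: mem_oclass)

lemma presented_carr:
  "carr (presented_operad G E) n d = oclass G E n d ` {t. wf_expr G n d t}"
  by (simp add: presented_operad_def)

lemma oclass_in_carr: "wf_expr G n d t \<Longrightarrow> oclass G E n d t \<in> carr (presented_operad G E) n d"
  by (simp add: presented_carr)

lemma presented_carrE:
  assumes "X \<in> carr (presented_operad G E) n d"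
  obtains t where "wf_expr G n d t" "X = oclass G E n d t"
  using assms by (auto simp: presented_carr)

lemma presented_one: "\<one>\<^bsub>cpt (presented_operad G E) n d\<^esub> = oclass G E n d (Zero n d)"
  by (simp add: presented_operad_def)

lemma presented_mult:
  assumes "wf_expr G n d s" "wf_expr G n d t"
  shows "oclass G E n d s \<otimes>\<^bsub>cpt (presented_operad G E) n d\<^esub> oclass G E n d t =
    oclass G E n d (Add s t)"
proof -
  have "(\<Union>t'\<in>oclass G E n d t. oclass G E n d (Add s' t')) = oclass G E n d (Add s t)"
    if "ocong G E n d s s'" for s'
    using assms(2)
    by (rule UN_oclass_const) (intro oclass_eqI oc_Add oc_sym[OF that], rule oc_sym)
  then show ?thesis
    unfolding presented_operad_def by (simp add: UN_oclass_const[OF assms(1)])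
qed

lemma presented_pcomp:
  assumes "wf_expr G m a s" "wf_expr G n b t" "1 \<le> i" "i \<le> m" "N = m + n - 1" "d = a + b"
  shows "pcomp (presented_operad G E) m a n b i (oclass G E m a s) (oclass G E n b t) =
    oclass G E N d (Comp i s t)"
proof -
  have "(\<Union>t'\<in>oclass G E n b t. oclass G E N d (Comp i s' t')) = oclass G E N d (Comp i s t)"
    if "ocong G E m a s s'" for s'
    using assms(2) unfolding assms(5,6)
    by (rule UN_oclass_const) (intro oclass_eqI oc_Comp oc_sym[OF that] assms(3,4), rule oc_sym)
  then show ?thesis
    using assms(5,6) unfolding presented_operad_def by (simp add: UN_oclass_const[OF assms(1)])
qed

lemma presented_comm_group: "comm_group (cpt (presented_operad G E) n d)"
proof (rule comm_groupI)
  let ?H = "cpt (presented_operad G E) n d"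
  show "\<exists>y\<in>carrier ?H. y \<otimes>\<^bsub>?H\<^esub> x = \<one>\<^bsub>?H\<^esub>" if x: "x \<in> carrier ?H" for x
  proof -
    obtain t where t: "wf_expr G n d t" "x = oclass G E n d t"
      using x by (rule presented_carrE)
    then have "oclass G E n d (Neg t) \<otimes>\<^bsub>?H\<^esub> x = \<one>\<^bsub>?H\<^esub>"
      by (simp add: presented_mult presented_one wf_Neg oclass_eqI[OF oc_add_neg])
    then show ?thesis using t by (meson oclass_in_carr wf_Neg)
  qed
  show "x \<otimes>\<^bsub>?H\<^esub> y = y \<otimes>\<^bsub>?H\<^esub> x" if xy: "x \<in> carrier ?H" "y \<in> carrier ?H" for x y
    using presented_carrE[OF xy(1)] presented_carrE[OF xy(2)]
    by (metis oclass_eqI oc_add_comm presented_mult)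
qed (auto elim!: presented_carrE simp: presented_mult presented_one wf_Add wf_Zero oclass_in_carr
      oclass_eqI[OF oc_add_assoc] oclass_eqI[OF oc_add_zero]
      intro!: oclass_eqI[OF oc_add_comm])

lemma presented_inv:
  assumes "wf_expr G n d t"
  shows "inv\<^bsub>cpt (presented_operad G E) n d\<^esub> (oclass G E n d t) = oclass G E n d (Neg t)"
proof -
  interpret comm_group "cpt (presented_operad G E) n d" by (rule presented_comm_group)
  show ?thesis using assms
    by (intro inv_equality) (simp_all add: presented_mult presented_one wf_Neg oclass_in_carr
        oclass_eqI[OF oc_add_neg])
qed

lemma presented_signed:
  assumes "wf_expr G n d t"
  shows "signed (cpt (presented_operad G E) n d) k (oclass G E n d t) = oclass G E n d (esigned k t)"
  using presented_inv[OF assms] by (simp add: signed_def esigned_def)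

text \<open>
  Every axiom of an operad is one of the rules generating the congruence, so that it holds for the
  classes.\<close>

theorem graded_operad_presented: "graded_operad (presented_operad G E)"
proof (rule graded_operad.intro)
  let ?P = "presented_operad G E"
  show "comm_group (cpt ?P n d)" for n d by (rule presented_comm_group)
  show "(\<lambda>x. pcomp ?P m a n b i x y) \<in> hom (cpt ?P m a) (cpt ?P (m + n - 1) (a + b))"
    if i: "1 \<le> i" "i \<le> m" and y: "y \<in> carr ?P n b" for i m y n b a
  proof (rule homI)
    obtain u where u: "wf_expr G n b u" "y = oclass G E n b u"
      using y by (rule presented_carrE)
    show "pcomp ?P m a n b i x y \<in> carr ?P (m + n - 1) (a + b)" if "x \<in> carr ?P m a" for x
      using that u i by (auto elim!: presented_carrE simp: presented_pcomp[OF _ _ i refl refl]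
          simp del: One_nat_def intro!: oclass_in_carr wf_Comp)
    show "pcomp ?P m a n b i (x \<otimes>\<^bsub>cpt ?P m a\<^esub> x') y =
        pcomp ?P m a n b i x y \<otimes>\<^bsub>cpt ?P (m + n - 1) (a + b)\<^esub> pcomp ?P m a n b i x' y"
      if cs: "x \<in> carr ?P m a" "x' \<in> carr ?P m a" for x x'
    proof -
      obtain s t where st: "wf_expr G m a s" "x = oclass G E m a s" "wf_expr G m a t" "x' = oclass G E m a t"
        using cs by (auto elim!: presented_carrE)
      show ?thesis unfolding st(2,4) u(2)
        presented_mult[OF st(1,3)] presented_pcomp[OF st(1) u(1) i refl refl]
        presented_pcomp[OF st(3) u(1) i refl refl]
        presented_pcomp[OF wf_Add[OF st(1,3)] u(1) i refl refl]
        presented_mult[OF wf_Comp[OF st(1) u(1) i] wf_Comp[OF st(3) u(1) i]]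
        by (rule oclass_eqI[OF oc_comp_add_left[OF st(1,3) u(1) i]])
    qed
  qed
  show "(\<lambda>y. pcomp ?P m a n b i x y) \<in> hom (cpt ?P n b) (cpt ?P (m + n - 1) (a + b))"
    if i: "1 \<le> i" "i \<le> m" and x: "x \<in> carr ?P m a" for i m x n b a
  proof (rule homI)
    obtain s where s: "wf_expr G m a s" "x = oclass G E m a s"
      using x by (rule presented_carrE)
    show "pcomp ?P m a n b i x y \<in> carr ?P (m + n - 1) (a + b)" if "y \<in> carr ?P n b" for y
      using that s i by (auto elim!: presented_carrE simp: presented_pcomp[OF _ _ i refl refl]
          simp del: One_nat_def intro!: oclass_in_carr wf_Comp)
    show "pcomp ?P m a n b i x (y \<otimes>\<^bsub>cpt ?P n b\<^esub> y') =
        pcomp ?P m a n b i x y \<otimes>\<^bsub>cpt ?P (m + n - 1) (a + b)\<^esub> pcomp ?P m a n b i x y'"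
      if cs: "y \<in> carr ?P n b" "y' \<in> carr ?P n b" for y y'
    proof -
      obtain t u where tu: "wf_expr G n b t" "y = oclass G E n b t" "wf_expr G n b u" "y' = oclass G E n b u"
        using cs by (auto elim!: presented_carrE)
      show ?thesis unfolding tu(2,4) s(2)
        presented_mult[OF tu(1,3)] presented_pcomp[OF s(1) tu(1) i refl refl]
        presented_pcomp[OF s(1) tu(3) i refl refl]
        presented_pcomp[OF s(1) wf_Add[OF tu(1,3)] i refl refl]
        presented_mult[OF wf_Comp[OF s(1) tu(1) i] wf_Comp[OF s(1) tu(3) i]]
        by (rule oclass_eqI[OF oc_comp_add_right[OF s(1) tu(1,3) i]])
    qed
  qed
  show "pcomp ?P (m + n - 1) (a + b) l c (i - 1 + j) (pcomp ?P m a n b i x y) z =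
      pcomp ?P m a (n + l - 1) (b + c) i x (pcomp ?P n b l c j y z)"
    if ij: "1 \<le> i" "i \<le> m" "1 \<le> j" "j \<le> n"
      and xyz: "x \<in> carr ?P m a" "y \<in> carr ?P n b" "z \<in> carr ?P l c"
    for i m j n x a y b z l c
  proof -
    obtain s t u where s: "wf_expr G m a s" "x = oclass G E m a s"
      and t: "wf_expr G n b t" "y = oclass G E n b t"
      and u: "wf_expr G l c u" "z = oclass G E l c u"
      using xyz by (auto elim!: presented_carrE)
    have "pcomp ?P (m + n - 1) (a + b) l c (i - 1 + j) (pcomp ?P m a n b i x y) z =
        oclass G E (m + n + l - 2) (a + b + c) (Comp (i - 1 + j) (Comp i s t) u)"
      unfolding s(2) t(2) u(2) presented_pcomp[OF s(1) t(1) ij(1,2) refl refl]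
      using ij by (intro presented_pcomp wf_Comp s t u) auto
    also have "\<dots> = oclass G E (m + n + l - 2) (a + b + c) (Comp i s (Comp j t u))"
      by (intro oclass_eqI oc_comp_seq s t u ij)
    also have "\<dots> = pcomp ?P m a (n + l - 1) (b + c) i x (pcomp ?P n b l c j y z)"
      unfolding s(2) t(2) u(2) presented_pcomp[OF t(1) u(1) ij(3,4) refl refl]
      using ij by (intro presented_pcomp[symmetric] wf_Comp s t u) auto
    finally show ?thesis .
  qed
  show "pcomp ?P (m + n - 1) (a + b) l c (k - 1 + n) (pcomp ?P m a n b i x y) z =
      signed (cpt ?P (m + n + l - 2) (a + b + c)) (b * c)
        (pcomp ?P (m + l - 1) (a + c) n b i (pcomp ?P m a l c k x z) y)"
    if ik: "1 \<le> i" "i < k" "k \<le> m"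
      and xyz: "x \<in> carr ?P m a" "y \<in> carr ?P n b" "z \<in> carr ?P l c"
    for i m k x a y n b z l c
  proof -
    obtain s t u where s: "wf_expr G m a s" "x = oclass G E m a s"
      and t: "wf_expr G n b t" "y = oclass G E n b t"
      and u: "wf_expr G l c u" "z = oclass G E l c u"
      using xyz by (auto elim!: presented_carrE)
    have i: "i \<le> m" and k: "1 \<le> k" using ik by auto
    have "wf_expr G (m + n + l - 2) (a + b + c) (Comp i (Comp k s u) t)"
      using ik by (intro wf_Comp'[OF wf_Comp[OF s(1) u(1) k ik(3)] t(1)]) auto
    note signed = presented_signed[OF this, of E "b * c"]
    have "pcomp ?P (m + n - 1) (a + b) l c (k - 1 + n) (pcomp ?P m a n b i x y) z =
        oclass G E (m + n + l - 2) (a + b + c) (Comp (k - 1 + n) (Comp i s t) u)"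
      unfolding s(2) t(2) u(2) presented_pcomp[OF s(1) t(1) ik(1) i refl refl]
      using ik by (intro presented_pcomp wf_Comp s t u) auto
    also have "\<dots> = oclass G E (m + n + l - 2) (a + b + c) (esigned (b * c) (Comp i (Comp k s u) t))"
      by (intro oclass_eqI oc_comp_par s t u ik)
    also have "oclass G E (m + n + l - 2) (a + b + c) (Comp i (Comp k s u) t) =
        pcomp ?P (m + l - 1) (a + c) n b i (pcomp ?P m a l c k x z) y"
      unfolding s(2) t(2) u(2) presented_pcomp[OF s(1) u(1) k ik(3) refl refl]
      using ik by (intro presented_pcomp[symmetric] wf_Comp s t u) auto
    then have "oclass G E (m + n + l - 2) (a + b + c) (esigned (b * c) (Comp i (Comp k s u) t)) =
      signed (cpt ?P (m + n + l - 2) (a + b + c)) (b * c)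
        (pcomp ?P (m + l - 1) (a + c) n b i (pcomp ?P m a l c k x z) y)"
      using signed by simp
    finally show ?thesis .
  qed
qed

fun eval :: "('b, 'k) goperad_scheme \<Rightarrow> (nat \<Rightarrow> int \<Rightarrow> 'g \<Rightarrow> 'b) \<Rightarrow> 'g expr \<Rightarrow> 'b" where
  "eval R \<gamma> (Gen n d g) = \<gamma> n d g"
| "eval R \<gamma> (Zero n d) = \<one>\<^bsub>cpt R n d\<^esub>"
| "eval R \<gamma> (Add s t) = eval R \<gamma> s \<otimes>\<^bsub>cpt R (earity s) (edeg s)\<^esub> eval R \<gamma> t"
| "eval R \<gamma> (Neg s) = inv\<^bsub>cpt R (earity s) (edeg s)\<^esub> (eval R \<gamma> s)"
| "eval R \<gamma> (Comp i s t) =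
     pcomp R (earity s) (edeg s) (earity t) (edeg t) i (eval R \<gamma> s) (eval R \<gamma> t)"

text \<open>
  A class is evaluated on an arbitrary representative; for a map of generators that respects the
  relations the choice is irrelevant (\<open>induced_map_oclass\<close>).\<close>

definition induced_map ::
  "('b, 'k) goperad_scheme \<Rightarrow> (nat \<Rightarrow> int \<Rightarrow> 'g \<Rightarrow> 'b) \<Rightarrow> nat \<Rightarrow> int \<Rightarrow> 'g expr set \<Rightarrow> 'b" where
  "induced_map R \<gamma> n d X = eval R \<gamma> (SOME t. t \<in> X)"

text \<open>
  The generators interpreted in an operad such that the relations hold. The axioms of an operad
  are sound for such an interpretation, so that it induces a morphism from the presented operad.\<close>

locale operad_model = graded_operad R
  for R :: "('b, 'k) goperad_scheme" +
  fixes G :: "nat \<Rightarrow> int \<Rightarrow> 'g set"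
    and E :: "nat \<Rightarrow> int \<Rightarrow> 'g expr \<Rightarrow> 'g expr \<Rightarrow> bool"
    and \<gamma> :: "nat \<Rightarrow> int \<Rightarrow> 'g \<Rightarrow> 'b"
  assumes gen_closed: "g \<in> G n d \<Longrightarrow> \<gamma> n d g \<in> carr R n d"
    and rel_eval: "\<lbrakk>E n d s t; wf_expr G n d s; wf_expr G n d t\<rbrakk> \<Longrightarrow> eval R \<gamma> s = eval R \<gamma> t"
begin

lemma eval_closed: "wf_expr G n d t \<Longrightarrow> eval R \<gamma> t \<in> carr R n d"
proof (induction rule: wf_expr.induct)
  case (wf_Comp m a s n b t i)
  then show ?case using wf_expr_type[OF wf_Comp(1)] wf_expr_type[OF wf_Comp(2)]
    by (auto intro!: pcomp_closed)
qed (auto dest: wf_expr_type simp: gen_closed mult_closed inv_in_carr one_in_carr)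

lemma eval_Add: "wf_expr G n d s \<Longrightarrow> eval R \<gamma> (Add s t) = eval R \<gamma> s \<otimes>\<^bsub>cpt R n d\<^esub> eval R \<gamma> t"
  using wf_expr_type[of G n d s] by simp

lemma eval_Neg: "wf_expr G n d s \<Longrightarrow> eval R \<gamma> (Neg s) = inv\<^bsub>cpt R n d\<^esub> (eval R \<gamma> s)"
  using wf_expr_type[of G n d s] by simp

lemma eval_Comp: "wf_expr G m a s \<Longrightarrow> wf_expr G n b t \<Longrightarrow>
    eval R \<gamma> (Comp i s t) = pcomp R m a n b i (eval R \<gamma> s) (eval R \<gamma> t)"
  using wf_expr_type[of G m a s] wf_expr_type[of G n b t] by simp

lemma eval_esigned:
  "wf_expr G n d s \<Longrightarrow> eval R \<gamma> (esigned k s) = signed (cpt R n d) k (eval R \<gamma> s)"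
  by (simp add: esigned_def signed_def eval_Neg del: eval.simps)

lemma eval_ocong: "ocong G E n d s t \<Longrightarrow> eval R \<gamma> s = eval R \<gamma> t"
proof (induction rule: ocong.induct)
  case (oc_Comp m a s s' n b t t' i)
  note wf = ocong_wf[OF oc_Comp(1)] ocong_wf[OF oc_Comp(2)]
  show ?case using wf oc_Comp.IH eval_Comp[of m a _ n b] by metis
next
  case (oc_comp_add_left m a s t n b u i)
  then show ?case
    by (simp add: eval_Comp[of m a _ n b] eval_Add[of m a] eval_Add[OF wf_Comp[of _ m a _ n b]]
        wf_Add eval_closed pcomp_mult_left del: eval.simps)
next
  case (oc_comp_add_right m a s n b t u i)
  then show ?case
    by (simp add: eval_Comp[of m a _ n b] eval_Add[of n b] eval_Add[OF wf_Comp[of _ m a _ n b]]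
        wf_Add eval_closed pcomp_mult_right del: eval.simps)
next
  case (oc_comp_seq m a s n b t l c u i j)
  note wf = wf_Comp[OF oc_comp_seq(1,2,4,5)] wf_Comp[OF oc_comp_seq(2,3,6,7)]
  show ?case
    unfolding eval_Comp[OF wf(1) oc_comp_seq(3)] eval_Comp[OF oc_comp_seq(1) wf(2)]
      eval_Comp[OF oc_comp_seq(1,2)] eval_Comp[OF oc_comp_seq(2,3)]
    using oc_comp_seq by (intro pcomp_seq eval_closed)
next
  case (oc_comp_par m a s n b t l c u i k)
  have ik: "i \<le> m" "1 \<le> k" using oc_comp_par by auto
  note wf = wf_Comp[OF oc_comp_par(1,2,4) ik(1)] wf_Comp[OF oc_comp_par(1,3) ik(2) oc_comp_par(6)]
  have "wf_expr G (m + n + l - 2) (a + b + c) (Comp i (Comp k s u) t)"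
    using oc_comp_par(4-6) by (intro wf_Comp'[OF wf(2) oc_comp_par(2)]) auto
  then show ?case
    unfolding eval_esigned[OF \<open>wf_expr G (m + n + l - 2) (a + b + c) (Comp i (Comp k s u) t)\<close>]
      eval_Comp[OF wf(1) oc_comp_par(3)] eval_Comp[OF wf(2) oc_comp_par(2)]
      eval_Comp[OF oc_comp_par(1,2)] eval_Comp[OF oc_comp_par(1,3)]
    using oc_comp_par by (intro pcomp_par eval_closed)
next
  case (oc_Add n d s s' t t')
  show ?case using oc_Add.IH ocong_wf[OF oc_Add(1)] by (simp add: eval_Add[of n d] del: eval.simps)
next
  case (oc_Neg n d s s')
  show ?case using oc_Neg.IH ocong_wf[OF oc_Neg(1)] by (simp add: eval_Neg[of n d] del: eval.simps)
next
  case (oc_rel n d s t) then show ?case by (rule rel_eval)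
next
  case (oc_add_assoc n d s t u)
  then show ?case
    by (simp add: eval_Add[of n d] wf_Add monoid.m_assoc[of "cpt R n d"] eval_closed del: eval.simps)
next
  case (oc_add_comm n d s t)
  then show ?case
    by (simp add: eval_Add[of n d] comm_monoid.m_comm[of "cpt R n d"] eval_closed del: eval.simps)
next
  case (oc_add_zero n d s)
  then show ?case
    by (simp add: eval_Add[of n d] wf_Zero eval_closed group.is_monoid monoid.l_one del: eval.simps(3))
next
  case (oc_add_neg n d s)
  then show ?case
    by (simp add: eval_Add[of n d] eval_Neg[of n d] wf_Neg eval_closed group.l_inv del: eval.simps(3,4))
qed simp_all

lemma induced_map_oclass:
  "wf_expr G n d t \<Longrightarrow> induced_map R \<gamma> n d (oclass G E n d t) = eval R \<gamma> t"
  using eval_ocong someI[of "\<lambda>s. s \<in> oclass G E n d t", OF oclass_self]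
  unfolding induced_map_def by (metis mem_oclass)

lemma induced_map_hom: "operad_hom (presented_operad G E) R (induced_map R \<gamma>)"
proof -
  let ?P = "presented_operad G E" and ?f = "induced_map R \<gamma>"
  have "?f n d \<in> hom (cpt ?P n d) (cpt R n d)" for n d
    by (rule homI) (auto elim!: presented_carrE simp: induced_map_oclass eval_closed
        presented_mult wf_Add eval_Add[of n d] simp del: eval.simps)
  moreover have "?f (m + n - 1) (a + b) (pcomp ?P m a n b i x y) =
      pcomp R m a n b i (?f m a x) (?f n b y)"
    if i: "1 \<le> i" "i \<le> m" and xy: "x \<in> carr ?P m a" "y \<in> carr ?P n b" for m a n b i x y
  proof -
    obtain s t where "wf_expr G m a s" "x = oclass G E m a s"
      "wf_expr G n b t" "y = oclass G E n b t"
      using xy by (auto elim!: presented_carrE)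
    with i show ?thesis
      by (simp add: presented_pcomp[OF _ _ i refl refl] induced_map_oclass wf_Comp
          induced_map_oclass[OF wf_Comp] eval_Comp[of m a _ n b] del: One_nat_def eval.simps)
  qed
  ultimately show ?thesis unfolding operad_hom_def by blast
qed

end

lemma presented_gen_closed: "g \<in> G n d \<Longrightarrow> oclass G E n d (Gen n d g) \<in> carr (presented_operad G E) n d"
  by (simp add: oclass_in_carr wf_Gen)

lemma equalizer_subgroup:
  assumes "f \<in> hom G H" "g \<in> hom G H" "comm_group G" "comm_group H"
  shows "subgroup {x \<in> carrier G. f x = g x} G"
proof -
  interpret G: comm_group G by fact
  have "f (inv\<^bsub>G\<^esub> x) = g (inv\<^bsub>G\<^esub> x)" if "x \<in> carrier G" "f x = g x" for x
    using hom_inv[OF assms(1,3,4)] hom_inv[OF assms(2,3,4)] that by simp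
  moreover have "\<one>\<^bsub>G\<^esub> \<in> {x \<in> carrier G. f x = g x}"
    using hom_to_one[OF assms(1,3,4)] hom_to_one[OF assms(2,3,4)] by simp
  ultimately show ?thesis
    by (intro G.subgroupI) (auto simp: hom_mult[OF assms(1)] hom_mult[OF assms(2)])
qed

lemma equalizer_suboperad:
  assumes f: "operad_hom P R f" and g: "operad_hom P R g"
    and P: "graded_operad P" and R: "graded_operad R"
  shows "suboperad (\<lambda>n d. {x \<in> carr P n d. f n d x = g n d x}) P"
  unfolding suboperad_def
proof (intro conjI allI impI)
  show "subgroup {x \<in> carr P n d. f n d x = g n d x} (cpt P n d)" for n d
    using operad_homD(1)[OF f] operad_homD(1)[OF g]
      graded_operad.comm_group_cpt[OF P] graded_operad.comm_group_cpt[OF R]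
    by (rule equalizer_subgroup)
  show "pcomp P m a n b i x y \<in> {z \<in> carr P (m + n - 1) (a + b).
      f (m + n - 1) (a + b) z = g (m + n - 1) (a + b) z}"
    if *: "1 \<le> i \<and> i \<le> m \<and> x \<in> {x \<in> carr P m a. f m a x = g m a x} \<and>
      y \<in> {x \<in> carr P n b. f n b x = g n b x}" for m a n b i x y
  proof -
    have i: "1 \<le> i" "i \<le> m" and xy: "x \<in> carr P m a" "y \<in> carr P n b" using * by auto
    show ?thesis
      using graded_operad.pcomp_closed[OF P i xy refl refl] *
        operad_homD(2)[OF f i xy refl refl] operad_homD(2)[OF g i xy refl refl] by simp
  qed
qed

text \<open>
  Induction on expressions: a suboperad of a presented operad that contains the generators is
  everything. Properties of elements are proved below by showing that they define a suboperad.\<close>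

lemma presented_generated:
  assumes S: "suboperad S (presented_operad G E)"
    and gens: "\<And>n d x. x \<in> G n d \<Longrightarrow> oclass G E n d (Gen n d x) \<in> S n d"
    and X: "X \<in> carr (presented_operad G E) n d"
  shows "X \<in> S n d"
proof -
  let ?P = "presented_operad G E"
  note sub = suboperadD(1)[OF S]
  have "oclass G E n d t \<in> S n d" if "wf_expr G n d t" for n d t
    using that
  proof (induction rule: wf_expr.induct)
    case (wf_Gen x n d) then show ?case by (rule gens)
  next
    case (wf_Zero n d)
    show ?case using subgroup.one_closed[OF sub] by (simp add: presented_one)
  next
    case (wf_Add n d s t)
    then show ?case using subgroup.m_closed[OF sub] presented_mult by metis
  next
    case (wf_Neg n d s)
    then show ?case using subgroup.m_inv_closed[OF sub] presented_inv by metis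
  next
    case (wf_Comp m a s n b t i)
    then show ?case
      using suboperadD(2)[OF S wf_Comp(3,4) wf_Comp.IH refl refl]
      by (simp add: presented_pcomp[OF wf_Comp(1-4) refl refl] del: One_nat_def)
  qed
  then show ?thesis using X by (metis presented_carrE)
qed

lemma presented_hom_unique:
  assumes f: "operad_hom (presented_operad G E) R f" and g: "operad_hom (presented_operad G E) R g"
    and R: "graded_operad R"
    and gens: "\<And>n d x. x \<in> G n d \<Longrightarrow> f n d (oclass G E n d (Gen n d x)) = g n d (oclass G E n d (Gen n d x))"
    and X: "X \<in> carr (presented_operad G E) n d"
  shows "f n d X = g n d X"
  using presented_generated[OF equalizer_suboperad[OF f g graded_operad_presented R] _ X] gens
  by (simp add: presented_gen_closed)


section \<open>Derivations\<close>

text \<open>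
  The right-hand side of the Leibniz rule of degree \<open>-1\<close> for \<open>x \<circ>\<^sub>i y\<close>, where the derivatives
  \<open>x'\<close> and \<open>y'\<close> are arguments of their own. In this form the compatibility with the operad axioms can
  be shown before any derivation is available.\<close>

definition leibniz ::
  "('a, 'm) goperad_scheme \<Rightarrow> nat \<Rightarrow> int \<Rightarrow> nat \<Rightarrow> int \<Rightarrow> nat \<Rightarrow> 'a \<Rightarrow> 'a \<Rightarrow> 'a \<Rightarrow> 'a \<Rightarrow> 'a" where
  "leibniz P m a n b i x x' y y' =
     pcomp P m (a - 1) n b i x' y \<otimes>\<^bsub>cpt P (m + n - 1) (a + b - 1)\<^esub>
     signed (cpt P (m + n - 1) (a + b - 1)) a (pcomp P m a n (b - 1) i x y')"

definition derivation :: "('a, 'm) goperad_scheme \<Rightarrow> (nat \<Rightarrow> int \<Rightarrow> 'a \<Rightarrow> 'a) \<Rightarrow> bool" where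
  "derivation P D \<longleftrightarrow>
     (\<forall>n d. D n d \<in> hom (cpt P n d) (cpt P n (d - 1))) \<and>
     (\<forall>m a n b i x y. 1 \<le> i \<and> i \<le> m \<and> x \<in> carr P m a \<and> y \<in> carr P n b \<longrightarrow>
        D (m + n - 1) (a + b) (pcomp P m a n b i x y) =
        leibniz P m a n b i x (D m a x) y (D n b y))"

lemma derivationD:
  assumes "derivation P D"
  shows "D n d \<in> hom (cpt P n d) (cpt P n (d - 1))"
    and "1 \<le> i \<Longrightarrow> i \<le> m \<Longrightarrow> x \<in> carr P m a \<Longrightarrow> y \<in> carr P n b \<Longrightarrow> N = m + n - 1 \<Longrightarrow> e = a + b
      \<Longrightarrow> D N e (pcomp P m a n b i x y) = leibniz P m a n b i x (D m a x) y (D n b y)"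
    and "x \<in> carr P n d \<Longrightarrow> D n d x \<in> carr P n (d - 1)"
  using assms hom_in_carrier unfolding derivation_def by fast+

lemma signed_parity: "even j = even k \<Longrightarrow> signed G j x = signed G k x"
  by (simp add: signed_def)

context graded_operad
begin

lemma mult_swap_inner:
  assumes "x \<in> carr P n d" "y \<in> carr P n d" "z \<in> carr P n d" "w \<in> carr P n d"
  shows "(x \<otimes>\<^bsub>cpt P n d\<^esub> y) \<otimes>\<^bsub>cpt P n d\<^esub> (z \<otimes>\<^bsub>cpt P n d\<^esub> w) =
    (x \<otimes>\<^bsub>cpt P n d\<^esub> z) \<otimes>\<^bsub>cpt P n d\<^esub> (y \<otimes>\<^bsub>cpt P n d\<^esub> w)"
proof -
  interpret comm_group "cpt P n d" by simp
  show ?thesis using assms by (simp add: m_ac)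
qed

lemma leibniz_mult_left:
  assumes "1 \<le> i" "i \<le> m" "x \<in> carr P m a" "x' \<in> carr P m (a - 1)"
    "u \<in> carr P m a" "u' \<in> carr P m (a - 1)" "y \<in> carr P n b" "y' \<in> carr P n (b - 1)"
  shows "leibniz P m a n b i (x \<otimes>\<^bsub>cpt P m a\<^esub> u) (x' \<otimes>\<^bsub>cpt P m (a - 1)\<^esub> u') y y' =
    leibniz P m a n b i x x' y y' \<otimes>\<^bsub>cpt P (m + n - 1) (a + b - 1)\<^esub> leibniz P m a n b i u u' y y'"
proof -
  let ?N = "m + n - 1" and ?d = "a + b - 1"
  have 1: "pcomp P m (a - 1) n b i (x' \<otimes>\<^bsub>cpt P m (a - 1)\<^esub> u') y =
      pcomp P m (a - 1) n b i x' y \<otimes>\<^bsub>cpt P ?N ?d\<^esub> pcomp P m (a - 1) n b i u' y"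
    using assms by (intro pcomp_mult_left) auto
  have 2: "pcomp P m a n (b - 1) i (x \<otimes>\<^bsub>cpt P m a\<^esub> u) y' =
      pcomp P m a n (b - 1) i x y' \<otimes>\<^bsub>cpt P ?N ?d\<^esub> pcomp P m a n (b - 1) i u y'"
    using assms by (intro pcomp_mult_left) auto
  have c: "pcomp P m (a - 1) n b i x' y \<in> carr P ?N ?d" "pcomp P m (a - 1) n b i u' y \<in> carr P ?N ?d"
    "pcomp P m a n (b - 1) i x y' \<in> carr P ?N ?d" "pcomp P m a n (b - 1) i u y' \<in> carr P ?N ?d"
    using assms by (auto intro!: pcomp_closed)
  show ?thesis
    unfolding leibniz_def 1 2 signed_mult[OF comm_group_cpt c(3,4)]
    using c by (intro mult_swap_inner signed_in_carr)
qed

lemma leibniz_mult_right: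
  assumes "1 \<le> i" "i \<le> m" "x \<in> carr P m a" "x' \<in> carr P m (a - 1)"
    "y \<in> carr P n b" "y' \<in> carr P n (b - 1)" "u \<in> carr P n b" "u' \<in> carr P n (b - 1)"
  shows "leibniz P m a n b i x x' (y \<otimes>\<^bsub>cpt P n b\<^esub> u) (y' \<otimes>\<^bsub>cpt P n (b - 1)\<^esub> u') =
    leibniz P m a n b i x x' y y' \<otimes>\<^bsub>cpt P (m + n - 1) (a + b - 1)\<^esub> leibniz P m a n b i x x' u u'"
proof -
  let ?N = "m + n - 1" and ?d = "a + b - 1"
  have 1: "pcomp P m a n (b - 1) i x (y' \<otimes>\<^bsub>cpt P n (b - 1)\<^esub> u') =
      pcomp P m a n (b - 1) i x y' \<otimes>\<^bsub>cpt P ?N ?d\<^esub> pcomp P m a n (b - 1) i x u'"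
    using assms by (intro pcomp_mult_right) auto
  have 2: "pcomp P m (a - 1) n b i x' (y \<otimes>\<^bsub>cpt P n b\<^esub> u) =
      pcomp P m (a - 1) n b i x' y \<otimes>\<^bsub>cpt P ?N ?d\<^esub> pcomp P m (a - 1) n b i x' u"
    using assms by (intro pcomp_mult_right) auto
  have c: "pcomp P m (a - 1) n b i x' y \<in> carr P ?N ?d" "pcomp P m (a - 1) n b i x' u \<in> carr P ?N ?d"
    "pcomp P m a n (b - 1) i x y' \<in> carr P ?N ?d" "pcomp P m a n (b - 1) i x u' \<in> carr P ?N ?d"
    using assms by (auto intro!: pcomp_closed)
  show ?thesis
    unfolding leibniz_def 1 2 signed_mult[OF comm_group_cpt c(3,4)]
    using c by (intro mult_swap_inner signed_in_carr)
qed

text \<open>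
  The next two lemmas say that the sequential and the parallel axiom are consistent with the Leibniz
  rule: differentiating both sides of the axiom gives the same element. They are what makes
  a derivation of a free operad well defined.\<close>

lemma leibniz_seq:
  assumes ij: "1 \<le> i" "i \<le> m" "1 \<le> j" "j \<le> n"
    and x: "x \<in> carr P m a" "x' \<in> carr P m (a - 1)"
    and y: "y \<in> carr P n b" "y' \<in> carr P n (b - 1)"
    and z: "z \<in> carr P l c" "z' \<in> carr P l (c - 1)"
  shows "leibniz P (m + n - 1) (a + b) l c (i - 1 + j)
      (pcomp P m a n b i x y) (leibniz P m a n b i x x' y y') z z' =
    leibniz P m a (n + l - 1) (b + c) i x x' (pcomp P n b l c j y z) (leibniz P n b l c j y y' z z')"
proof -
  let ?N = "m + n + l - 2" and ?d = "a + b + c - 1"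
  let ?H = "cpt P ?N ?d" and ?k = "i - 1 + j"
  have k: "1 \<le> ?k" "?k \<le> m + n - 1" and N: "?N = m + n - 1 + l - 1" "?N = m + (n + l - 1) - 1"
    using ij by auto
  interpret H: comm_group ?H by simp
  define A where "A = pcomp P m (a - 1) (n + l - 1) (b + c) i x' (pcomp P n b l c j y z)"
  define B where "B = pcomp P m a (n + l - 1) (b - 1 + c) i x (pcomp P n (b - 1) l c j y' z)"
  define C where "C = pcomp P m a (n + l - 1) (b + (c - 1)) i x (pcomp P n b l (c - 1) j y z')"
  have c: "A \<in> carrier ?H" "B \<in> carrier ?H" "C \<in> carrier ?H"
    unfolding A_def B_def C_def N(2) using ij x y z by (auto intro!: pcomp_closed)
  have "pcomp P (m + n - 1) (a + b - 1) l c ?k (leibniz P m a n b i x x' y y') z =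
      pcomp P (m + n - 1) (a + b - 1) l c ?k (pcomp P m (a - 1) n b i x' y) z \<otimes>\<^bsub>?H\<^esub>
      pcomp P (m + n - 1) (a + b - 1) l c ?k
        (signed (cpt P (m + n - 1) (a + b - 1)) a (pcomp P m a n (b - 1) i x y')) z"
    unfolding leibniz_def using ij x y z k N
    by (intro pcomp_mult_left signed_in_carr pcomp_closed) auto
  also have "pcomp P (m + n - 1) (a + b - 1) l c ?k (pcomp P m (a - 1) n b i x' y) z = A"
    unfolding A_def using ij x y z by (intro pcomp_seq') auto
  also have "pcomp P (m + n - 1) (a + b - 1) l c ?k
        (signed (cpt P (m + n - 1) (a + b - 1)) a (pcomp P m a n (b - 1) i x y')) z =
      signed ?H a (pcomp P (m + n - 1) (a + b - 1) l c ?k (pcomp P m a n (b - 1) i x y') z)"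
    using ij x y z k N by (intro pcomp_signed_left pcomp_closed) auto
  also have "pcomp P (m + n - 1) (a + b - 1) l c ?k (pcomp P m a n (b - 1) i x y') z = B"
    unfolding B_def using ij x y z by (intro pcomp_seq') auto
  finally have 1: "pcomp P (m + n - 1) (a + b - 1) l c ?k (leibniz P m a n b i x x' y y') z =
      A \<otimes>\<^bsub>?H\<^esub> signed ?H a B" .
  have 2: "pcomp P (m + n - 1) (a + b) l (c - 1) ?k (pcomp P m a n b i x y) z' = C"
    unfolding C_def using ij x y z by (intro pcomp_seq') auto
  have "pcomp P m a (n + l - 1) (b + c - 1) i x (leibniz P n b l c j y y' z z') =
      pcomp P m a (n + l - 1) (b + c - 1) i x (pcomp P n (b - 1) l c j y' z) \<otimes>\<^bsub>?H\<^esub>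
      pcomp P m a (n + l - 1) (b + c - 1) i x
        (signed (cpt P (n + l - 1) (b + c - 1)) b (pcomp P n b l (c - 1) j y z'))"
    unfolding leibniz_def using ij x y z k N
    by (intro pcomp_mult_right signed_in_carr pcomp_closed) auto
  also have "pcomp P m a (n + l - 1) (b + c - 1) i x (pcomp P n (b - 1) l c j y' z) = B"
    unfolding B_def by (simp add: algebra_simps)
  also have "pcomp P m a (n + l - 1) (b + c - 1) i x
        (signed (cpt P (n + l - 1) (b + c - 1)) b (pcomp P n b l (c - 1) j y z')) =
      signed ?H b (pcomp P m a (n + l - 1) (b + c - 1) i x (pcomp P n b l (c - 1) j y z'))"
    using ij x y z k N by (intro pcomp_signed_right pcomp_closed) auto
  also have "pcomp P m a (n + l - 1) (b + c - 1) i x (pcomp P n b l (c - 1) j y z') = C"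
    unfolding C_def by (simp add: algebra_simps)
  finally have 3: "pcomp P m a (n + l - 1) (b + c - 1) i x (leibniz P n b l c j y y' z z') =
      B \<otimes>\<^bsub>?H\<^esub> signed ?H b C" .
  have "leibniz P (m + n - 1) (a + b) l c ?k
      (pcomp P m a n b i x y) (leibniz P m a n b i x x' y y') z z' =
      (A \<otimes>\<^bsub>?H\<^esub> signed ?H a B) \<otimes>\<^bsub>?H\<^esub> signed ?H (a + b) C"
    unfolding leibniz_def[of P "m + n - 1"] 1 2 N(1) ..
  also have "\<dots> = A \<otimes>\<^bsub>?H\<^esub> signed ?H a (B \<otimes>\<^bsub>?H\<^esub> signed ?H b C)"
    using c by (simp add: H.m_assoc signed_mult signed_signed)
  also have "\<dots> = leibniz P m a (n + l - 1) (b + c) i x x' (pcomp P n b l c j y z)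
      (leibniz P n b l c j y y' z z')"
    unfolding leibniz_def[of P m a "n + l - 1"] 3 A_def N(2) by (simp add: add.assoc add_diff_eq)
  finally show ?thesis .
qed

lemma leibniz_par:
  assumes ik: "1 \<le> i" "i < k" "k \<le> m"
    and x: "x \<in> carr P m a" "x' \<in> carr P m (a - 1)"
    and y: "y \<in> carr P n b" "y' \<in> carr P n (b - 1)"
    and z: "z \<in> carr P l c" "z' \<in> carr P l (c - 1)"
  shows "leibniz P (m + n - 1) (a + b) l c (k - 1 + n)
      (pcomp P m a n b i x y) (leibniz P m a n b i x x' y y') z z' =
    signed (cpt P (m + n + l - 2) (a + b + c - 1)) (b * c)
      (leibniz P (m + l - 1) (a + c) n b i
        (pcomp P m a l c k x z) (leibniz P m a l c k x x' z z') y y')"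
proof -
  let ?N = "m + n + l - 2" and ?d = "a + b + c - 1"
  let ?H = "cpt P ?N ?d" and ?k = "k - 1 + n"
  have k: "1 \<le> ?k" "?k \<le> m + n - 1" "1 \<le> k" "i \<le> m" "i \<le> m + l - 1"
    and N: "?N = m + n - 1 + l - 1" "?N = m + l - 1 + n - 1"
    using ik by auto
  interpret H: comm_group ?H by simp
  define A where "A = pcomp P (m + l - 1) (a - 1 + c) n b i (pcomp P m (a - 1) l c k x' z) y"
  define B where "B = pcomp P (m + l - 1) (a + c) n (b - 1) i (pcomp P m a l c k x z) y'"
  define C where "C = pcomp P (m + l - 1) (a + (c - 1)) n b i (pcomp P m a l (c - 1) k x z') y"
  have c: "A \<in> carrier ?H" "B \<in> carrier ?H" "C \<in> carrier ?H"
    unfolding A_def B_def C_def N(2) using ik k x y z by (auto intro!: pcomp_closed)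
  have "pcomp P (m + n - 1) (a + b - 1) l c ?k (leibniz P m a n b i x x' y y') z =
      pcomp P (m + n - 1) (a + b - 1) l c ?k (pcomp P m (a - 1) n b i x' y) z \<otimes>\<^bsub>?H\<^esub>
      pcomp P (m + n - 1) (a + b - 1) l c ?k
        (signed (cpt P (m + n - 1) (a + b - 1)) a (pcomp P m a n (b - 1) i x y')) z"
    unfolding leibniz_def using ik x y z k N
    by (intro pcomp_mult_left signed_in_carr pcomp_closed) auto
  also have "pcomp P (m + n - 1) (a + b - 1) l c ?k (pcomp P m (a - 1) n b i x' y) z =
      signed ?H (b * c) A"
    unfolding A_def using ik x y z by (intro pcomp_par') auto
  also have "pcomp P (m + n - 1) (a + b - 1) l c ?k
        (signed (cpt P (m + n - 1) (a + b - 1)) a (pcomp P m a n (b - 1) i x y')) z =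
      signed ?H a (pcomp P (m + n - 1) (a + b - 1) l c ?k (pcomp P m a n (b - 1) i x y') z)"
    using ik x y z k N by (intro pcomp_signed_left pcomp_closed) auto
  also have "pcomp P (m + n - 1) (a + b - 1) l c ?k (pcomp P m a n (b - 1) i x y') z =
      signed ?H ((b - 1) * c) B"
    unfolding B_def using ik x y z by (intro pcomp_par') auto
  finally have 1: "pcomp P (m + n - 1) (a + b - 1) l c ?k (leibniz P m a n b i x x' y y') z =
      signed ?H (b * c) A \<otimes>\<^bsub>?H\<^esub> signed ?H a (signed ?H ((b - 1) * c) B)" .
  have 2: "pcomp P (m + n - 1) (a + b) l (c - 1) ?k (pcomp P m a n b i x y) z' =
      signed ?H (b * (c - 1)) C"
    unfolding C_def using ik x y z by (intro pcomp_par') auto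
  have "pcomp P (m + l - 1) (a + c - 1) n b i (leibniz P m a l c k x x' z z') y =
      pcomp P (m + l - 1) (a + c - 1) n b i (pcomp P m (a - 1) l c k x' z) y \<otimes>\<^bsub>?H\<^esub>
      pcomp P (m + l - 1) (a + c - 1) n b i
        (signed (cpt P (m + l - 1) (a + c - 1)) a (pcomp P m a l (c - 1) k x z')) y"
    unfolding leibniz_def using ik x y z k N
    by (intro pcomp_mult_left signed_in_carr pcomp_closed) auto
  also have "pcomp P (m + l - 1) (a + c - 1) n b i (pcomp P m (a - 1) l c k x' z) y = A"
    unfolding A_def by (simp add: algebra_simps)
  also have "pcomp P (m + l - 1) (a + c - 1) n b i
        (signed (cpt P (m + l - 1) (a + c - 1)) a (pcomp P m a l (c - 1) k x z')) y =
      signed ?H a (pcomp P (m + l - 1) (a + c - 1) n b i (pcomp P m a l (c - 1) k x z') y)"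
    using ik x y z k N by (intro pcomp_signed_left pcomp_closed) auto
  also have "pcomp P (m + l - 1) (a + c - 1) n b i (pcomp P m a l (c - 1) k x z') y = C"
    unfolding C_def by (simp add: algebra_simps)
  finally have 3: "pcomp P (m + l - 1) (a + c - 1) n b i (leibniz P m a l c k x x' z z') y =
      A \<otimes>\<^bsub>?H\<^esub> signed ?H a C" .
  \<comment> \<open>Koszul signs: moving the derivative past an operation of degree \<open>a\<close> or \<open>b\<close>, compared with exchanging \<open>y\<close> and \<open>z\<close>.\<close>
  have p: "even (a + (b - 1) * c) = even (b * c + (a + c))" "even (a + b + b * (c - 1)) = even (b * c + a)"
    by auto
  have "leibniz P (m + n - 1) (a + b) l c ?k
      (pcomp P m a n b i x y) (leibniz P m a n b i x x' y y') z z' =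
      (signed ?H (b * c) A \<otimes>\<^bsub>?H\<^esub> signed ?H a (signed ?H ((b - 1) * c) B)) \<otimes>\<^bsub>?H\<^esub>
      signed ?H (a + b) (signed ?H (b * (c - 1)) C)"
    unfolding leibniz_def[of P "m + n - 1"] 1 2 N(1) ..
  also have "\<dots> = (signed ?H (b * c) A \<otimes>\<^bsub>?H\<^esub> signed ?H (b * c + (a + c)) B) \<otimes>\<^bsub>?H\<^esub>
      signed ?H (b * c + a) C"
    unfolding signed_signed[OF comm_group_cpt c(2)] signed_signed[OF comm_group_cpt c(3)]
      signed_parity[OF p(1)] signed_parity[OF p(2)] ..
  also have "\<dots> = signed ?H (b * c) ((A \<otimes>\<^bsub>?H\<^esub> signed ?H a C) \<otimes>\<^bsub>?H\<^esub> signed ?H (a + c) B)"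
    using c by (simp add: signed_mult signed_signed H.m_ac)
  also have "(A \<otimes>\<^bsub>?H\<^esub> signed ?H a C) \<otimes>\<^bsub>?H\<^esub> signed ?H (a + c) B =
      leibniz P (m + l - 1) (a + c) n b i
        (pcomp P m a l c k x z) (leibniz P m a l c k x x' z z') y y'"
    unfolding leibniz_def[of P "m + l - 1"] 3 B_def N(2)
    by (simp add: algebra_simps)
  finally show ?thesis .
qed

text \<open>
  The square of an odd derivation satisfies the Leibniz rule without a sign, since the two mixed
  terms cancel. Hence its kernel is closed under composition, and \<open>d\<^sup>2 = 0\<close> has to be checked on
  generators only.\<close>

lemma derivation_square_suboperad:
  assumes D: "derivation P D"
  shows "suboperad (\<lambda>n d. {x \<in> carr P n d. D n (d - 1) (D n d x) = \<one>\<^bsub>cpt P n (d - 2)\<^esub>}) P"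
  unfolding suboperad_def
proof (intro conjI allI impI)
  fix n d
  have "(\<lambda>x. D n (d - 1) (D n d x)) \<in> hom (cpt P n d) (cpt P n (d - 1 - 1))"
    by (rule hom_compose_apply) (rule derivationD(1)[OF D])+
  then have h: "(\<lambda>x. D n (d - 1) (D n d x)) \<in> hom (cpt P n d) (cpt P n (d - 2))" by simp
  interpret H: comm_group "cpt P n (d - 2)" by simp
  have "(\<lambda>x. \<one>\<^bsub>cpt P n (d - 2)\<^esub>) \<in> hom (cpt P n d) (cpt P n (d - 2))"
    by (simp add: hom_def)
  from equalizer_subgroup[OF h this]
  show "subgroup {x \<in> carr P n d. D n (d - 1) (D n d x) = \<one>\<^bsub>cpt P n (d - 2)\<^esub>} (cpt P n d)" by simp
next
  fix m a n b i x y
  assume *: "1 \<le> i \<and> i \<le> m \<and>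
    x \<in> {x \<in> carr P m a. D m (a - 1) (D m a x) = \<one>\<^bsub>cpt P m (a - 2)\<^esub>} \<and>
    y \<in> {x \<in> carr P n b. D n (b - 1) (D n b x) = \<one>\<^bsub>cpt P n (b - 2)\<^esub>}"
  then have i: "1 \<le> i" "i \<le> m" and xy: "x \<in> carr P m a" "y \<in> carr P n b"
    and sq: "D m (a - 1) (D m a x) = \<one>\<^bsub>cpt P m (a - 2)\<^esub>" "D n (b - 1) (D n b y) = \<one>\<^bsub>cpt P n (b - 2)\<^esub>"
    by auto
  let ?N = "m + n - 1"
  let ?H = "cpt P ?N (a + b - 2)"
  interpret H: comm_group ?H by simp
  note Dx = derivationD(3)[OF D xy(1)] and Dy = derivationD(3)[OF D xy(2)]
  let ?u = "pcomp P m (a - 1) n b i (D m a x) y" and ?v = "pcomp P m a n (b - 1) i x (D n b y)"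
  let ?w = "pcomp P m (a - 1) n (b - 1) i (D m a x) (D n b y)"
  have u: "?u \<in> carr P ?N (a + b - 1)" and v: "?v \<in> carr P ?N (a + b - 1)"
    and w: "?w \<in> carr P ?N (a + b - 2)"
    using i xy Dx Dy by (auto intro!: pcomp_closed)
  have h: "D ?N (a + b - 1) \<in> hom (cpt P ?N (a + b - 1)) ?H"
    using derivationD(1)[OF D, of ?N "a + b - 1"] by simp
  have "D ?N (a + b) (pcomp P m a n b i x y) =
      ?u \<otimes>\<^bsub>cpt P ?N (a + b - 1)\<^esub> signed (cpt P ?N (a + b - 1)) a ?v"
    using derivationD(2)[OF D i xy refl refl] by (simp add: leibniz_def)
  then have "D ?N (a + b - 1) (D ?N (a + b) (pcomp P m a n b i x y)) =
      D ?N (a + b - 1) ?u \<otimes>\<^bsub>?H\<^esub> signed ?H a (D ?N (a + b - 1) ?v)"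
    using hom_mult[OF h u signed_in_carr[OF v]] hom_signed[OF h _ _ v] by simp
  also have "D ?N (a + b - 1) ?u = signed ?H (a - 1) ?w"
    using derivationD(2)[OF D i Dx xy(2), of ?N "a + b - 1"]
      pcomp_one_left[OF i xy(2), of ?N "a + b - 2" "a - 2"] w
    by (simp add: leibniz_def sq)
  also have "D ?N (a + b - 1) ?v = ?w"
    using derivationD(2)[OF D i xy(1) Dy, of ?N "a + b - 1"]
      pcomp_one_right[OF i xy(1), of ?N n "a + b - 2" "b - 2"] w
    by (simp add: leibniz_def sq)
  also have "signed ?H (a - 1) ?w \<otimes>\<^bsub>?H\<^esub> signed ?H a ?w = \<one>\<^bsub>?H\<^esub>"
    using H.l_inv[OF w] H.r_inv[OF w] by (simp add: signed_def del: One_nat_def)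
  finally show "pcomp P m a n b i x y \<in> {x \<in> carr P (m + n - 1) (a + b).
      D (m + n - 1) (a + b - 1) (D (m + n - 1) (a + b) x) = \<one>\<^bsub>cpt P (m + n - 1) (a + b - 2)\<^esub>}"
    using pcomp_closed[OF i xy refl refl] by simp
qed

end

text \<open>
  A morphism of operads thus commutes with derivations as soon as it does so on generators.\<close>

lemma derivation_intertwined_suboperad:
  assumes P: "graded_operad P" and R: "graded_operad R" and f: "operad_hom P R f"
    and D: "derivation P D" and D': "derivation R D'"
  shows "suboperad (\<lambda>n d. {x \<in> carr P n d. f n (d - 1) (D n d x) = D' n d (f n d x)}) P"
  unfolding suboperad_def
proof (intro conjI allI impI)
  interpret P: graded_operad P by fact
  interpret R: graded_operad R by fact
  show "subgroup {x \<in> carr P n d. f n (d - 1) (D n d x) = D' n d (f n d x)} (cpt P n d)" for n d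
  proof (rule equalizer_subgroup)
    show "(\<lambda>x. f n (d - 1) (D n d x)) \<in> hom (cpt P n d) (cpt R n (d - 1))"
      by (rule hom_compose_apply[OF derivationD(1)[OF D] operad_homD(1)[OF f]])
    show "(\<lambda>x. D' n d (f n d x)) \<in> hom (cpt P n d) (cpt R n (d - 1))"
      by (rule hom_compose_apply[OF operad_homD(1)[OF f] derivationD(1)[OF D']])
  qed auto
  fix m a n b i x y
  assume *: "1 \<le> i \<and> i \<le> m \<and>
    x \<in> {x \<in> carr P m a. f m (a - 1) (D m a x) = D' m a (f m a x)} \<and>
    y \<in> {x \<in> carr P n b. f n (b - 1) (D n b x) = D' n b (f n b x)}"
  then have i: "1 \<le> i" "i \<le> m" and xy: "x \<in> carr P m a" "y \<in> carr P n b"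
    and eq: "f m (a - 1) (D m a x) = D' m a (f m a x)" "f n (b - 1) (D n b y) = D' n b (f n b y)"
    by auto
  let ?N = "m + n - 1"
  note Dx = derivationD(3)[OF D xy(1)] and Dy = derivationD(3)[OF D xy(2)]
  let ?u = "pcomp P m (a - 1) n b i (D m a x) y" and ?v = "pcomp P m a n (b - 1) i x (D n b y)"
  have u: "?u \<in> carr P ?N (a + b - 1)" and v: "?v \<in> carr P ?N (a + b - 1)"
    using i xy Dx Dy by (auto intro!: P.pcomp_closed)
  note h = operad_homD(1)[OF f, of ?N "a + b - 1"]
  have "f ?N (a + b - 1) (D ?N (a + b) (pcomp P m a n b i x y)) =
      f ?N (a + b - 1) ?u \<otimes>\<^bsub>cpt R ?N (a + b - 1)\<^esub>
      signed (cpt R ?N (a + b - 1)) a (f ?N (a + b - 1) ?v)"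
    using derivationD(2)[OF D i xy refl refl] hom_mult[OF h u P.signed_in_carr[OF v]]
      hom_signed[OF h _ _ v] by (simp add: leibniz_def)
  also have "f ?N (a + b - 1) ?u = pcomp R m (a - 1) n b i (D' m a (f m a x)) (f n b y)"
    using operad_homD(2)[OF f i Dx xy(2), of ?N "a + b - 1"] by (simp add: eq)
  also have "f ?N (a + b - 1) ?v = pcomp R m a n (b - 1) i (f m a x) (D' n b (f n b y))"
    using operad_homD(2)[OF f i xy(1) Dy, of ?N "a + b - 1"] by (simp add: eq)
  finally have "f ?N (a + b - 1) (D ?N (a + b) (pcomp P m a n b i x y)) =
      D' ?N (a + b) (f ?N (a + b) (pcomp P m a n b i x y))"
    using operad_homD(2)[OF f i xy refl refl]
      derivationD(2)[OF D' i operad_homD(3)[OF f xy(1)] operad_homD(3)[OF f xy(2)] refl refl]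
    by (simp add: leibniz_def)
  then show "pcomp P m a n b i x y \<in> {x \<in> carr P (m + n - 1) (a + b).
      f (m + n - 1) (a + b - 1) (D (m + n - 1) (a + b) x) =
      D' (m + n - 1) (a + b) (f (m + n - 1) (a + b) x)}"
    using P.pcomp_closed[OF i xy refl refl] by simp
qed

subsection \<open>Derivations of free operads\<close>

locale generator_derivative =
  fixes G :: "nat \<Rightarrow> int \<Rightarrow> 'g set" and \<delta> :: "nat \<Rightarrow> int \<Rightarrow> 'g \<Rightarrow> 'g expr"
  assumes wf_generator_derivative: "g \<in> G n d \<Longrightarrow> wf_expr G n (d - 1) (\<delta> n d g)"
begin

abbreviation F where "F \<equiv> presented_operad G no_rel"
abbreviation cls where "cls \<equiv> oclass G no_rel"

lemma wf_ederiv: "wf_expr G n d t \<Longrightarrow> wf_expr G n (d - 1) (ederiv \<delta> t)"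
proof (induction rule: wf_expr.induct)
  case (wf_Comp m a s n b t i)
  have "wf_expr G (m + n - 1) (a + b - 1) (Comp i (ederiv \<delta> s) t)"
    using wf_Comp by (intro wf_Comp'[of G m "a - 1" _ n b]) auto
  moreover have "wf_expr G (m + n - 1) (a + b - 1) (Comp i s (ederiv \<delta> t))"
    using wf_Comp by (intro wf_Comp'[of G m a _ n "b - 1"]) auto
  ultimately show ?case by (simp add: wf_Add wf_esigned)
qed (auto intro: wf_expr.intros wf_generator_derivative)

lemma ederiv_Comp:
  assumes s: "wf_expr G m a s" and t: "wf_expr G n b t" and i: "1 \<le> i" "i \<le> m"
    and N: "N = m + n - 1" "d = a + b - 1"
  shows "cls N d (ederiv \<delta> (Comp i s t)) =
    leibniz F m a n b i (cls m a s) (cls m (a - 1) (ederiv \<delta> s)) (cls n b t) (cls n (b - 1) (ederiv \<delta> t))"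
proof -
  have "wf_expr G N d (Comp i (ederiv \<delta> s) t)"
    using N by (intro wf_Comp'[OF wf_ederiv[OF s] t i]) auto
  moreover have "wf_expr G N d (Comp i s (ederiv \<delta> t))"
    using N by (intro wf_Comp'[OF s wf_ederiv[OF t] i]) auto
  ultimately have wf: "wf_expr G N d (Comp i (ederiv \<delta> s) t)" "wf_expr G N d (Comp i s (ederiv \<delta> t))"
    by auto
  have "cls N d (ederiv \<delta> (Comp i s t)) =
      cls N d (Comp i (ederiv \<delta> s) t) \<otimes>\<^bsub>cpt F N d\<^esub>
      signed (cpt F N d) a (cls N d (Comp i s (ederiv \<delta> t)))"
    using wf wf_expr_type[OF s]
    by (simp add: presented_mult presented_signed wf_esigned)
  also have "cls N d (Comp i (ederiv \<delta> s) t) =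
      pcomp F m (a - 1) n b i (cls m (a - 1) (ederiv \<delta> s)) (cls n b t)"
    using assms by (intro presented_pcomp[symmetric] wf_ederiv) auto
  also have "cls N d (Comp i s (ederiv \<delta> t)) =
      pcomp F m a n (b - 1) i (cls m a s) (cls n (b - 1) (ederiv \<delta> t))"
    using assms by (intro presented_pcomp[symmetric] wf_ederiv) auto
  finally show ?thesis by (simp add: leibniz_def N)
qed

interpretation F: graded_operad F by (rule graded_operad_presented)

lemmas cls_closed = oclass_in_carr[of G _ _ _ no_rel] oclass_in_carr[OF wf_ederiv, of _ _ _ no_rel]

text \<open>
  The derivation of expressions respects the congruence. The additive rules are immediate, and the
  two composition axioms are the lemmas \<open>leibniz_seq\<close> and \<open>leibniz_par\<close>.\<close>

lemma ederiv_ocong: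
  "ocong G no_rel n d s t \<Longrightarrow> cls n (d - 1) (ederiv \<delta> s) = cls n (d - 1) (ederiv \<delta> t)"
proof (induction rule: ocong.induct)
  case (oc_Add n d s s' t t')
  then show ?case using ocong_wf[OF oc_Add(1)] ocong_wf[OF oc_Add(2)]
    by (simp flip: presented_mult add: wf_ederiv)
next
  case (oc_Neg n d s s')
  then show ?case using ocong_wf[OF oc_Neg(1)]
    by (simp flip: presented_inv add: wf_ederiv)
next
  case (oc_Comp m a s s' n b t t' i)
  note wf = ocong_wf[OF oc_Comp(1)] ocong_wf[OF oc_Comp(2)]
  show ?case
    using wf ederiv_Comp[of m a _ n b _ i, OF _ _ oc_Comp(3,4) refl refl] oc_Comp.IH
      oclass_eqI[OF oc_Comp(1)] oclass_eqI[OF oc_Comp(2)] by metis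
next
  case (oc_add_assoc n d s t u)
  then show ?case by (simp add: oclass_eqI[OF ocong.oc_add_assoc] wf_ederiv)
next
  case (oc_add_comm n d s t)
  then show ?case by (simp add: oclass_eqI[OF ocong.oc_add_comm] wf_ederiv)
next
  case (oc_add_zero n d s)
  then show ?case by (simp add: oclass_eqI[OF ocong.oc_add_zero] wf_ederiv)
next
  case (oc_add_neg n d s)
  then show ?case by (simp add: oclass_eqI[OF ocong.oc_add_neg] wf_ederiv)
next
  case (oc_comp_add_left m a s t n b u i)
  let ?N = "m + n - 1" and ?d = "a + b - 1"
  note i = oc_comp_add_left(4,5)
  have "cls ?N ?d (ederiv \<delta> (Comp i (Add s t) u)) =
      cls ?N ?d (ederiv \<delta> (Comp i s u)) \<otimes>\<^bsub>cpt F ?N ?d\<^esub> cls ?N ?d (ederiv \<delta> (Comp i t u))"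
    unfolding ederiv_Comp[OF oc_comp_add_left(1,3) i refl refl] ederiv_Comp[OF oc_comp_add_left(2,3) i refl refl]
      ederiv_Comp[OF wf_Add[OF oc_comp_add_left(1,2)] oc_comp_add_left(3) i refl refl]
    using oc_comp_add_left
    by (simp only: ederiv.simps presented_mult[symmetric] wf_ederiv) (intro F.leibniz_mult_left cls_closed)
  also have "\<dots> = cls ?N ?d (ederiv \<delta> (Add (Comp i s u) (Comp i t u)))"
    unfolding ederiv.simps(3)
    by (intro presented_mult wf_ederiv[of ?N "a + b", simplified] wf_ederiv wf_Comp oc_comp_add_left)
  finally show ?case .
next
  case (oc_comp_add_right m a s n b t u i)
  let ?N = "m + n - 1" and ?d = "a + b - 1"
  note i = oc_comp_add_right(4,5)
  have "cls ?N ?d (ederiv \<delta> (Comp i s (Add t u))) =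
      cls ?N ?d (ederiv \<delta> (Comp i s t)) \<otimes>\<^bsub>cpt F ?N ?d\<^esub> cls ?N ?d (ederiv \<delta> (Comp i s u))"
    unfolding ederiv_Comp[OF oc_comp_add_right(1,2) i refl refl] ederiv_Comp[OF oc_comp_add_right(1,3) i refl refl]
      ederiv_Comp[OF oc_comp_add_right(1) wf_Add[OF oc_comp_add_right(2,3)] i refl refl]
    using oc_comp_add_right
    by (simp only: ederiv.simps presented_mult[symmetric] wf_ederiv) (intro F.leibniz_mult_right cls_closed)
  also have "\<dots> = cls ?N ?d (ederiv \<delta> (Add (Comp i s t) (Comp i s u)))"
    unfolding ederiv.simps(3)
    by (intro presented_mult wf_ederiv wf_Comp oc_comp_add_right)
  finally show ?case .
next
  case (oc_comp_seq m a s n b t l c u i j)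
  note ij = oc_comp_seq(4-7)
  note st = wf_Comp[OF oc_comp_seq(1,2) ij(1,2)] and tu = wf_Comp[OF oc_comp_seq(2,3) ij(3,4)]
  have "cls (m + n + l - 2) (a + b + c - 1) (ederiv \<delta> (Comp (i - 1 + j) (Comp i s t) u)) =
    leibniz F (m + n - 1) (a + b) l c (i - 1 + j) (cls (m + n - 1) (a + b) (Comp i s t))
      (cls (m + n - 1) (a + b - 1) (ederiv \<delta> (Comp i s t))) (cls l c u) (cls l (c - 1) (ederiv \<delta> u))"
    using ij by (intro ederiv_Comp st oc_comp_seq(3)) auto
  also have "\<dots> = leibniz F m a (n + l - 1) (b + c) i (cls m a s) (cls m (a - 1) (ederiv \<delta> s))
      (cls (n + l - 1) (b + c) (Comp j t u)) (cls (n + l - 1) (b + c - 1) (ederiv \<delta> (Comp j t u)))"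
    unfolding ederiv_Comp[OF oc_comp_seq(1,2) ij(1,2) refl refl]
      ederiv_Comp[OF oc_comp_seq(2,3) ij(3,4) refl refl]
      presented_pcomp[OF oc_comp_seq(1,2) ij(1,2) refl refl, symmetric]
      presented_pcomp[OF oc_comp_seq(2,3) ij(3,4) refl refl, symmetric]
    by (intro F.leibniz_seq ij cls_closed oc_comp_seq(1-3))
  also have "\<dots> = cls (m + n + l - 2) (a + b + c - 1) (ederiv \<delta> (Comp i s (Comp j t u)))"
    using ij by (intro ederiv_Comp[symmetric] tu oc_comp_seq(1)) auto
  finally show ?case .
next
  case (oc_comp_par m a s n b t l c u i k)
  note ik = oc_comp_par(4-6)
  have k: "i \<le> m" "1 \<le> k" using ik by auto
  note st = wf_Comp[OF oc_comp_par(1,2) ik(1) k(1)] and su = wf_Comp[OF oc_comp_par(1,3) k(2) ik(3)]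
  let ?N = "m + n + l - 2" and ?d = "a + b + c - 1"
  have sut: "wf_expr G ?N (a + b + c) (Comp i (Comp k s u) t)"
    using ik by (intro wf_Comp'[OF su oc_comp_par(2)]) auto
  have "cls ?N ?d (ederiv \<delta> (Comp (k - 1 + n) (Comp i s t) u)) =
    leibniz F (m + n - 1) (a + b) l c (k - 1 + n) (cls (m + n - 1) (a + b) (Comp i s t))
      (cls (m + n - 1) (a + b - 1) (ederiv \<delta> (Comp i s t))) (cls l c u) (cls l (c - 1) (ederiv \<delta> u))"
    using ik by (intro ederiv_Comp st oc_comp_par(3)) auto
  also have "\<dots> = signed (cpt F ?N ?d) (b * c) (leibniz F (m + l - 1) (a + c) n b i
      (cls (m + l - 1) (a + c) (Comp k s u)) (cls (m + l - 1) (a + c - 1) (ederiv \<delta> (Comp k s u)))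
      (cls n b t) (cls n (b - 1) (ederiv \<delta> t)))"
    unfolding ederiv_Comp[OF oc_comp_par(1,2) ik(1) k(1) refl refl]
      ederiv_Comp[OF oc_comp_par(1,3) k(2) ik(3) refl refl]
      presented_pcomp[OF oc_comp_par(1,2) ik(1) k(1) refl refl, symmetric]
      presented_pcomp[OF oc_comp_par(1,3) k(2) ik(3) refl refl, symmetric]
    by (intro F.leibniz_par ik cls_closed oc_comp_par(1-3))
  also have "leibniz F (m + l - 1) (a + c) n b i
      (cls (m + l - 1) (a + c) (Comp k s u)) (cls (m + l - 1) (a + c - 1) (ederiv \<delta> (Comp k s u)))
      (cls n b t) (cls n (b - 1) (ederiv \<delta> t)) = cls ?N ?d (ederiv \<delta> (Comp i (Comp k s u) t))"
    using ik by (intro ederiv_Comp[symmetric] su oc_comp_par(2)) auto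
  also have "signed (cpt F ?N ?d) (b * c) \<dots> =
      cls ?N ?d (ederiv \<delta> (esigned (b * c) (Comp i (Comp k s u) t)))"
    using presented_signed[OF wf_ederiv[OF sut], of no_rel "b * c"]
    by (simp add: esigned_def split: if_splits)
  finally show ?case .
qed auto

lemma free_deriv_oclass:
  "wf_expr G n d t \<Longrightarrow> free_deriv G \<delta> n d (cls n d t) = cls n (d - 1) (ederiv \<delta> t)"
  unfolding free_deriv_def by (rule UN_oclass_const) (simp_all add: ederiv_ocong)

lemma derivation_free_deriv: "derivation (free_operad G) (free_deriv G \<delta>)"
  unfolding derivation_def free_operad_def
proof (intro conjI allI impI)
  show "free_deriv G \<delta> n d \<in> hom (cpt F n d) (cpt F n (d - 1))" for n d
    by (rule homI) (auto elim!: presented_carrE simp: free_deriv_oclass oclass_in_carr wf_ederiv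
        presented_mult wf_Add)
  fix m a n b i x y
  assume "1 \<le> i \<and> i \<le> m \<and> x \<in> carr F m a \<and> y \<in> carr F n b"
  then obtain s t where i: "1 \<le> i" "i \<le> m" and s: "wf_expr G m a s" "x = cls m a s"
    and t: "wf_expr G n b t" "y = cls n b t" by (auto elim!: presented_carrE)
  show "free_deriv G \<delta> (m + n - 1) (a + b) (pcomp F m a n b i x y) =
      leibniz F m a n b i x (free_deriv G \<delta> m a x) y (free_deriv G \<delta> n b y)"
    unfolding s(2) t(2) presented_pcomp[OF s(1) t(1) i refl refl]
      free_deriv_oclass[OF s(1)] free_deriv_oclass[OF t(1)] free_deriv_oclass[OF wf_Comp[OF s(1) t(1) i]]
    by (intro ederiv_Comp s t i refl)
qed

end


section \<open>The curvature of a sequence of operations\<close>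

definition triples :: "nat \<Rightarrow> (nat \<times> nat \<times> nat) set" where
  "triples n = {(p, q, r). p + q + r = n}"

definition quintuples :: "nat \<Rightarrow> (nat \<times> nat \<times> nat \<times> nat \<times> nat) set" where
  "quintuples n = {(a, b, c, d, e). a + b + c + d + e = n}"

lemma finite_triples [simp]: "finite (triples n)"
  by (rule finite_subset[of _ "{..n} \<times> {..n} \<times> {..n}"]) (auto simp: triples_def)

text \<open>
  The quadratic part of the Maurer-Cartan expression of a sequence \<open>m\<close> of operations of degree \<open>-1\<close>.
  Indexing by triples \<open>p + q + r = n\<close> avoids subtraction of natural numbers in the arities.\<close>

definition mc_sum :: "('a, 'm) goperad_scheme \<Rightarrow> (nat \<Rightarrow> 'a) \<Rightarrow> nat \<Rightarrow> 'a" where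
  "mc_sum P m n = finprod (cpt P n (-2))
     (\<lambda>(p, q, r). pcomp P (p + 1 + r) (-1) q (-1) (p + 1) (m (p + 1 + r)) (m q)) (triples n)"

definition curvature ::
  "('a, 'm) goperad_scheme \<Rightarrow> (nat \<Rightarrow> int \<Rightarrow> 'a \<Rightarrow> 'a) \<Rightarrow> (nat \<Rightarrow> 'a) \<Rightarrow> nat \<Rightarrow> 'a" where
  "curvature P D m n = D n (-1) (m n) \<otimes>\<^bsub>cpt P n (-2)\<^esub> mc_sum P m n"

context graded_operad
begin

lemma mc_term_closed:
  assumes "\<And>n. m n \<in> carr P n (-1)" "p + q + r = n"
  shows "pcomp P (p + 1 + r) (-1) q (-1) (p + 1) (m (p + 1 + r)) (m q) \<in> carr P n (-2)"
  using assms(2) by (intro pcomp_closed assms(1)) auto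

lemma mc_sum_closed:
  assumes "\<And>n. m n \<in> carr P n (-1)"
  shows "mc_sum P m n \<in> carr P n (-2)"
  unfolding mc_sum_def 
  by (auto intro!: finprod_in_carr mc_term_closed[of m, OF assms] simp: triples_def simp del: One_nat_def)

text \<open>
  Both sides are sums over pairs of nested insertions. On the left the second insertion either takes
  place inside the first one, which gives the right-hand side by the sequential axiom, or to the
  left or to the right of it. The last two families are exchanged by the parallel axiom, with the
  sign \<open>-1\<close> because all operations are odd, and cancel.\<close>

lemma mc_sum_jacobi:
  assumes m: "\<And>n. m n \<in> carr P n (-1)"
  shows "finprod (cpt P n (-3))
      (\<lambda>(p, q, r). pcomp P (p + 1 + r) (-2) q (-1) (p + 1) (mc_sum P m (p + 1 + r)) (m q)) (triples n) =
    finprod (cpt P n (-3))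
      (\<lambda>(p, q, r). pcomp P (p + 1 + r) (-1) q (-2) (p + 1) (m (p + 1 + r)) (mc_sum P m q)) (triples n)"
proof -
  let ?H = "cpt P n (-3)"
  interpret H: comm_group ?H by simp
  define f where "f = (\<lambda>((p, q, r), (p', q', r')). pcomp P (p + 1 + r) (-2) q (-1) (p + 1)
    (pcomp P (p' + 1 + r') (-1) q' (-1) (p' + 1) (m (p' + 1 + r')) (m q')) (m q))"
  define g where "g = (\<lambda>((p, q, r), (p', q', r')). pcomp P (p + 1 + r) (-1) q (-2) (p + 1)
    (m (p + 1 + r)) (pcomp P (p' + 1 + r') (-1) q' (-1) (p' + 1) (m (p' + 1 + r')) (m q')))"
  define I where "I = Sigma (triples n) (\<lambda>(p, q, r). triples (p + 1 + r))"
  define J where "J = Sigma (triples n) (\<lambda>(p, q, r). triples q)"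
  have f_closed: "f t \<in> carrier ?H" if "t \<in> I" for t
    using that unfolding f_def I_def
    by (auto simp: triples_def simp del: One_nat_def add_Suc_right add_Suc
        intro!: pcomp_closed[OF _ _ mc_term_closed[of m, OF m] m])
  have g_closed: "g t \<in> carrier ?H" if "t \<in> J" for t
    using that unfolding g_def J_def
    by (auto simp: triples_def simp del: One_nat_def add_Suc_right add_Suc
        intro!: pcomp_closed[OF _ _ m mc_term_closed[of m, OF m]])
  have fin: "finite I" "finite J"
    unfolding I_def J_def by (auto intro!: finite_SigmaI)

  have "finprod ?H (\<lambda>(p, q, r). pcomp P (p + 1 + r) (-2) q (-1) (p + 1) (mc_sum P m (p + 1 + r)) (m q))
      (triples n) =
    finprod ?H (\<lambda>t. finprod ?H (\<lambda>t'. f (t, t')) (case t of (p, q, r) \<Rightarrow> triples (p + 1 + r))) (triples n)"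
  proof (rule H.finprod_eq)
    fix t assume t: "t \<in> triples n"
    obtain p q r where [simp]: "t = (p, q, r)" by (cases t)
    have "pcomp P (p + 1 + r) (-2) q (-1) (p + 1) (mc_sum P m (p + 1 + r)) (m q) =
        finprod ?H (\<lambda>t'. pcomp P (p + 1 + r) (-2) q (-1) (p + 1)
          (case t' of (p', q', r') \<Rightarrow>
            pcomp P (p' + 1 + r') (-1) q' (-1) (p' + 1) (m (p' + 1 + r')) (m q')) (m q))
          (triples (p + 1 + r))"
      unfolding mc_sum_def
      using t by (intro pcomp_finprod_left m)
        (auto simp: triples_def simp del: One_nat_def intro!: mc_term_closed[of m, OF m])
    also have "\<dots> = finprod ?H (\<lambda>t'. f (t, t')) (triples (p + 1 + r))"
      using t f_closed by (intro H.finprod_eq) (auto simp: f_def I_def)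
    finally show "(case t of (p, q, r) \<Rightarrow>
        pcomp P (p + 1 + r) (-2) q (-1) (p + 1) (mc_sum P m (p + 1 + r)) (m q)) =
      finprod ?H (\<lambda>t'. f (t, t')) (case t of (p, q, r) \<Rightarrow> triples (p + 1 + r))" by simp
    show "finprod ?H (\<lambda>t'. f (t, t')) (case t of (p, q, r) \<Rightarrow> triples (p + 1 + r)) \<in> carrier ?H"
      using t f_closed by (intro H.finprod_in_carrier) (auto simp: I_def)
  qed
  also have "\<dots> = finprod ?H f I"
    unfolding I_def using f_closed by (intro H.finprod_Sigma[symmetric]) (auto simp: I_def)
  finally have left: "finprod ?H (\<lambda>(p, q, r). pcomp P (p + 1 + r) (-2) q (-1) (p + 1)
      (mc_sum P m (p + 1 + r)) (m q)) (triples n) = finprod ?H f I" .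

  have "finprod ?H (\<lambda>(p, q, r). pcomp P (p + 1 + r) (-1) q (-2) (p + 1) (m (p + 1 + r)) (mc_sum P m q))
      (triples n) =
    finprod ?H (\<lambda>t. finprod ?H (\<lambda>t'. g (t, t')) (case t of (p, q, r) \<Rightarrow> triples q)) (triples n)"
  proof (rule H.finprod_eq)
    fix t assume t: "t \<in> triples n"
    obtain p q r where [simp]: "t = (p, q, r)" by (cases t)
    have "pcomp P (p + 1 + r) (-1) q (-2) (p + 1) (m (p + 1 + r)) (mc_sum P m q) =
        finprod ?H (\<lambda>t'. pcomp P (p + 1 + r) (-1) q (-2) (p + 1) (m (p + 1 + r))
          (case t' of (p', q', r') \<Rightarrow>
            pcomp P (p' + 1 + r') (-1) q' (-1) (p' + 1) (m (p' + 1 + r')) (m q')))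
          (triples q)"
      unfolding mc_sum_def
      using t by (intro pcomp_finprod_right m)
        (auto simp: triples_def simp del: One_nat_def intro!: mc_term_closed[of m, OF m])
    also have "\<dots> = finprod ?H (\<lambda>t'. g (t, t')) (triples q)"
      using t g_closed by (intro H.finprod_eq) (auto simp: g_def J_def)
    finally show "(case t of (p, q, r) \<Rightarrow>
        pcomp P (p + 1 + r) (-1) q (-2) (p + 1) (m (p + 1 + r)) (mc_sum P m q)) =
      finprod ?H (\<lambda>t'. g (t, t')) (case t of (p, q, r) \<Rightarrow> triples q)" by simp
    show "finprod ?H (\<lambda>t'. g (t, t')) (case t of (p, q, r) \<Rightarrow> triples q) \<in> carrier ?H"
      using t g_closed by (intro H.finprod_in_carrier) (auto simp: J_def)
  qed
  also have "\<dots> = finprod ?H g J"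
    unfolding J_def using g_closed by (intro H.finprod_Sigma[symmetric]) (auto simp: J_def)
  finally have right: "finprod ?H (\<lambda>(p, q, r). pcomp P (p + 1 + r) (-1) q (-2) (p + 1)
      (m (p + 1 + r)) (mc_sum P m q)) (triples n) = finprod ?H g J" .

  \<comment> \<open>The insertion of \<open>m q\<close> takes place to the left of, inside, and to the right of the one of \<open>m q'\<close>.\<close>
  define I1 where "I1 = {((p, q, r), (p', q', r')). ((p, q, r), (p', q', r')) \<in> I \<and> p < p'}"
  define I2 where "I2 = {((p, q, r), (p', q', r')). ((p, q, r), (p', q', r')) \<in> I \<and> p' \<le> p \<and> p < p' + q'}"
  define I3 where "I3 = {((p, q, r), (p', q', r')). ((p, q, r), (p', q', r')) \<in> I \<and> p' + q' \<le> p}"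
  have un: "I = I1 \<union> (I3 \<union> I2)" and sub: "I1 \<subseteq> I" "I2 \<subseteq> I" "I3 \<subseteq> I"
    unfolding I1_def I2_def I3_def by auto
  have dis: "I1 \<inter> (I3 \<union> I2) = {}" "I3 \<inter> I2 = {}"
    unfolding I1_def I2_def I3_def by auto
  have fin': "finite I1" "finite I2" "finite I3" 
    using sub fin(1) by (auto intro: finite_subset)

  \<comment> \<open>\<open>h1\<close> and \<open>h3\<close> describe the same two disjoint insertions, of arities \<open>q1\<close> and \<open>q2\<close> with \<open>u\<close>, \<open>v\<close>, \<open>w\<close> free inputs around them, made in the two possible orders; \<open>h2\<close> and \<open>h4\<close> describe the same iterated insertion.\<close>
  define h1 where "h1 = (\<lambda>(u, q1, v, q2, w). ((u, q1, v + q2 + w), (u + 1 + v, q2, w)) ::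
    (nat \<times> nat \<times> nat) \<times> (nat \<times> nat \<times> nat))"
  define h3 where "h3 = (\<lambda>(u, q1, v, q2, w). ((u + q1 + v, q2, w), (u, q1, v + 1 + w)) ::
    (nat \<times> nat \<times> nat) \<times> (nat \<times> nat \<times> nat))"
  define h2 where "h2 = (\<lambda>(a, b, q, c, e). ((a + b, q, c + e), (a, b + 1 + c, e)) ::
    (nat \<times> nat \<times> nat) \<times> (nat \<times> nat \<times> nat))"
  define h4 where "h4 = (\<lambda>(a, b, q, c, e). ((a, b + q + c, e), (b, q, c)) ::
    (nat \<times> nat \<times> nat) \<times> (nat \<times> nat \<times> nat))"
  have b1: "bij_betw h1 (quintuples n) I1"
    by (rule bij_betw_byWitness[where f' = "\<lambda>((p, q, r), (p', q', r')). (p, q, p' - p - 1, q', r')"])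
      (auto simp: h1_def I1_def I_def quintuples_def triples_def)
  have b2: "bij_betw h2 (quintuples n) I2"
    by (rule bij_betw_byWitness[where f' = "\<lambda>((p, q, r), (p', q', r')). (p', p - p', q, r - r', r')"])
      (auto simp: h2_def I2_def I_def quintuples_def triples_def)
  have b3: "bij_betw h3 (quintuples n) I3"
    by (rule bij_betw_byWitness[where f' = "\<lambda>((p, q, r), (p', q', r')). (p', q', p - p' - q', q, r)"])
      (auto simp: h3_def I3_def I_def quintuples_def triples_def)
  have b4: "bij_betw h4 (quintuples n) J"
    by (rule bij_betw_byWitness[where f' = "\<lambda>((p, q, r), (p', q', r')). (p, p', q', r', r)"])
      (auto simp: h4_def J_def quintuples_def triples_def)
  have f1: "f (h1 t) \<in> carrier ?H" "f (h2 t) \<in> carrier ?H" if "t \<in> quintuples n" for t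
    using f_closed sub b1 b2 that bij_betwE by blast+

  have f3: "f (h3 t) = inv\<^bsub>?H\<^esub> (f (h1 t))" if "t \<in> quintuples n" for t
  proof -
    obtain u q1 v q2 w where t: "t = (u, q1, v, q2, w)" by (cases t)
    have n: "u + q1 + v + q2 + w = n" using that by (simp add: t quintuples_def)
    have "f (h3 t) = signed ?H ((-1) * (-1)) (pcomp P (u + 1 + (v + q2 + w)) (-2) q1 (-1) (u + 1)
        (pcomp P (u + 1 + v + 1 + w) (-1) q2 (-1) (u + 1 + v + 1) (m (u + 1 + v + 1 + w)) (m q2)) (m q1))"
      using n m[of "u + 1 + v + 1 + w"] unfolding t h3_def f_def
      by (simp only: prod.case, intro trans[OF _ pcomp_par'[of "u + 1" "u + 1 + v + 1" "u + 1 + v + 1 + w"]])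
        (auto simp: m algebra_simps)
    then show ?thesis by (simp add: t h1_def f_def signed_def)
  qed
  have f2: "f (h2 t) = g (h4 t)" if "t \<in> quintuples n" for t
  proof -
    obtain a b q c e where t: "t = (a, b, q, c, e)" by (cases t)
    show ?thesis unfolding t h2_def h4_def f_def g_def prod.case
      by (rule pcomp_seq') (auto simp: m)
  qed

  have "finprod ?H f I = finprod ?H f I1 \<otimes>\<^bsub>?H\<^esub> (finprod ?H f I3 \<otimes>\<^bsub>?H\<^esub> finprod ?H f I2)"
    unfolding un using fin' dis f_closed sub
    by (subst H.finprod_Un_disjoint, auto intro!: arg_cong2[where f = "mult ?H"] H.finprod_Un_disjoint)
  also have "finprod ?H f I1 = finprod ?H (\<lambda>t. f (h1 t)) (quintuples n)"
    using b1 f_closed sub by (intro H.finprod_bij) auto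
  also have "finprod ?H f I3 = finprod ?H (\<lambda>t. f (h3 t)) (quintuples n)"
    using b3 f_closed sub by (intro H.finprod_bij) auto
  also have "\<dots> = finprod ?H (\<lambda>t. inv\<^bsub>?H\<^esub> (f (h1 t))) (quintuples n)"
    using f3 f1 by (intro H.finprod_eq) auto
  also have "\<dots> = inv\<^bsub>?H\<^esub> (finprod ?H (\<lambda>t. f (h1 t)) (quintuples n))"
    using f1 by (intro H.finprod_inverse) auto
  also have "finprod ?H f I2 = finprod ?H (\<lambda>t. f (h2 t)) (quintuples n)"
    using b2 f_closed sub by (intro H.finprod_bij) auto
  also have "\<dots> = finprod ?H (\<lambda>t. g (h4 t)) (quintuples n)"
    using f2 f1 by (intro H.finprod_eq) auto
  also have "\<dots> = finprod ?H g J"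
    using b4 g_closed by (intro H.finprod_bij[symmetric]) auto
  also have "finprod ?H (\<lambda>t. f (h1 t)) (quintuples n) \<otimes>\<^bsub>?H\<^esub>
      (inv\<^bsub>?H\<^esub> (finprod ?H (\<lambda>t. f (h1 t)) (quintuples n)) \<otimes>\<^bsub>?H\<^esub> finprod ?H g J) = finprod ?H g J"
  proof -
    have "finprod ?H (\<lambda>t. f (h1 t)) (quintuples n) \<in> carrier ?H" "finprod ?H g J \<in> carrier ?H"
      using f1 g_closed by (auto intro!: H.finprod_in_carrier)
    then show ?thesis by (simp flip: H.m_assoc)
  qed
  finally show ?thesis unfolding left right .
qed

text \<open>
  The sign of the second sum comes from moving the derivation past an operation of degree \<open>-1\<close>.\<close>

lemma derivation_mc_sum:
  assumes D: "derivation P D" and m: "\<And>n. m n \<in> carr P n (-1)"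
  shows "D n (-2) (mc_sum P m n) =
    finprod (cpt P n (-3))
      (\<lambda>(p, q, r). pcomp P (p + 1 + r) (-2) q (-1) (p + 1) (D (p + 1 + r) (-1) (m (p + 1 + r))) (m q))
      (triples n) \<otimes>\<^bsub>cpt P n (-3)\<^esub>
    inv\<^bsub>cpt P n (-3)\<^esub> (finprod (cpt P n (-3))
      (\<lambda>(p, q, r). pcomp P (p + 1 + r) (-1) q (-2) (p + 1) (m (p + 1 + r)) (D q (-1) (m q))) (triples n))"
proof -
  let ?H = "cpt P n (-3)"
  interpret H: comm_group ?H by simp
  let ?a = "\<lambda>t. case t of (p, q, r) \<Rightarrow>
    pcomp P (p + 1 + r) (-2) q (-1) (p + 1) (D (p + 1 + r) (-1) (m (p + 1 + r))) (m q)"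
  let ?b = "\<lambda>t. case t of (p, q, r) \<Rightarrow>
    pcomp P (p + 1 + r) (-1) q (-2) (p + 1) (m (p + 1 + r)) (D q (-1) (m q))"
  have Dm: "D n (-1) (m n) \<in> carr P n (-2)" for n
    using derivationD(3)[OF D m, of n] by simp
  have a: "?a t \<in> carrier ?H" "?b t \<in> carrier ?H" if "t \<in> triples n" for t
    using that by (auto simp: triples_def intro!: pcomp_closed m Dm[simplified])
  have h: "D n (-2) \<in> hom (cpt P n (-2)) ?H"
    using derivationD(1)[OF D, of n "-2"] by simp
  have "D n (-2) (mc_sum P m n) = finprod ?H (\<lambda>t. ?a t \<otimes>\<^bsub>?H\<^esub> inv\<^bsub>?H\<^esub> (?b t)) (triples n)"
    unfolding mc_sum_def
  proof (subst hom_finprod[OF h], goal_cases)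
    case 4
    show ?case
    proof (rule H.finprod_eq)
      fix t assume t: "t \<in> triples n"
      obtain p q r where [simp]: "t = (p, q, r)" by (cases t)
      have "D n (-2) (pcomp P (p + 1 + r) (-1) q (-1) (p + 1) (m (p + 1 + r)) (m q)) =
          leibniz P (p + 1 + r) (-1) q (-1) (p + 1) (m (p + 1 + r))
            (D (p + 1 + r) (-1) (m (p + 1 + r))) (m q) (D q (-1) (m q))"
        using t by (intro derivationD(2)[OF D] m) (auto simp: triples_def)
      moreover have "p + 1 + r + q - 1 = n" using t by (simp add: triples_def)
      ultimately show "D n (-2) (case t of (p, q, r) \<Rightarrow>
          pcomp P (p + 1 + r) (-1) q (-1) (p + 1) (m (p + 1 + r)) (m q)) =
          ?a t \<otimes>\<^bsub>?H\<^esub> inv\<^bsub>?H\<^esub> (?b t)"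
        by (simp add: leibniz_def signed_def)
    qed (use a in auto)
  qed (auto simp: triples_def simp del: One_nat_def intro!: mc_term_closed[of m, OF m])
  also have "\<dots> = finprod ?H ?a (triples n) \<otimes>\<^bsub>?H\<^esub> finprod ?H (\<lambda>t. inv\<^bsub>?H\<^esub> (?b t)) (triples n)"
    using a by (intro H.finprod_mult) auto
  also have "finprod ?H (\<lambda>t. inv\<^bsub>?H\<^esub> (?b t)) (triples n) = inv\<^bsub>?H\<^esub> (finprod ?H ?b (triples n))"
    using a by (intro H.finprod_inverse) auto
  finally show ?thesis .
qed

text \<open>
  By \<open>mc_sum_jacobi\<close>, the derivatives \<open>D m\<close> in the previous lemma may be replaced by the curvatures,
  as the quadratic sums that this adds to both terms cancel.\<close>

lemma bianchi:
  assumes D: "derivation P D" and m: "\<And>n. m n \<in> carr P n (-1)"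
  shows "D n (-2) (mc_sum P m n) =
    finprod (cpt P n (-3))
      (\<lambda>(p, q, r). pcomp P (p + 1 + r) (-2) q (-1) (p + 1) (curvature P D m (p + 1 + r)) (m q))
      (triples n) \<otimes>\<^bsub>cpt P n (-3)\<^esub>
    inv\<^bsub>cpt P n (-3)\<^esub> (finprod (cpt P n (-3))
      (\<lambda>(p, q, r). pcomp P (p + 1 + r) (-1) q (-2) (p + 1) (m (p + 1 + r)) (curvature P D m q)) (triples n))"
proof -
  let ?H = "cpt P n (-3)"
  interpret H: comm_group ?H by simp
  define L where "L = (\<lambda>f. finprod ?H (\<lambda>(p, q, r).
    pcomp P (p + 1 + r) (-2) q (-1) (p + 1) (f (p + 1 + r)) (m q)) (triples n))"
  define R where "R = (\<lambda>f. finprod ?H (\<lambda>(p, q, r).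
    pcomp P (p + 1 + r) (-1) q (-2) (p + 1) (m (p + 1 + r)) (f q)) (triples n))"
  let ?D = "\<lambda>k. D k (-1) (m k)"
  have d: "?D k \<in> carr P k (-2)" for k
    using derivationD(3)[OF D m, of k] by simp
  note s = mc_sum_closed[of m, OF m]
  have Lt: "pcomp P (p + 1 + r) (-2) q (-1) (p + 1) (f (p + 1 + r)) (m q) \<in> carrier ?H"
    if "\<And>k. f k \<in> carr P k (-2)" "p + q + r = n" for f p q r
    using that(2) by (intro pcomp_closed m that(1)) auto
  have Rt: "pcomp P (p + 1 + r) (-1) q (-2) (p + 1) (m (p + 1 + r)) (f q) \<in> carrier ?H"
    if "\<And>k. f k \<in> carr P k (-2)" "p + q + r = n" for f p q r
    using that(2) by (intro pcomp_closed m that(1)) auto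
  have Lm: "pcomp P (p + 1 + r) (-2) q (-1) (p + 1) (curvature P D m (p + 1 + r)) (m q) =
      pcomp P (p + 1 + r) (-2) q (-1) (p + 1) (?D (p + 1 + r)) (m q) \<otimes>\<^bsub>?H\<^esub>
      pcomp P (p + 1 + r) (-2) q (-1) (p + 1) (mc_sum P m (p + 1 + r)) (m q)"
    if "p + q + r = n" for p q r
    unfolding curvature_def using that by (intro pcomp_mult_left d s m) auto
  have Rm: "pcomp P (p + 1 + r) (-1) q (-2) (p + 1) (m (p + 1 + r)) (curvature P D m q) =
      pcomp P (p + 1 + r) (-1) q (-2) (p + 1) (m (p + 1 + r)) (?D q) \<otimes>\<^bsub>?H\<^esub>
      pcomp P (p + 1 + r) (-1) q (-2) (p + 1) (m (p + 1 + r)) (mc_sum P m q)"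
    if "p + q + r = n" for p q r
    unfolding curvature_def using that by (intro pcomp_mult_right d s m) auto
  have L: "L f \<in> carrier ?H" "R f \<in> carrier ?H" if "\<And>k. f k \<in> carr P k (-2)" for f
    unfolding L_def R_def using Lt[OF that] Rt[OF that]
    by (auto intro!: H.finprod_in_carrier simp: triples_def simp del: One_nat_def)
  have "L (curvature P D m) = L ?D \<otimes>\<^bsub>?H\<^esub> L (mc_sum P m)"
    unfolding L_def
  proof (subst H.finprod_mult[symmetric], goal_cases)
    case 3
    show ?case
      using Lm Lt[OF d] Lt[OF s]
      by (intro H.finprod_eq) (auto simp: triples_def simp del: One_nat_def intro!: mult_closed)
  qed (use Lt[OF d] Lt[OF s] in \<open>auto simp: triples_def simp del: One_nat_def\<close>)
  moreover have "R (curvature P D m) = R ?D \<otimes>\<^bsub>?H\<^esub> R (mc_sum P m)"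
    unfolding R_def
  proof (subst H.finprod_mult[symmetric], goal_cases)
    case 3
    show ?case
      using Rm Rt[OF d] Rt[OF s]
      by (intro H.finprod_eq) (auto simp: triples_def simp del: One_nat_def intro!: mult_closed)
  qed (use Rt[OF d] Rt[OF s] in \<open>auto simp: triples_def simp del: One_nat_def\<close>)
  moreover have "L (mc_sum P m) = R (mc_sum P m)"
    unfolding L_def R_def by (rule mc_sum_jacobi[OF m])
  moreover have "D n (-2) (mc_sum P m n) = L ?D \<otimes>\<^bsub>?H\<^esub> inv\<^bsub>?H\<^esub> (R ?D)"
    unfolding L_def R_def by (rule derivation_mc_sum[OF D m])
  moreover have "L ?D \<otimes>\<^bsub>?H\<^esub> inv\<^bsub>?H\<^esub> (R ?D) =
      (L ?D \<otimes>\<^bsub>?H\<^esub> R (mc_sum P m)) \<otimes>\<^bsub>?H\<^esub> inv\<^bsub>?H\<^esub> (R ?D \<otimes>\<^bsub>?H\<^esub> R (mc_sum P m))"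
    using L[OF d] L[OF s] by (intro H.div_cancel_right)
  ultimately have "D n (-2) (mc_sum P m n) =
      L (curvature P D m) \<otimes>\<^bsub>?H\<^esub> inv\<^bsub>?H\<^esub> (R (curvature P D m))" by simp
  then show ?thesis unfolding L_def R_def .
qed

end


section \<open>Suboperads and coproducts\<close>

lemma suboperadI:
  assumes "\<And>n d. subgroup (S n d) (cpt P n d)"
    and "\<And>m a n b i x y. 1 \<le> i \<Longrightarrow> i \<le> m \<Longrightarrow> x \<in> S m a \<Longrightarrow> y \<in> S n b \<Longrightarrow>
      pcomp P m a n b i x y \<in> S (m + n - 1) (a + b)"
  shows "suboperad S P"
  using assms unfolding suboperad_def by blast

lemma generated_suboperad_least:
  assumes "suboperad S P" "\<And>n d. X n d \<subseteq> S n d"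
  shows "generated_suboperad P X n d \<subseteq> S n d"
  using assms unfolding generated_suboperad_def by blast

lemma generated_suboperad_contains: "X n d \<subseteq> generated_suboperad P X n d"
  unfolding generated_suboperad_def by blast

lemma (in graded_operad) suboperad_carr: "suboperad (carr P) P"
  using group.subgroup_self[OF cpt_group(1)] by (intro suboperadI pcomp_closed) auto

lemma (in graded_operad) suboperad_generated:
  assumes X: "\<And>n d. X n d \<subseteq> carr P n d"
  shows "suboperad (generated_suboperad P X) P"
proof (rule suboperadI)
  fix n d
  show "subgroup (generated_suboperad P X n d) (cpt P n d)"
    unfolding generated_suboperad_def
    using suboperad_carr X suboperadD(1)
    by (intro group.subgroups_Inter cpt_group) blast+
next
  fix m a n b i x y
  assume *: "1 \<le> i" "i \<le> m" "x \<in> generated_suboperad P X m a" "y \<in> generated_suboperad P X n b"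
  show "pcomp P m a n b i x y \<in> generated_suboperad P X (m + n - 1) (a + b)"
    unfolding generated_suboperad_def
  proof safe
    fix S assume S: "suboperad S P" "\<forall>m a. X m a \<subseteq> S m a"
    then have "x \<in> S m a" "y \<in> S n b"
      using *(3,4) generated_suboperad_least[of S P X] by blast+
    then show "pcomp P m a n b i x y \<in> S (m + n - 1) (a + b)"
      by (intro suboperadD(2)[OF S(1)] * refl)
  qed
qed

lemma restrict_simps [simp]:
  "cpt (restrict_operad P S) n d = (cpt P n d)\<lparr>carrier := S n d\<rparr>"
  "pcomp (restrict_operad P S) = pcomp P"
  by (simp_all add: restrict_operad_def)

lemma restrict_signed:
  assumes "group G" "subgroup H G" "x \<in> H"
  shows "signed (G\<lparr>carrier := H\<rparr>) k x = signed G k x"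
  using group.m_inv_consistent[OF assms] by (simp add: signed_def)

lemma (in graded_operad) graded_operad_restrict:
  assumes S: "suboperad S P"
  shows "graded_operad (restrict_operad P S)"
proof (rule graded_operad.intro, goal_cases)
  case (1 n d)
  note sub = suboperadD(1)[OF S, of n d]
  show ?case
    using subgroup.subgroup_is_group[OF sub cpt_group(1)] subgroup.mem_carrier[OF sub]
    by (auto intro!: group.group_comm_groupI simp: comm_monoid.m_comm)
next
  case (2 i m y n b a)
  note i = 2(1,2)
  have y: "y \<in> S n b" using 2 by simp
  show ?case
    using suboperadD(2)[OF S i _ y refl refl] suboperadD(3)[OF S] y
    by (auto intro!: homI simp: pcomp_mult_left[OF i _ _ _ refl refl] simp del: One_nat_def)
next
  case (3 i m x a n b)
  note i = 3(1,2)
  have x: "x \<in> S m a" using 3 by simp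
  show ?case
    using suboperadD(2)[OF S i x _ refl refl] suboperadD(3)[OF S] x
    by (auto intro!: homI simp: pcomp_mult_right[OF i _ _ _ refl refl] simp del: One_nat_def)
next
  case (4 i m j n x a y b z l c)
  then have "x \<in> carr P m a" "y \<in> carr P n b" "z \<in> carr P l c" using suboperadD(3)[OF S] by auto
  with 4(1-4) show ?case by (simp only: restrict_simps pcomp_seq)
next
  case (5 i k m x a y n b z l c)
  then have c: "x \<in> S m a" "y \<in> S n b" "z \<in> S l c" by auto
  have "pcomp P (m + l - 1) (a + c) n b i (pcomp P m a l c k x z) y \<in> S (m + n + l - 2) (a + b + c)"
    using 5(1-3) c by (intro suboperadD(2)[OF S]) auto
  note s = restrict_signed[OF cpt_group(1) suboperadD(1)[OF S] this]
  show ?case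
    unfolding restrict_simps s
    using 5(1-3) c by (intro pcomp_par suboperadD(3)[OF S])
qed

lemma suboperad_restrict_trans:
  assumes "graded_operad P" "suboperad S P" "suboperad T (restrict_operad P S)"
  shows "suboperad T P"
proof (rule suboperadI)
  show "subgroup (T n d) (cpt P n d)" for n d
    using group.incl_subgroup[OF graded_operad.cpt_group(1)[OF assms(1)] suboperadD(1)[OF assms(2)]]
      suboperadD(1)[OF assms(3), of n d] by simp
  show "pcomp P m a n b i x y \<in> T (m + n - 1) (a + b)"
    if "1 \<le> i" "i \<le> m" "x \<in> T m a" "y \<in> T n b" for m a n b i x y
    using suboperadD(2)[OF assms(3) that refl refl] by simp
qed

lemma operad_hom_restrict:
  assumes "operad_hom P R f" "suboperad S P"
  shows "operad_hom (restrict_operad P S) R f"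
  unfolding operad_hom_def
proof (intro conjI allI impI)
  show "f n d \<in> hom (cpt (restrict_operad P S) n d) (cpt R n d)" for n d
    using operad_homD(1,3)[OF assms(1)] suboperadD(3)[OF assms(2)] hom_mult
    by (auto intro!: homI simp: hom_mult[OF operad_homD(1)[OF assms(1)]])
  show "f (m + n - 1) (a + b) (pcomp (restrict_operad P S) m a n b i x y) =
      pcomp R m a n b i (f m a x) (f n b y)"
    if "1 \<le> i \<and> i \<le> m \<and> x \<in> carr (restrict_operad P S) m a \<and> y \<in> carr (restrict_operad P S) n b"
    for m a n b i x y
    using that suboperadD(3)[OF assms(2)]
    by (auto intro!: operad_homD(2)[OF assms(1)] simp del: One_nat_def)
qed

lemma operad_hom_id: "operad_hom P P (\<lambda>n d x. x)"
  by (simp add: operad_hom_def hom_def)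

lemma coprod_model:
  assumes R: "graded_operad R" and f: "operad_hom P R f" and g: "operad_hom K R g"
  shows "operad_model R (coprod_gens P K) (coprod_rel P K) (\<lambda>n d. case_sum (f n d) (g n d))"
proof -
  interpret graded_operad R by fact
  show ?thesis
  proof unfold_locales
    fix n d s t
    assume "coprod_rel P K n d s t"
    then show "eval R (\<lambda>n d. case_sum (f n d) (g n d)) s = eval R (\<lambda>n d. case_sum (f n d) (g n d)) t"
    proof cases
      case (Inl_add x y) then show ?thesis by (simp add: hom_mult[OF operad_homD(1)[OF f]])
    next
      case (Inr_add x y) then show ?thesis by (simp add: hom_mult[OF operad_homD(1)[OF g]])
    next
      case (Inl_comp x m a y n b i)
      then show ?thesis by (simp add: operad_homD(2)[OF f _ _ _ _ refl refl] del: One_nat_def)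
    next
      case (Inr_comp x m a y n b i)
      then show ?thesis by (simp add: operad_homD(2)[OF g _ _ _ _ refl refl] del: One_nat_def)
    qed
  qed (auto simp: coprod_gens_def intro: operad_homD(3)[OF f] operad_homD(3)[OF g])
qed

lemma graded_operad_coprod: "graded_operad (coprod_operad P K)"
  unfolding coprod_operad_def by (rule graded_operad_presented)

lemma wf_coprod_gen:
  "x \<in> carr P n d \<Longrightarrow> wf_expr (coprod_gens P K) n d (Gen n d (Inl x))"
  "y \<in> carr K n d \<Longrightarrow> wf_expr (coprod_gens P K) n d (Gen n d (Inr y))"
  by (auto intro: wf_Gen simp: coprod_gens_def)

lemma coprod_inl_hom:
  assumes "graded_operad P"
  shows "operad_hom P (coprod_operad P K) (coprod_inl P K)"
  unfolding operad_hom_def coprod_operad_def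
proof (intro conjI allI impI)
  interpret graded_operad P by fact
  show "coprod_inl P K n d \<in> hom (cpt P n d) (cpt (presented_operad (coprod_gens P K) (coprod_rel P K)) n d)" for n d
  proof (rule homI)
    fix x y assume xy: "x \<in> carr P n d" "y \<in> carr P n d"
    show "coprod_inl P K n d (x \<otimes>\<^bsub>cpt P n d\<^esub> y) = coprod_inl P K n d x
        \<otimes>\<^bsub>cpt (presented_operad (coprod_gens P K) (coprod_rel P K)) n d\<^esub> coprod_inl P K n d y"
      unfolding coprod_inl_def presented_mult[OF wf_coprod_gen(1)[OF xy(1)] wf_coprod_gen(1)[OF xy(2)]]
      by (intro oclass_eqI[symmetric] oc_rel coprod_rel.intros wf_Add wf_coprod_gen mult_closed xy)
  qed (simp add: coprod_inl_def oclass_in_carr wf_coprod_gen)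
  fix m a n b i x y
  assume "1 \<le> i \<and> i \<le> m \<and> x \<in> carr P m a \<and> y \<in> carr P n b"
  then have i: "1 \<le> i" "i \<le> m" and xy: "x \<in> carr P m a" "y \<in> carr P n b" by auto
  note wf = wf_coprod_gen(1)[OF xy(1), of K] wf_coprod_gen(1)[OF xy(2), of K]
  show "coprod_inl P K (m + n - 1) (a + b) (pcomp P m a n b i x y) =
      pcomp (presented_operad (coprod_gens P K) (coprod_rel P K)) m a n b i
        (coprod_inl P K m a x) (coprod_inl P K n b y)"
    unfolding coprod_inl_def presented_pcomp[OF wf i refl refl]
    by (intro oclass_eqI[symmetric] oc_rel coprod_rel.intros wf_Comp[OF wf i] wf_coprod_gen i xy
        pcomp_closed refl)
qed

lemma coprod_inr_hom:
  assumes "graded_operad K"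
  shows "operad_hom K (coprod_operad P K) (coprod_inr P K)"
  unfolding operad_hom_def coprod_operad_def
proof (intro conjI allI impI)
  interpret graded_operad K by fact
  show "coprod_inr P K n d \<in> hom (cpt K n d) (cpt (presented_operad (coprod_gens P K) (coprod_rel P K)) n d)" for n d
  proof (rule homI)
    fix x y assume xy: "x \<in> carr K n d" "y \<in> carr K n d"
    show "coprod_inr P K n d (x \<otimes>\<^bsub>cpt K n d\<^esub> y) = coprod_inr P K n d x
        \<otimes>\<^bsub>cpt (presented_operad (coprod_gens P K) (coprod_rel P K)) n d\<^esub> coprod_inr P K n d y"
      unfolding coprod_inr_def presented_mult[OF wf_coprod_gen(2)[OF xy(1)] wf_coprod_gen(2)[OF xy(2)]]
      by (intro oclass_eqI[symmetric] oc_rel coprod_rel.intros wf_Add wf_coprod_gen mult_closed xy)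
  qed (simp add: coprod_inr_def oclass_in_carr wf_coprod_gen)
  fix m a n b i x y
  assume "1 \<le> i \<and> i \<le> m \<and> x \<in> carr K m a \<and> y \<in> carr K n b"
  then have i: "1 \<le> i" "i \<le> m" and xy: "x \<in> carr K m a" "y \<in> carr K n b" by auto
  note wf = wf_coprod_gen(2)[OF xy(1), of P] wf_coprod_gen(2)[OF xy(2), of P]
  show "coprod_inr P K (m + n - 1) (a + b) (pcomp K m a n b i x y) =
      pcomp (presented_operad (coprod_gens P K) (coprod_rel P K)) m a n b i
        (coprod_inr P K m a x) (coprod_inr P K n b y)"
    unfolding coprod_inr_def presented_pcomp[OF wf i refl refl]
    by (intro oclass_eqI[symmetric] oc_rel coprod_rel.intros wf_Comp[OF wf i] wf_coprod_gen i xy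
        pcomp_closed refl)
qed

text \<open>
  The universal property of the coproduct, in a form that does not mention expressions.\<close>

lemma coprod_universal:
  assumes R: "graded_operad R" and f: "operad_hom P R f" and g: "operad_hom K R g"
  obtains h where "operad_hom (coprod_operad P K) R h"
    "\<And>n d x. x \<in> carr P n d \<Longrightarrow> h n d (coprod_inl P K n d x) = f n d x"
    "\<And>n d y. y \<in> carr K n d \<Longrightarrow> h n d (coprod_inr P K n d y) = g n d y"
proof -
  interpret operad_model R "coprod_gens P K" "coprod_rel P K" "\<lambda>n d. case_sum (f n d) (g n d)"
    by (rule coprod_model[OF R f g])
  show ?thesis
    using that[OF induced_map_hom[folded coprod_operad_def]]
    by (simp add: coprod_inl_def coprod_inr_def induced_map_oclass wf_coprod_gen)
qed

lemma coprod_hom_unique: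
  assumes "operad_hom (coprod_operad P K) R f" "operad_hom (coprod_operad P K) R g" "graded_operad R"
    and "\<And>n d x. x \<in> carr P n d \<Longrightarrow> f n d (coprod_inl P K n d x) = g n d (coprod_inl P K n d x)"
    and "\<And>n d y. y \<in> carr K n d \<Longrightarrow> f n d (coprod_inr P K n d y) = g n d (coprod_inr P K n d y)"
    and "X \<in> carr (coprod_operad P K) n d"
  shows "f n d X = g n d X"
proof (rule presented_hom_unique[OF assms(1,2)[unfolded coprod_operad_def] assms(3)])
  show "X \<in> carr (presented_operad (coprod_gens P K) (coprod_rel P K)) n d"
    using assms(6) by (simp add: coprod_operad_def)
  fix n d z assume "z \<in> coprod_gens P K n d"
  then consider x where "z = Inl x" "x \<in> carr P n d" | y where "z = Inr y" "y \<in> carr K n d"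
    by (auto simp: coprod_gens_def)
  then show "f n d (oclass (coprod_gens P K) (coprod_rel P K) n d (Gen n d z)) =
      g n d (oclass (coprod_gens P K) (coprod_rel P K) n d (Gen n d z))"
    by cases (simp_all add: assms(4,5)[unfolded coprod_inl_def coprod_inr_def])
qed

lemma graded_operad_free: "graded_operad (free_operad G)"
  unfolding free_operad_def by (rule graded_operad_presented)

lemma free_gen_closed: "g \<in> G n d \<Longrightarrow> free_gen G n d g \<in> carr (free_operad G) n d"
  by (simp add: free_operad_def free_gen_def presented_gen_closed)

lemma free_universal:
  assumes R: "graded_operad R" and "\<And>n d g. g \<in> G n d \<Longrightarrow> \<gamma> n d g \<in> carr R n d"
  obtains h where "operad_hom (free_operad G) R h"
    "\<And>n d g. g \<in> G n d \<Longrightarrow> h n d (free_gen G n d g) = \<gamma> n d g"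
proof -
  interpret operad_model R G no_rel \<gamma>
    using assms by (simp add: operad_model_def operad_model_axioms_def)
  show ?thesis
    using that[OF induced_map_hom[folded free_operad_def]]
    by (simp add: free_gen_def induced_map_oclass wf_Gen)
qed

lemma free_hom_unique:
  assumes "operad_hom (free_operad G) R f" "operad_hom (free_operad G) R g" "graded_operad R"
    and "\<And>n d x. x \<in> G n d \<Longrightarrow> f n d (free_gen G n d x) = g n d (free_gen G n d x)"
    and "X \<in> carr (free_operad G) n d"
  shows "f n d X = g n d X"
  by (rule presented_hom_unique[OF assms(1,2)[unfolded free_operad_def] assms(3)
        assms(4)[unfolded free_gen_def] assms(5)[unfolded free_operad_def]])

lemma free_generated:
  assumes "suboperad S (free_operad G)" "\<And>n d x. x \<in> G n d \<Longrightarrow> free_gen G n d x \<in> S n d"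
    and "X \<in> carr (free_operad G) n d"
  shows "X \<in> S n d"
  using assms presented_generated unfolding free_operad_def free_gen_def by blast


section \<open>Weights\<close>

context graded_operad
begin

context
  fixes S :: "nat \<Rightarrow> int \<Rightarrow> 'a set" and k :: 'a
  assumes S: "suboperad S P" and k: "k \<in> carr P 0 (-1)"
begin

lemma weight_part_carr: "weight_part P S k w n d x \<Longrightarrow> x \<in> carr P n d"
proof (induction rule: weight_part.induct)
  case (wp_comp v m a x w n b y i)
  then show ?case by (intro pcomp_closed refl)
qed (simp_all add: k suboperadD(3)[OF S] mult_closed inv_in_carr one_in_carr)

lemma subgroup_weight_part: "subgroup {x. weight_part P S k w n d x} (cpt P n d)"
proof (rule group.subgroupI[OF cpt_group(1)])
  show "{x. weight_part P S k w n d x} \<noteq> {}" using wp_zero[of P S k w n d] by blast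
qed (auto simp: weight_part_carr wp_neg wp_add)

lemma weight_part_comp:
  "weight_part P S k v m a x \<Longrightarrow> weight_part P S k w n b y \<Longrightarrow> 1 \<le> i \<Longrightarrow> i \<le> m \<Longrightarrow>
    u = v + w \<Longrightarrow> N = m + n - 1 \<Longrightarrow> d = a + b \<Longrightarrow> weight_part P S k u N d (pcomp P m a n b i x y)"
  by (simp del: One_nat_def add: wp_comp)

lemma weight_part_leibniz:
  assumes "weight_part P S k v m a x" "weight_part P S k (v + u) m (a - 1) x'"
    "weight_part P S k w n b y" "weight_part P S k (w + u) n (b - 1) y'" "1 \<le> i" "i \<le> m"
  shows "weight_part P S k (v + w + u) (m + n - 1) (a + b - 1) (leibniz P m a n b i x x' y y')"
proof -
  have "weight_part P S k (v + w + u) (m + n - 1) (a + b - 1) (pcomp P m (a - 1) n b i x' y)"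
    by (rule weight_part_comp[OF assms(2,3,5,6)]) auto
  moreover have "weight_part P S k (v + w + u) (m + n - 1) (a + b - 1) (pcomp P m a n (b - 1) i x y')"
    by (rule weight_part_comp[OF assms(1,4,5,6)]) auto
  ultimately show ?thesis
    unfolding leibniz_def signed_def by (auto intro: wp_add wp_neg)
qed

text \<open>
  By the Leibniz rule it suffices to know the effect of a derivation on weights for the base and for
  the distinguished operation.\<close>

lemma derivation_raises_weight:
  assumes D: "derivation P D"
    and base: "\<And>n d x. x \<in> S n d \<Longrightarrow> weight_part P S k u n (d - 1) (D n d x)"
    and kappa: "weight_part P S k (1 + u) 0 (-2) (D 0 (-1) k)"
  shows "weight_part P S k w n d x \<Longrightarrow> weight_part P S k (w + u) n (d - 1) (D n d x)"
proof (induction rule: weight_part.induct)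
  case (wp_base x n d) then show ?case using base by simp
next
  case wp_kappa then show ?case using kappa by simp
next
  case (wp_zero w n d)
  then show ?case
    using hom_to_one[OF derivationD(1)[OF D]] by (simp add: weight_part.wp_zero)
next
  case (wp_add w n d x y)
  then show ?case
    by (simp add: hom_mult[OF derivationD(1)[OF D]] weight_part_carr weight_part.wp_add)
next
  case (wp_neg w n d x)
  then show ?case
    by (simp add: hom_inv[OF derivationD(1)[OF D]] weight_part_carr weight_part.wp_neg)
next
  case (wp_comp v m a x w n b y i)
  have "D (m + n - 1) (a + b) (pcomp P m a n b i x y) = leibniz P m a n b i x (D m a x) y (D n b y)"
    by (rule derivationD(2)[OF D wp_comp(3,4) weight_part_carr weight_part_carr refl refl])
      (use wp_comp in auto)
  then show ?case
    using weight_part_leibniz[OF wp_comp(1) wp_comp.IH(1) wp_comp(2) wp_comp.IH(2) wp_comp(3,4)] by simp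
qed

lemma derivation_weight_suboperad:
  assumes D: "derivation P D"
  shows "suboperad (\<lambda>n d. {x \<in> S n d. weight_part P S k u n (d - 1) (D n d x)}) P"
proof (rule suboperadI)
  fix n d
  note sub = suboperadD(1)[OF S, of n d]
  note c = suboperadD(3)[OF S]
  show "subgroup {x \<in> S n d. weight_part P S k u n (d - 1) (D n d x)} (cpt P n d)"
  proof (rule group.subgroupI[OF cpt_group(1)])
    show "{x \<in> S n d. weight_part P S k u n (d - 1) (D n d x)} \<noteq> {}"
      using subgroup.one_closed[OF sub] hom_to_one[OF derivationD(1)[OF D], of n d]
        wp_zero[of P S k u n "d - 1"] by auto
  qed (use c subgroup.m_inv_closed[OF sub] subgroup.m_closed[OF sub] in
      \<open>auto simp: hom_inv[OF derivationD(1)[OF D]] hom_mult[OF derivationD(1)[OF D]] intro: wp_neg wp_add\<close>)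
next
  fix m a n b i x y
  assume i: "1 \<le> i" "i \<le> m"
    and x: "x \<in> {x \<in> S m a. weight_part P S k u m (a - 1) (D m a x)}"
    and y: "y \<in> {x \<in> S n b. weight_part P S k u n (b - 1) (D n b x)}"
  then have xy: "x \<in> S m a" "y \<in> S n b" by auto
  have "D (m + n - 1) (a + b) (pcomp P m a n b i x y) = leibniz P m a n b i x (D m a x) y (D n b y)"
    by (rule derivationD(2)[OF D i suboperadD(3)[OF S xy(1)] suboperadD(3)[OF S xy(2)] refl refl])
  then show "pcomp P m a n b i x y \<in> {x \<in> S (m + n - 1) (a + b).
      weight_part P S k u (m + n - 1) (a + b - 1) (D (m + n - 1) (a + b) x)}"
    using weight_part_leibniz[OF wp_base[of x S m a P k, OF xy(1)] _ wp_base[of y S n b P k, OF xy(2)] _ i, of u] x y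
      suboperadD(2)[OF S i xy refl refl] by simp
qed

end

lemma derivation_sum:
  assumes D: "derivation P D" and D': "derivation P D'"
  shows "derivation P (\<lambda>n d x. D n d x \<otimes>\<^bsub>cpt P n (d - 1)\<^esub> D' n d x)"
  unfolding derivation_def
proof (intro conjI allI impI)
  fix n d
  show "(\<lambda>x. D n d x \<otimes>\<^bsub>cpt P n (d - 1)\<^esub> D' n d x) \<in> hom (cpt P n d) (cpt P n (d - 1))"
    using derivationD(3)[OF D] derivationD(3)[OF D']
    by (auto intro!: homI mult_swap_inner mult_closed
        simp: hom_mult[OF derivationD(1)[OF D]] hom_mult[OF derivationD(1)[OF D']])
next
  fix m a n b i x y
  assume "1 \<le> i \<and> i \<le> m \<and> x \<in> carr P m a \<and> y \<in> carr P n b"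
  then have i: "1 \<le> i" "i \<le> m" and xy: "x \<in> carr P m a" "y \<in> carr P n b" by auto
  let ?H = "cpt P (m + n - 1) (a + b - 1)"
  interpret H: comm_group ?H by simp
  note d = derivationD(3)[OF D xy(1)] derivationD(3)[OF D xy(2)]
    derivationD(3)[OF D' xy(1)] derivationD(3)[OF D' xy(2)]
  have l: "pcomp P m (a - 1) n b i (D m a x \<otimes>\<^bsub>cpt P m (a - 1)\<^esub> D' m a x) y =
      pcomp P m (a - 1) n b i (D m a x) y \<otimes>\<^bsub>?H\<^esub> pcomp P m (a - 1) n b i (D' m a x) y"
    using d xy i by (intro pcomp_mult_left) auto
  have r: "pcomp P m a n (b - 1) i x (D n b y \<otimes>\<^bsub>cpt P n (b - 1)\<^esub> D' n b y) =
      pcomp P m a n (b - 1) i x (D n b y) \<otimes>\<^bsub>?H\<^esub> pcomp P m a n (b - 1) i x (D' n b y)"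
    using d xy i by (intro pcomp_mult_right) auto
  have c: "pcomp P m (a - 1) n b i (D m a x) y \<in> carrier ?H"
    "pcomp P m (a - 1) n b i (D' m a x) y \<in> carrier ?H"
    "pcomp P m a n (b - 1) i x (D n b y) \<in> carrier ?H"
    "pcomp P m a n (b - 1) i x (D' n b y) \<in> carrier ?H"
    using d xy i by (auto intro!: pcomp_closed)
  show "D (m + n - 1) (a + b) (pcomp P m a n b i x y) \<otimes>\<^bsub>?H\<^esub>
      D' (m + n - 1) (a + b) (pcomp P m a n b i x y) =
    leibniz P m a n b i x (D m a x \<otimes>\<^bsub>cpt P m (a - 1)\<^esub> D' m a x) y
      (D n b y \<otimes>\<^bsub>cpt P n (b - 1)\<^esub> D' n b y)"
    unfolding derivationD(2)[OF D i xy refl refl] derivationD(2)[OF D' i xy refl refl]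
      leibniz_def l r signed_mult[OF comm_group_cpt c(3,4)]
    using c by (intro mult_swap_inner signed_in_carr)
qed

end


section \<open>The curved A-infinity operad is a curved operad\<close>

abbreviation free_mu :: "unit expr set goperad" where
  "free_mu \<equiv> free_operad mu_gens"

interpretation free_mu: graded_operad free_mu
  by (rule graded_operad_free)

lemma wf_mu_expr: "wf_expr mu_gens n (-1) (mu_expr n)"
  unfolding mu_expr_def by (rule wf_Gen) (simp add: mu_gens_def)

lemma mu_oclass: "mu n = oclass mu_gens no_rel n (-1) (mu_expr n)"
  by (simp add: mu_def free_gen_def mu_expr_def)

lemma mu_closed: "mu n \<in> carr free_mu n (-1)"
  unfolding mu_def by (rule free_gen_closed) (simp add: mu_gens_def)

lemma mu_gens_cases: "g \<in> mu_gens n d \<Longrightarrow> d = -1 \<and> free_gen mu_gens n d g = mu n"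
  by (simp add: mu_gens_def mu_def split: if_splits)

lemma foldr_Add_oclass:
  assumes "\<And>x. x \<in> set xs \<Longrightarrow> wf_expr G n d (f x)" "distinct xs"
  shows "wf_expr G n d (foldr Add (map f xs) (Zero n d)) \<and>
    oclass G E n d (foldr Add (map f xs) (Zero n d)) =
    finprod (cpt (presented_operad G E) n d) (\<lambda>x. oclass G E n d (f x)) (set xs)"
  using assms
proof (induction xs)
  case Nil
  interpret comm_group "cpt (presented_operad G E) n d" by (rule presented_comm_group)
  show ?case by (simp add: wf_Zero presented_one)
next
  case (Cons x xs)
  interpret comm_group "cpt (presented_operad G E) n d" by (rule presented_comm_group)
  let ?t = "foldr Add (map f xs) (Zero n d)"
  have IH: "wf_expr G n d ?t" "oclass G E n d ?t =
      finprod (cpt (presented_operad G E) n d) (\<lambda>x. oclass G E n d (f x)) (set xs)"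
    using Cons by auto
  have "oclass G E n d (f x) \<otimes>\<^bsub>cpt (presented_operad G E) n d\<^esub> oclass G E n d ?t =
      finprod (cpt (presented_operad G E) n d) (\<lambda>x. oclass G E n d (f x)) (set (x # xs))"
    using Cons.prems oclass_in_carr[of G n d, of _ E] unfolding IH(2)
    by (simp add: finprod_insert Pi_def)
  then show ?case
    using Cons.prems IH(1) by (simp add: presented_mult wf_Add)
qed

definition triple_list :: "nat \<Rightarrow> (nat \<times> nat \<times> nat) list" where
  "triple_list n = filter (\<lambda>(p, q, r). p + q + r = n)
     (List.product [0..<n + 1] (List.product [0..<n + 1] [0..<n + 1]))"

lemma set_triple_list: "set (triple_list n) = triples n"
  by (auto simp: triple_list_def triples_def)

lemma distinct_triple_list: "distinct (triple_list n)"
  unfolding triple_list_def by (intro distinct_filter distinct_product distinct_upt)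

text \<open>
  The summands of the differential of \<open>\<mu>\<^sub>n\<close> selected by a predicate \<open>C\<close>. All of them give the
  differential itself; its components of weight zero and one arise from complementary predicates.\<close>

definition mu_part :: "(nat \<times> nat \<times> nat \<Rightarrow> bool) \<Rightarrow> nat \<Rightarrow> int \<Rightarrow> unit \<Rightarrow> unit expr" where
  "mu_part C n d g = Neg (foldr Add
     (map (\<lambda>(p, q, r). Comp (p + 1) (mu_expr (p + 1 + r)) (mu_expr q)) (filter C (triple_list n)))
     (Zero n (-2)))"

lemma concat_map_if: "concat (map (\<lambda>x. if Q x then [f x] else []) xs) = map f (filter Q xs)"
  by (induction xs) auto

lemma mu_diff_eq_mu_part: "mu_diff = mu_part (\<lambda>_. True)"
proof (intro ext)
  fix n d g
  have "[Comp (p + 1) (mu_expr (p + 1 + r)) (mu_expr q).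
      p \<leftarrow> [0..<n + 1], q \<leftarrow> [0..<n + 1], r \<leftarrow> [0..<n + 1], p + q + r = n] =
    map (\<lambda>(p, q, r). Comp (p + 1) (mu_expr (p + 1 + r)) (mu_expr q)) (triple_list n)"
    unfolding triple_list_def product_concat_map
    by (simp add: filter_concat map_concat filter_map comp_def concat_map_if del: upt_Suc)
  then show "mu_diff n d g = mu_part (\<lambda>_. True) n d g"
    by (simp add: mu_diff_def mu_part_def del: upt_Suc)
qed

definition mu_term :: "nat \<times> nat \<times> nat \<Rightarrow> unit expr set" where
  "mu_term = (\<lambda>(p, q, r). pcomp free_mu (p + 1 + r) (-1) q (-1) (p + 1) (mu (p + 1 + r)) (mu q))"

lemma mu_term_closed: "t \<in> triples n \<Longrightarrow> mu_term t \<in> carr free_mu n (-2)"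
  using free_mu.mc_term_closed[of mu, OF mu_closed]
  by (auto simp: mu_term_def triples_def simp del: One_nat_def)

lemma mu_part_oclass:
  "wf_expr mu_gens n (-2) (mu_part C n d g)"
  "oclass mu_gens no_rel n (-2) (mu_part C n d g) =
    inv\<^bsub>cpt free_mu n (-2)\<^esub> (finprod (cpt free_mu n (-2)) mu_term {t \<in> triples n. C t})"
proof -
  let ?f = "\<lambda>(p, q, r). Comp (p + 1) (mu_expr (p + 1 + r)) (mu_expr q)"
  let ?xs = "filter C (triple_list n)"
  have wf: "wf_expr mu_gens n (-2) (?f t)" if t: "t \<in> triples n" for t
    using t by (auto simp: triples_def intro!: wf_Comp' wf_mu_expr)
  have xs: "set ?xs = {t \<in> triples n. C t}" "distinct ?xs"
    by (auto simp: set_triple_list distinct_triple_list)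
  have *: "wf_expr mu_gens n (-2) (foldr Add (map ?f ?xs) (Zero n (-2)))"
    "oclass mu_gens no_rel n (-2) (foldr Add (map ?f ?xs) (Zero n (-2))) =
      finprod (cpt free_mu n (-2)) (\<lambda>t. oclass mu_gens no_rel n (-2) (?f t)) {t \<in> triples n. C t}"
    using foldr_Add_oclass[of ?xs mu_gens n "-2" ?f no_rel] wf xs
    unfolding free_operad_def by auto
  show "wf_expr mu_gens n (-2) (mu_part C n d g)"
    unfolding mu_part_def by (rule wf_Neg[OF *(1)])
  interpret H: comm_group "cpt free_mu n (-2)" by simp
  have "oclass mu_gens no_rel n (-2) (?f t) = mu_term t" if mem: "t \<in> triples n" for t
  proof -
    obtain p q r where t: "t = (p, q, r)" "p + q + r = n"
      using mem by (auto simp: triples_def)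
    show ?thesis
      unfolding t(1) mu_term_def mu_oclass free_operad_def prod.case
      using t(2) by (intro presented_pcomp[symmetric] wf_mu_expr) auto
  qed
  then have "finprod (cpt free_mu n (-2)) (\<lambda>t. oclass mu_gens no_rel n (-2) (?f t)) {t \<in> triples n. C t} =
      finprod (cpt free_mu n (-2)) mu_term {t \<in> triples n. C t}"
    using mu_term_closed by (intro H.finprod_eq) auto
  then show "oclass mu_gens no_rel n (-2) (mu_part C n d g) =
    inv\<^bsub>cpt free_mu n (-2)\<^esub> (finprod (cpt free_mu n (-2)) mu_term {t \<in> triples n. C t})"
    unfolding mu_part_def using presented_inv[OF *(1), of no_rel] *(2)
    by (simp add: free_operad_def)
qed

abbreviation mu_deriv :: "(nat \<times> nat \<times> nat \<Rightarrow> bool) \<Rightarrow> nat \<Rightarrow> int \<Rightarrow> unit expr set \<Rightarrow> unit expr set" where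
  "mu_deriv C \<equiv> free_deriv mu_gens (mu_part C)"

interpretation mu_part: generator_derivative mu_gens "mu_part C" for C
  by unfold_locales (auto simp: mu_gens_def mu_part_oclass split: if_splits)

lemma derivation_mu_deriv: "derivation free_mu (mu_deriv C)"
  by (rule mu_part.derivation_free_deriv)

lemma mu_deriv_mu: "mu_deriv C n (-1) (mu n) =
    inv\<^bsub>cpt free_mu n (-2)\<^esub> (finprod (cpt free_mu n (-2)) mu_term {t \<in> triples n. C t})"
  unfolding mu_oclass[of n] mu_part.free_deriv_oclass[OF wf_mu_expr]
  by (simp add: mu_expr_def mu_part_oclass)

lemma mc_sum_mu: "mc_sum free_mu mu n = finprod (cpt free_mu n (-2)) mu_term (triples n)"
  by (simp add: mc_sum_def mu_term_def)

lemma cA_inf_simps [simp]: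
  "cpt cA_inf = cpt free_mu" "pcomp cA_inf = pcomp free_mu"
  "odiff cA_inf = mu_deriv (\<lambda>_. True)" "kappa cA_inf = mu 0"
  by (simp_all add: cA_inf_def mu_diff_eq_mu_part)

text \<open>
  The differential is defined such that the universal sequence \<open>\<mu>\<close> has no curvature.\<close>

lemma curvature_mu: "curvature free_mu (mu_deriv (\<lambda>_. True)) mu n = \<one>\<^bsub>cpt free_mu n (-2)\<^esub>"
proof -
  interpret comm_group "cpt free_mu n (-2)" by simp
  have "finprod (cpt free_mu n (-2)) mu_term (triples n) \<in> carr free_mu n (-2)"
    using mu_term_closed by (intro finprod_in_carrier)
  then show ?thesis unfolding curvature_def mu_deriv_mu mc_sum_mu by simp
qed

lemma mu_deriv_square:
  assumes X: "X \<in> carr free_mu n d"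
  shows "mu_deriv (\<lambda>_. True) n (d - 1) (mu_deriv (\<lambda>_. True) n d X) = \<one>\<^bsub>cpt free_mu n (d - 2)\<^esub>"
proof -
  let ?D = "mu_deriv (\<lambda>_. True)"
  note D = derivation_mu_deriv[of "\<lambda>_. True"]
  let ?S = "\<lambda>n d. {x \<in> carr free_mu n d. ?D n (d - 1) (?D n d x) = \<one>\<^bsub>cpt free_mu n (d - 2)\<^esub>}"
  have "?D n (-2) (?D n (-1) (mu n)) = \<one>\<^bsub>cpt free_mu n (-3)\<^esub>" for n
  proof -
    let ?H = "cpt free_mu n (-3)"
    interpret H: comm_group ?H by simp
    \<comment> \<open>By the Bianchi identity, whose right-hand side is made of curvatures.\<close>
    have "?D n (-2) (mc_sum free_mu mu n) = \<one>\<^bsub>?H\<^esub>"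
    proof -
      have "pcomp free_mu (p + 1 + r) (-2) q (-1) (p + 1) \<one>\<^bsub>cpt free_mu (p + 1 + r) (-2)\<^esub> (mu q) = \<one>\<^bsub>?H\<^esub>"
        "pcomp free_mu (p + 1 + r) (-1) q (-2) (p + 1) (mu (p + 1 + r)) \<one>\<^bsub>cpt free_mu q (-2)\<^esub> = \<one>\<^bsub>?H\<^esub>"
        if "p + q + r = n" for p q r
        using that by (intro free_mu.pcomp_one_left free_mu.pcomp_one_right mu_closed; simp)+
      then have "finprod ?H (\<lambda>(p, q, r). pcomp free_mu (p + 1 + r) (-2) q (-1) (p + 1)
            \<one>\<^bsub>cpt free_mu (p + 1 + r) (-2)\<^esub> (mu q)) (triples n) = \<one>\<^bsub>?H\<^esub>"
        "finprod ?H (\<lambda>(p, q, r). pcomp free_mu (p + 1 + r) (-1) q (-2) (p + 1)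
            (mu (p + 1 + r)) \<one>\<^bsub>cpt free_mu q (-2)\<^esub>) (triples n) = \<one>\<^bsub>?H\<^esub>"
        by (auto intro!: H.finprod_one_eqI simp: triples_def simp del: One_nat_def)
      then show ?thesis
        using free_mu.bianchi[OF D mu_closed, of n] unfolding curvature_mu by simp
    qed
    moreover have "?D n (-1) (mu n) = inv\<^bsub>cpt free_mu n (-2)\<^esub> (mc_sum free_mu mu n)"
      unfolding mu_deriv_mu mc_sum_mu by simp
    moreover have "?D n (-2) \<in> hom (cpt free_mu n (-2)) ?H"
      using derivationD(1)[OF D, of n "-2"] by simp
    ultimately show ?thesis
      using hom_inv[of "?D n (-2)" "cpt free_mu n (-2)" ?H "mc_sum free_mu mu n"]
        free_mu.mc_sum_closed[of mu, OF mu_closed] by simp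
  qed
  then have "X \<in> ?S n d"
    by (intro free_generated[OF free_mu.derivation_square_suboperad[OF D] _ X])
      (auto dest!: mu_gens_cases simp: mu_closed)
  then show ?thesis by simp
qed

lemma dg_operad_cA_inf: "dg_operad cA_inf"
proof (intro dg_operad.intro dg_operad_axioms.intro)
  show "graded_operad cA_inf"
    by (rule graded_operad_cong[OF free_mu.graded_operad_axioms]) simp_all
  note D = derivation_mu_deriv[of "\<lambda>_. True"]
  show "odiff cA_inf n d \<in> hom (cpt cA_inf n d) (cpt cA_inf n (d - 1))" for n d
    using derivationD(1)[OF D] by simp
  show "odiff cA_inf n (d - 1) (odiff cA_inf n d x) = \<one>\<^bsub>cpt cA_inf n (d - 2)\<^esub>"
    if "x \<in> carr cA_inf n d" for x n d
    using mu_deriv_square that by simp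
  show "odiff cA_inf (m + n - 1) (a + b) (pcomp cA_inf m a n b i x y) =
      pcomp cA_inf m (a - 1) n b i (odiff cA_inf m a x) y
      \<otimes>\<^bsub>cpt cA_inf (m + n - 1) (a + b - 1)\<^esub>
      signed (cpt cA_inf (m + n - 1) (a + b - 1)) a (pcomp cA_inf m a n (b - 1) i x (odiff cA_inf n b y))"
    if "1 \<le> i" "i \<le> m" "x \<in> carr cA_inf m a" "y \<in> carr cA_inf n b" for i m x a y n b
    using derivationD(2)[OF D, of i m x a y n b] that by (simp add: leibniz_def)
qed

subsection \<open>The suboperad generated by the operations of positive arity\<close>

abbreviation mu_base :: "nat \<Rightarrow> int \<Rightarrow> unit expr set set" where
  "mu_base \<equiv> generated_suboperad free_mu (\<lambda>n d. if n > 0 \<and> d = -1 then {mu n} else {})"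

lemma base_cA_inf [simp]: "base cA_inf = mu_base"
  by (simp add: cA_inf_def)

lemma suboperad_mu_base: "suboperad mu_base free_mu"
  by (rule free_mu.suboperad_generated) (auto simp: mu_closed)

lemma mu_in_base: "n > 0 \<Longrightarrow> mu n \<in> mu_base n (-1)"
  using generated_suboperad_contains[of "\<lambda>n d. if n > 0 \<and> d = -1 then {mu n} else {}" n "-1" free_mu]
  by simp

lemma mu_base_least:
  assumes "suboperad S free_mu" "\<And>n. n > 0 \<Longrightarrow> mu n \<in> S n (-1)" "x \<in> mu_base n d"
  shows "x \<in> S n d"
proof -
  have "mu_base n d \<subseteq> S n d"
    by (rule generated_suboperad_least[OF assms(1)]) (simp add: assms(2))
  then show ?thesis using assms(3) by blast
qed

text \<open>
  An operad concentrated in arity zero and degree \<open>-1\<close>, with no nonzero composition. Sending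
  \<open>\<mu>\<^sub>0\<close> to \<open>1\<close> and the other generators to zero gives a morphism to it that kills the base but not
  \<open>\<mu>\<^sub>0\<close>.\<close>

definition point_operad :: "int goperad" where
  "point_operad =
     \<lparr>cpt = (\<lambda>n d. \<lparr>carrier = (if n = 0 \<and> d = -1 then UNIV else {0}), mult = (+), one = 0\<rparr>),
      pcomp = (\<lambda>m a n b i x y. 0)\<rparr>"

lemma graded_operad_point: "graded_operad point_operad"
proof (rule graded_operad.intro)
  show g: "comm_group (cpt point_operad n d)" for n d
    by (rule comm_groupI) (auto simp: point_operad_def intro: exI[of _ "- x" for x])
  show "pcomp point_operad (m + n - 1) (a + b) l c (k - 1 + n) (pcomp point_operad m a n b i x y) z =
      signed (cpt point_operad (m + n + l - 2) (a + b + c)) (b * c)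
        (pcomp point_operad (m + l - 1) (a + c) n b i (pcomp point_operad m a l c k x z) y)"
    for m n a b l c k i x y z
    using signed_one[OF g, of "m + n + l - 2" "a + b + c" "b * c"]
    by (simp add: point_operad_def)
qed (auto simp: point_operad_def hom_def)

lemma mu_0_notin_base: "mu 0 \<notin> mu_base 0 (-1)"
proof
  assume mem: "mu 0 \<in> mu_base 0 (-1)"
  obtain h where h: "operad_hom free_mu point_operad h"
    and gen: "\<And>n d g. g \<in> mu_gens n d \<Longrightarrow> h n d (free_gen mu_gens n d g) = (if n = 0 then 1 else 0)"
  proof (rule free_universal[OF graded_operad_point, of mu_gens "\<lambda>n d g. if n = 0 then 1 else 0"])
    show "(if n = 0 then 1 else 0) \<in> carr point_operad n d" if "g \<in> mu_gens n d" for n d and g :: unit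
      using that by (simp add: point_operad_def mu_gens_def split: if_splits)
  qed blast
  have h_mu: "h n (-1) (mu n) = (if n = 0 then 1 else 0)" for n
    using gen[of "()" n "-1"] by (simp add: mu_gens_def mu_def)
  have "operad_hom free_mu point_operad (\<lambda>n d x. 0)"
    by (auto simp: operad_hom_def hom_def point_operad_def)
  from equalizer_suboperad[OF h this graded_operad_free graded_operad_point]
  have "mu 0 \<in> {x \<in> carr free_mu 0 (-1). h 0 (-1) x = 0}"
    by (rule mu_base_least[OF _ _ mem]) (simp add: mu_closed h_mu)
  then show False using h_mu[of 0] by simp
qed

subsection \<open>Freeness over the distinguished operation\<close>

text \<open>
  The natural morphism \<open>h\<close> is inverted by the morphism \<open>g\<close> out of the free operad with
  \<open>\<mu>\<^sub>0 \<mapsto> \<kappa>\<close> and \<open>\<mu>\<^sub>n \<mapsto> \<mu>\<^sub>n\<close> for \<open>n > 0\<close>. Since \<open>g\<close> agrees with the left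
  injection on these generators, it does so on the suboperad which they generate.\<close>

lemma natural_iso_cA_inf: "natural_iso cA_inf mu_base (mu 0)"
proof -
  let ?B = "restrict_operad free_mu mu_base" and ?K = kappa_operad
  let ?C = "coprod_operad ?B ?K"
  have restrict: "restrict_operad cA_inf mu_base = ?B" by (simp add: restrict_operad_def)
  have B: "graded_operad ?B" by (rule free_mu.graded_operad_restrict[OF suboperad_mu_base])
  have K: "graded_operad ?K" unfolding kappa_operad_def by (rule graded_operad_free)
  have kgen: "kappa_gen \<in> carr ?K 0 (-1)"
    unfolding kappa_gen_def kappa_operad_def by (rule free_gen_closed) (simp add: kappa_gens_def)
  note inl = coprod_inl_hom[OF B, of ?K] and inr = coprod_inr_hom[OF K, of ?B]
  obtain k where k: "operad_hom ?K free_mu k" and k_gen: "k 0 (-1) kappa_gen = mu 0"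
  proof (rule free_universal[OF graded_operad_free, of kappa_gens "\<lambda>n d g. mu n" mu_gens])
    show "mu n \<in> carr free_mu n d" if "g \<in> kappa_gens n d" for n d g
      using that mu_closed by (simp add: kappa_gens_def split: if_splits)
    fix k assume "operad_hom (free_operad kappa_gens) free_mu k"
      "\<And>n d g. g \<in> kappa_gens n d \<Longrightarrow> k n d (free_gen kappa_gens n d g) = mu n"
    then show thesis
      using that[of k] by (simp add: kappa_operad_def kappa_gen_def kappa_gens_def)
  qed
  obtain h where h: "operad_hom ?C free_mu h"
    and h_inl: "\<And>n d x. x \<in> carr ?B n d \<Longrightarrow> h n d (coprod_inl ?B ?K n d x) = x"
    and h_inr: "\<And>n d y. y \<in> carr ?K n d \<Longrightarrow> h n d (coprod_inr ?B ?K n d y) = k n d y"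
    by (rule coprod_universal[OF graded_operad_free operad_hom_restrict[OF operad_hom_id suboperad_mu_base] k])
      (rule that)
  let ?\<gamma> = "\<lambda>n d (g :: unit). if n = 0 then coprod_inr ?B ?K 0 (-1) kappa_gen
      else coprod_inl ?B ?K n (-1) (mu n)"
  have \<gamma>: "?\<gamma> n d g \<in> carr ?C n d" if "g \<in> mu_gens n d" for n d g
    using that operad_homD(3)[OF inl, of "mu n" n "-1"] operad_homD(3)[OF inr kgen] mu_in_base[of n]
    by (auto dest: mu_gens_cases)
  obtain g where g: "operad_hom free_mu ?C g"
    and g_gen: "\<And>n d x. x \<in> mu_gens n d \<Longrightarrow> g n d (free_gen mu_gens n d x) = ?\<gamma> n d x"
  proof (rule free_universal[of ?C mu_gens ?\<gamma>, OF graded_operad_coprod])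
    show "?\<gamma> n d u \<in> carr ?C n d" if "u \<in> mu_gens n d" for n d u using \<gamma>[OF that] .
  qed (rule that)
  have g_mu: "g n (-1) (mu n) = ?\<gamma> n (-1) ()" for n
    using g_gen[of "()" n "-1"] by (simp add: mu_gens_def mu_def)

  have g_base: "g n d x = coprod_inl ?B ?K n d x" if x: "x \<in> mu_base n d" for n d x
  proof -
    have "suboperad (\<lambda>n d. {x \<in> carr ?B n d. g n d x = coprod_inl ?B ?K n d x}) ?B"
      by (rule equalizer_suboperad[OF operad_hom_restrict[OF g suboperad_mu_base] inl B graded_operad_coprod])
    from mu_base_least[OF suboperad_restrict_trans[OF graded_operad_free suboperad_mu_base this] _ x]
    show ?thesis using g_mu mu_in_base by simp
  qed
  have g_kappa: "g n d (k n d y) = coprod_inr ?B ?K n d y" if y: "y \<in> carr ?K n d" for n d y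
  proof (rule free_hom_unique[where f = "\<lambda>n d y. g n d (k n d y)" and g = "coprod_inr ?B ?K"
        and R = ?C and G = kappa_gens, OF _ _ graded_operad_coprod])
    show "operad_hom (free_operad kappa_gens) ?C (\<lambda>n d y. g n d (k n d y))"
      using operad_hom_comp[OF k g] by (simp add: kappa_operad_def)
    show "operad_hom (free_operad kappa_gens) ?C (coprod_inr ?B ?K)"
      using inr by (simp add: kappa_operad_def)
    show "y \<in> carr (free_operad kappa_gens) n d" using y by (simp add: kappa_operad_def)
    fix n d u assume "u \<in> kappa_gens n d"
    then have "n = 0" "d = -1" "free_gen kappa_gens n d u = kappa_gen"
      by (auto simp: kappa_gens_def kappa_gen_def split: if_splits)
    then show "g n d (k n d (free_gen kappa_gens n d u)) = coprod_inr ?B ?K n d (free_gen kappa_gens n d u)"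
      using k_gen g_mu[of 0] by simp
  qed

  have gh: "g n d (h n d X) = X" if "X \<in> carr ?C n d" for n d X
    by (rule coprod_hom_unique[OF operad_hom_comp[OF h g] operad_hom_id graded_operad_coprod _ _ that])
      (simp_all add: h_inl h_inr g_base g_kappa)
  have hg: "h n d (g n d X) = X" if "X \<in> carr free_mu n d" for n d X
  proof (rule free_hom_unique[OF operad_hom_comp[OF g h] operad_hom_id graded_operad_free _ that])
    fix n d u assume "u \<in> mu_gens n d"
    then have u: "d = -1" "free_gen mu_gens n d u = mu n" using mu_gens_cases by auto
    show "h n d (g n d (free_gen mu_gens n d u)) = free_gen mu_gens n d u"
      unfolding u(2) unfolding u(1) g_mu using h_inr[OF kgen] k_gen h_inl[of "mu n" n "-1"] mu_in_base[of n] by auto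
  qed
  have "bij_betw (h n d) (carr ?C n d) (carr free_mu n d)" for n d
    by (rule bij_betw_byWitness[where f' = "g n d"])
      (auto simp: gh hg operad_homD(3)[OF g] operad_homD(3)[OF h])
  then have "operad_iso ?C cA_inf h"
    using h by (simp add: operad_iso_def operad_hom_def)
  then show ?thesis
    unfolding natural_iso_def restrict
    using h_inl h_inr[OF kgen] k_gen by auto
qed

subsection \<open>Weights of the differential\<close>

text \<open>
  A summand of \<open>d \<mu>\<^sub>n\<close> with \<open>q = 0\<close> contains one more \<open>\<mu>\<^sub>0\<close> than \<open>\<mu>\<^sub>n\<close> does, with one
  exception: the only summand \<open>\<mu>\<^sub>1 \<circ>\<^sub>1 \<mu>\<^sub>0\<close> of \<open>d \<mu>\<^sub>0\<close> has the same weight as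
  \<open>\<mu>\<^sub>0\<close>.\<close>

definition weight_zero_term :: "nat \<times> nat \<times> nat \<Rightarrow> bool" where
  "weight_zero_term = (\<lambda>(p, q, r). q > 0 \<or> p + q + r = 0)"

abbreviation mu_deriv0 where "mu_deriv0 \<equiv> mu_deriv weight_zero_term"
abbreviation mu_deriv1 where "mu_deriv1 \<equiv> mu_deriv (\<lambda>t. \<not> weight_zero_term t)"

lemma mu_deriv_sum:
  assumes "X \<in> carr free_mu n d"
  shows "mu_deriv (\<lambda>_. True) n d X = mu_deriv0 n d X \<otimes>\<^bsub>cpt free_mu n (d - 1)\<^esub> mu_deriv1 n d X"
proof -
  let ?D = "\<lambda>n d x. mu_deriv0 n d x \<otimes>\<^bsub>cpt free_mu n (d - 1)\<^esub> mu_deriv1 n d x"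
  have D: "derivation free_mu ?D"
    by (rule free_mu.derivation_sum[OF derivation_mu_deriv derivation_mu_deriv])
  have eq: "mu_deriv (\<lambda>_. True) n (-1) (mu n) = ?D n (-1) (mu n)" for n
  proof -
    let ?H = "cpt free_mu n (-2)"
    let ?I = "{t \<in> triples n. weight_zero_term t}" and ?J = "{t \<in> triples n. \<not> weight_zero_term t}"
    interpret H: comm_group ?H by simp
    have IJ: "triples n = ?I \<union> ?J" by auto
    have "finprod ?H mu_term (?I \<union> ?J) = finprod ?H mu_term ?I \<otimes>\<^bsub>?H\<^esub> finprod ?H mu_term ?J"
      using mu_term_closed by (intro H.finprod_Un_disjoint) auto
    then have "finprod ?H mu_term {t \<in> triples n. True} = finprod ?H mu_term ?I \<otimes>\<^bsub>?H\<^esub> finprod ?H mu_term ?J"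
      using IJ by simp
    moreover have "finprod ?H mu_term ?I \<in> carrier ?H" "finprod ?H mu_term ?J \<in> carrier ?H"
      using mu_term_closed by (auto intro!: H.finprod_in_carrier)
    ultimately show ?thesis unfolding mu_deriv_mu by (simp add: H.inv_mult mu_deriv_mu)
  qed
  have "X \<in> {x \<in> carr free_mu n d. mu_deriv (\<lambda>_. True) n d x = ?D n d x}"
    using derivation_intertwined_suboperad[OF graded_operad_free graded_operad_free operad_hom_id
        derivation_mu_deriv[of "\<lambda>_. True"] D] _ assms
    by (rule free_generated) (auto dest!: mu_gens_cases simp: mu_closed eq)
  then show ?thesis by simp
qed

abbreviation mu_weight where "mu_weight \<equiv> weight_part free_mu mu_base (mu 0)"

lemma subgroup_mu_weight: "subgroup {x. mu_weight w n d x} (cpt free_mu n d)"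
  by (rule free_mu.subgroup_weight_part[OF suboperad_mu_base mu_closed])

lemma mu_deriv_mu_weight:
  assumes "\<And>t. t \<in> triples n \<Longrightarrow> C t \<Longrightarrow> mu_weight w n (-2) (mu_term t)"
  shows "mu_weight w n (-2) (mu_deriv C n (-1) (mu n))"
proof -
  have "finprod (cpt free_mu n (-2)) mu_term {t \<in> triples n. C t} \<in> {x. mu_weight w n (-2) x}"
    using assms by (intro subgroup_finprod[OF _ subgroup_mu_weight]) auto
  then show ?thesis unfolding mu_deriv_mu by (auto intro: wp_neg)
qed

lemma mu_term_weight:
  assumes "p + q + r = n"
  shows "mu_weight (if q = 0 then 1 else 0) n (-2) (mu_term (p, q, r))"
proof -
  have base: "mu_weight 0 n (-1) (mu n)" if "n > 0" for n
    by (rule wp_base) (rule mu_in_base[OF that])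
  have 0: "mu_weight 0 (p + 1 + r) (-1) (mu (p + 1 + r))"
    by (rule base) simp
  have 1: "mu_weight (if q = 0 then 1 else 0) q (-1) (mu q)"
    using wp_kappa base by auto
  show ?thesis
    unfolding mu_term_def prod.case
    using assms by (intro free_mu.weight_part_comp[OF suboperad_mu_base mu_closed 0 1]) auto
qed

lemma mu_deriv0_weight:
  "mu_weight w n d x \<Longrightarrow> mu_weight w n (d - 1) (mu_deriv0 n d x)"
proof -
  assume x: "mu_weight w n d x"
  have "mu_weight (w + 0) n (d - 1) (mu_deriv0 n d x)"
  proof (rule free_mu.derivation_raises_weight[OF suboperad_mu_base mu_closed derivation_mu_deriv _ _ x])
    show "mu_weight (1 + 0) 0 (-2) (mu_deriv0 0 (-1) (mu 0))"
      using mu_term_weight[of 0 0 0 0] by (intro mu_deriv_mu_weight) (simp add: triples_def)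
    have "mu_weight 0 n (-2) (mu_deriv0 n (-1) (mu n))" if n: "n > 0" for n
    proof (rule mu_deriv_mu_weight)
      fix t assume "t \<in> triples n" "weight_zero_term t"
      then obtain p q r where "t = (p, q, r)" "p + q + r = n" "q > 0"
        using n by (cases t) (auto simp: triples_def weight_zero_term_def)
      then show "mu_weight 0 n (-2) (mu_term t)" using mu_term_weight[of p q r n] by simp
    qed
    then show "mu_weight 0 n (d - 1) (mu_deriv0 n d x)" if "x \<in> mu_base n d" for n d x
      using mu_base_least[OF free_mu.derivation_weight_suboperad[OF suboperad_mu_base mu_closed
            derivation_mu_deriv[of weight_zero_term], of 0] _ that]
      by (simp add: mu_in_base)
  qed
  then show ?thesis by simp
qed

lemma mu_deriv1_kappa: "mu_deriv1 0 (-1) (mu 0) = \<one>\<^bsub>cpt free_mu 0 (-2)\<^esub>"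
proof -
  have "{t \<in> triples 0. \<not> weight_zero_term t} = {}"
    by (auto simp: triples_def weight_zero_term_def)
  then show ?thesis unfolding mu_deriv_mu
    by (simp only: comm_monoid.finprod_empty[OF free_mu.cpt_group(3)] monoid.inv_one[OF free_mu.cpt_group(4)])
qed

lemma mu_deriv1_weight:
  "mu_weight w n d x \<Longrightarrow> mu_weight (w + 1) n (d - 1) (mu_deriv1 n d x)"
proof (rule free_mu.derivation_raises_weight[OF suboperad_mu_base mu_closed derivation_mu_deriv])
  show "mu_weight (1 + 1) 0 (-2) (mu_deriv1 0 (-1) (mu 0))"
    unfolding mu_deriv1_kappa by (rule wp_zero)
  have "mu_weight 1 n (-2) (mu_deriv1 n (-1) (mu n))" for n
  proof (rule mu_deriv_mu_weight)
    fix t assume "t \<in> triples n" "\<not> weight_zero_term t"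
    then obtain p q r where "t = (p, q, r)" "p + q + r = n" "q = 0"
      by (cases t) (auto simp: triples_def weight_zero_term_def)
    then show "mu_weight 1 n (-2) (mu_term t)" using mu_term_weight[of p q r n] by simp
  qed
  then show "mu_weight 1 n (d - 1) (mu_deriv1 n d x)" if "x \<in> mu_base n d" for n d x
    using mu_base_least[OF free_mu.derivation_weight_suboperad[OF suboperad_mu_base mu_closed
          derivation_mu_deriv[of "\<lambda>t. \<not> weight_zero_term t"], of 1] _ that]
    by (simp add: mu_in_base)
qed

lemma weight_part_cA_inf: "mu_weight w n d x \<Longrightarrow> weight_part cA_inf mu_base (mu 0) w n d x"
proof (induction rule: weight_part.induct)
  case (wp_comp v m a x w n b y i)
  then show ?case using weight_part.wp_comp[of cA_inf mu_base "mu 0" v m a x w n b y i] by simp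
next
  case (wp_zero w n d)
  then show ?case using weight_part.wp_zero[of cA_inf mu_base "mu 0" w n d] by simp
next
  case (wp_add w n d x y)
  then show ?case using weight_part.wp_add[of cA_inf mu_base "mu 0" w n d x y] by simp
next
  case (wp_neg w n d x)
  then show ?case using weight_part.wp_neg[of cA_inf mu_base "mu 0" w n d x] by simp
qed (auto intro: weight_part.intros)

lemma weight_part_cA_inf_D: "weight_part cA_inf mu_base (mu 0) w n d x \<Longrightarrow> mu_weight w n d x"
proof (induction rule: weight_part.induct)
  case (wp_comp v m a x w n b y i)
  then show ?case using weight_part.wp_comp[of free_mu mu_base "mu 0" v m a x w n b y i] by simp
next
  case (wp_zero w n d)
  then show ?case using weight_part.wp_zero[of free_mu mu_base "mu 0" w n d] by simp
next
  case (wp_add w n d x y)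
  then show ?case using weight_part.wp_add[of free_mu mu_base "mu 0" w n d x y] by simp
next
  case (wp_neg w n d x)
  then show ?case using weight_part.wp_neg[of free_mu mu_base "mu 0" w n d x] by simp
qed (auto intro: weight_part.intros)

lemma diff_decomp_cA_inf:
  "diff_decomp cA_inf (\<lambda>w. if w = 0 then mu_deriv0 else if w = 1 then mu_deriv1
      else (\<lambda>n d x. \<one>\<^bsub>cpt free_mu n (d - 1)\<^esub>))" (is "diff_decomp cA_inf ?D")
  unfolding diff_decomp_def cA_inf_simps base_cA_inf
proof (intro conjI allI impI ballI)
  fix w n d
  interpret H: comm_group "cpt free_mu n (d - 1)" by simp
  show "?D w n d \<in> hom (cpt free_mu n d) (cpt free_mu n (d - 1))"
    using derivationD(1)[OF derivation_mu_deriv] by (auto simp: hom_def)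
  fix v x
  assume "weight_part cA_inf mu_base (mu 0) v n d x"
  then have "mu_weight v n d x" by (rule weight_part_cA_inf_D)
  then show "weight_part cA_inf mu_base (mu 0) (v + w) n (d - 1) (?D w n d x)"
    using mu_deriv0_weight mu_deriv1_weight wp_zero[of free_mu mu_base "mu 0" "v + w" n "d - 1"]
    by (auto intro!: weight_part_cA_inf)
next
  fix n d x assume x: "x \<in> carr free_mu n d"
  let ?H = "cpt free_mu n (d - 1)" and ?I = "{w. ?D w n d x \<noteq> \<one>\<^bsub>cpt free_mu n (d - 1)\<^esub>}"
  interpret H: comm_group ?H by simp
  have sub: "?I \<subseteq> {0, 1}" by (auto split: if_splits)
  then show "finite ?I" by (rule finite_subset) simp
  have c: "mu_deriv0 n d x \<in> carrier ?H" "mu_deriv1 n d x \<in> carrier ?H"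
    using derivationD(3)[OF derivation_mu_deriv x] by auto
  have "finprod ?H (\<lambda>w. ?D w n d x) ?I = finprod ?H (\<lambda>w. ?D w n d x) {0, 1}"
    using sub c by (intro H.finprod_mono_neutral_cong_left) auto
  also have "\<dots> = mu_deriv0 n d x \<otimes>\<^bsub>?H\<^esub> mu_deriv1 n d x"
    using c by (simp add: H.finprod_insert)
  finally show "mu_deriv (\<lambda>_. True) n d x = finprod ?H (\<lambda>w. ?D w n d x) ?I"
    using mu_deriv_sum[OF x] by simp
qed

theorem curv_object_cA_inf: "curv_object cA_inf"
proof (intro curv_object.intro curv_object_axioms.intro)
  show "dg_operad cA_inf" by (rule dg_operad_cA_inf)
  show "suboperad (base cA_inf) cA_inf"
    using suboperad_mu_base by (simp add: suboperad_def)
  show "kappa cA_inf \<in> carr cA_inf 0 (-1)" by (simp add: mu_closed)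
  show "kappa cA_inf \<notin> base cA_inf 0 (-1)" by (simp add: mu_0_notin_base)
  show "natural_iso cA_inf (base cA_inf) (kappa cA_inf)" using natural_iso_cA_inf by simp
  show "\<exists>D. diff_decomp cA_inf D \<and>
      (\<forall>w n d. \<forall>x\<in>carr cA_inf n d. w \<notin> {0, 1} \<longrightarrow> D w n d x = \<one>\<^bsub>cpt cA_inf n (d - 1)\<^esub>) \<and>
      D 1 0 (-1) (kappa cA_inf) = \<one>\<^bsub>cpt cA_inf 0 (-2)\<^esub>"
    by (rule exI, rule conjI, rule diff_decomp_cA_inf) (simp add: mu_deriv1_kappa)
qed


section \<open>Normal forms for an adjoined operation of arity zero\<close>

subsection \<open>Adjoining a unit\<close>

text \<open>
  \<open>None\<close> plays the role of an identity operation of arity one. It serves as a formal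
  symbol: the operation \<open>\<kappa>\<close> itself becomes the identity with its input filled by \<open>\<kappa>\<close>, so that the
  normal forms treat \<open>\<kappa>\<close> and its insertions into other operations uniformly.\<close>

definition unital_carr :: "('a, 'm) goperad_scheme \<Rightarrow> nat \<Rightarrow> int \<Rightarrow> 'a option set" where
  "unital_carr P n d = Some ` carr P n d \<union> (if n = 1 \<and> d = 0 then {None} else {})"

fun unital_pcomp ::
  "('a, 'm) goperad_scheme \<Rightarrow> nat \<Rightarrow> int \<Rightarrow> nat \<Rightarrow> int \<Rightarrow> nat \<Rightarrow> 'a option \<Rightarrow> 'a option \<Rightarrow> 'a option"
where
  "unital_pcomp P m a n b i None y = y"
| "unital_pcomp P m a n b i (Some u) None = Some u"
| "unital_pcomp P m a n b i (Some u) (Some v) = Some (pcomp P m a n b i u v)"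

lemma Some_unital_carr [simp]: "Some x \<in> unital_carr P n d \<longleftrightarrow> x \<in> carr P n d"
  by (auto simp: unital_carr_def)

lemma None_unital_carr [simp]: "None \<in> unital_carr P n d \<longleftrightarrow> n = 1 \<and> d = 0"
  by (auto simp: unital_carr_def)

context graded_operad
begin

lemma unital_pcomp_closed:
  assumes "1 \<le> i" "i \<le> m" "x \<in> unital_carr P m a" "y \<in> unital_carr P n b"
    "N = m + n - 1" "d = a + b"
  shows "unital_pcomp P m a n b i x y \<in> unital_carr P N d"
  using assms pcomp_closed[OF assms(1,2) _ _ assms(5,6)]
  by (cases x; cases y) (auto simp del: One_nat_def)

lemma unital_pcomp_seq:
  assumes "1 \<le> i" "i \<le> m" "1 \<le> j" "j \<le> n"
    and x: "x \<in> unital_carr P m a" and y: "y \<in> unital_carr P n b" and z: "z \<in> unital_carr P l c"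
    and "M = m + n - 1" "e = a + b" "k = i - 1 + j" "N = n + l - 1" "f = b + c"
  shows "unital_pcomp P M e l c k (unital_pcomp P m a n b i x y) z =
    unital_pcomp P m a N f i x (unital_pcomp P n b l c j y z)"
proof (cases x)
  case None
  then have "m = 1" "a = 0" "i = 1" using x assms(1,2) by auto
  then show ?thesis using None assms(8-10) by simp
next
  case x': (Some u)
  show ?thesis
  proof (cases y)
    case None
    then have "n = 1" "b = 0" "j = 1" using y assms(3,4) by auto
    then show ?thesis using None x' assms(1) assms(8-12) by (cases z) auto
  next
    case y': (Some v)
    show ?thesis
    proof (cases z)
      case None
      then show ?thesis using x' y' z assms(3,4,11,12) by simp
    next
      case (Some w)
      then show ?thesis using x' y' x y z assms(1-4,8-) by (auto intro!: pcomp_seq' simp del: One_nat_def)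
    qed
  qed
qed

lemma unital_pcomp_par:
  assumes "1 \<le> i" "i < k" "k \<le> m"
    and x: "x \<in> unital_carr P m a" and y: "y \<in> unital_carr P n b" and z: "z \<in> unital_carr P l c"
    and "M = m + n - 1" "e = a + b" "k' = k - 1 + n" "N = m + l - 1" "f = a + c"
    "L = m + n + l - 2" "g = a + b + c"
  obtains w where "w \<in> carr P L g"
    "unital_pcomp P N f n b i (unital_pcomp P m a l c k x z) y = Some w"
    "unital_pcomp P M e l c k' (unital_pcomp P m a n b i x y) z = Some (signed (cpt P L g) (b * c) w)"
proof -
  have ik: "i \<le> m" "1 \<le> k" using assms(1-3) by auto
  obtain u where x': "x = Some u" "u \<in> carr P m a" using x assms(1-3) by (cases x) auto
  show thesis
  proof (cases y)
    case y': None
    then have n: "n = 1" "b = 0" using y by auto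
    show thesis
    proof (cases z)
      case None
      then have "l = 1" "c = 0" using z by auto
      then show thesis using that[of u] None y' x' n assms(7-) by (simp add: signed_def)
    next
      case (Some w)
      then have "pcomp P m a l c k u w \<in> carr P L g"
        using x' z n assms(3,12,13) ik by (intro pcomp_closed) auto
      then show thesis using that[of "pcomp P m a l c k u w"] Some y' x' n assms(7-9) assms(1-3)
        by (simp add: signed_def)
    qed
  next
    case y': (Some v)
    show thesis
    proof (cases z)
      case None
      then have l: "l = 1" "c = 0" using z by auto
      have "pcomp P m a n b i u v \<in> carr P L g"
        using x' y y' l assms(1,12,13) ik by (intro pcomp_closed) auto
      then show thesis using that[of "pcomp P m a n b i u v"] None y' x' l assms(10,11)
        by (simp add: signed_def)
    next
      case (Some w)
      have c: "v \<in> carr P n b" "w \<in> carr P l c" using y y' z Some by auto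
      have "pcomp P N f n b i (pcomp P m a l c k u w) v \<in> carr P L g"
        using x' c assms(1-3,10-13) ik by (intro pcomp_closed) auto
      moreover have "pcomp P M e l c k' (pcomp P m a n b i u v) w =
          signed (cpt P L g) (b * c) (pcomp P N f n b i (pcomp P m a l c k u w) v)"
        using assms(1-3,7-13) x' c by (intro pcomp_par') auto
      ultimately show thesis using that[of "pcomp P N f n b i (pcomp P m a l c k u w) v"] x' y' Some
        by simp
    qed
  qed
qed

end

subsection \<open>Masks\<close>

text \<open>
  A mask lists the inputs of an operation and marks with \<open>True\<close> those that are filled by \<open>\<kappa>\<close>. The free
  inputs are the entries \<open>False\<close>, and \<open>mask_pre m i\<close> and \<open>mask_post m i\<close> are the parts of the mask
  before and after the \<open>i\<close>-th free input.\<close>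

fun mask_pre :: "bool list \<Rightarrow> nat \<Rightarrow> bool list" where
  "mask_pre [] i = []"
| "mask_pre (True # m) i = True # mask_pre m i"
| "mask_pre (False # m) i = (if i \<le> 1 then [] else False # mask_pre m (i - 1))"

fun mask_post :: "bool list \<Rightarrow> nat \<Rightarrow> bool list" where
  "mask_post [] i = []"
| "mask_post (True # m) i = mask_post m i"
| "mask_post (False # m) i = (if i \<le> 1 then m else mask_post m (i - 1))"

abbreviation falses :: "bool list \<Rightarrow> nat" where "falses m \<equiv> count_list m False"
abbreviation trues :: "bool list \<Rightarrow> int" where "trues m \<equiv> int (count_list m True)"

lemma mask_split:
  "1 \<le> i \<Longrightarrow> i \<le> falses m \<Longrightarrow>
    m = mask_pre m i @ False # mask_post m i \<and> falses (mask_pre m i) = i - 1"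
proof (induction m i rule: mask_pre.induct)
  case (3 m i)
  then show ?case by (cases "i \<le> 1") auto
qed auto

lemma mask_splitE:
  assumes "1 \<le> i" "i \<le> falses m"
  obtains u w where "m = u @ False # w" "i = falses u + 1"
  using mask_split[OF assms] assms(1) that[of "mask_pre m i" "mask_post m i"] by auto

lemma mask_pre_append [simp]: "mask_pre (u @ False # w) (Suc (falses u)) = u"
proof (induction u)
  case (Cons c u) then show ?case by (cases c) auto
qed simp

lemma mask_post_append [simp]: "mask_post (u @ False # w) (Suc (falses u)) = w"
proof (induction u)
  case (Cons c u) then show ?case by (cases c) auto
qed simp

subsection \<open>Monomials\<close>

text \<open>
  The monomial \<open>(m, a, x)\<close> stands for the operation \<open>x\<close> of degree \<open>a\<close> with \<open>\<kappa>\<close> inserted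
  into the inputs marked by \<open>m\<close>, starting from the rightmost one. Its arity is the number of free inputs
  and its degree is \<open>a\<close> minus the number of insertions.\<close>

type_synonym 'a monomial = "bool list \<times> int \<times> 'a option"

fun monom_comp :: "('a, 'm) goperad_scheme \<Rightarrow> 'a monomial \<Rightarrow> nat \<Rightarrow> 'a monomial \<Rightarrow> 'a monomial" where
  "monom_comp P (m, a, x) i (m', b, y) =
     (mask_pre m i @ m' @ mask_post m i, a + b,
      unital_pcomp P (length m) a (length m') b (length (mask_pre m i) + 1) x y)"

text \<open>
  The sign relating a composite of monomials to its normal form: \<open>y\<close>, of degree \<open>b\<close>, is moved past
  the insertions of \<open>\<kappa>\<close> into \<open>x\<close>, and then the insertions into \<open>y\<close> are moved past those
  insertions into \<open>x\<close> that are further to the left.\<close>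

fun monom_sign :: "'a monomial \<Rightarrow> nat \<Rightarrow> 'a monomial \<Rightarrow> int" where
  "monom_sign (m, a, x) i (m', b, y) = b * trues m + trues m' * trues (mask_pre m i)"

fun is_monom :: "('a, 'm) goperad_scheme \<Rightarrow> nat \<Rightarrow> int \<Rightarrow> 'a monomial \<Rightarrow> bool" where
  "is_monom P n d (m, a, x) \<longleftrightarrow> falses m = n \<and> a - trues m = d \<and> x \<in> unital_carr P (length m) a"

context graded_operad
begin

lemma is_monom_comp:
  assumes "1 \<le> i" "i \<le> m" "is_monom P m a s" "is_monom P n b t" "N = m + n - 1" "d = a + b"
  shows "is_monom P N d (monom_comp P s i t)"
proof -
  obtain m1 a1 x m2 b1 y where st: "s = (m1, a1, x)" "t = (m2, b1, y)" by (cases s, cases t) auto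
  obtain u w where u: "m1 = u @ False # w" "i = falses u + 1"
    using mask_splitE[of i m1] assms(1-3) by (auto simp: st)
  show ?thesis using assms(3-) by (auto simp: st u intro!: unital_pcomp_closed)
qed

lemma monom_comp_seq:
  assumes "1 \<le> i" "i \<le> m" "1 \<le> j" "j \<le> n"
    and "is_monom P m a s" "is_monom P n b t" "is_monom P l c r"
  shows "monom_comp P (monom_comp P s i t) (i - 1 + j) r = monom_comp P s i (monom_comp P t j r)"
    and "monom_sign s i t + monom_sign (monom_comp P s i t) (i - 1 + j) r =
      monom_sign t j r + monom_sign s i (monom_comp P t j r)"
proof -
  obtain m1 a1 x m2 b1 y m3 c1 z
    where st: "s = (m1, a1, x)" "t = (m2, b1, y)" "r = (m3, c1, z)" by (cases s, cases t, cases r) auto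
  obtain u w where u: "m1 = u @ False # w" "i = falses u + 1"
    using mask_splitE[of i m1] assms(1,2,5) by (auto simp: st)
  obtain u' w' where u': "m2 = u' @ False # w'" "j = falses u' + 1"
    using mask_splitE[of j m2] assms(3,4,6) by (auto simp: st)
  have k: "i - 1 + j = Suc (falses (u @ u'))" using u u' by simp
  have "unital_pcomp P (length (u @ m2 @ w)) (a1 + b1) (length m3) c1 (length (u @ u') + 1)
      (unital_pcomp P (length m1) a1 (length m2) b1 (length u + 1) x y) z =
    unital_pcomp P (length m1) a1 (length (u' @ m3 @ w')) (b1 + c1) (length u + 1) x
      (unital_pcomp P (length m2) b1 (length m3) c1 (length u' + 1) y z)"
    using assms(5-) by (intro unital_pcomp_seq) (auto simp: st u u')
  moreover have mk: "u @ m2 @ w = (u @ u') @ False # w' @ w" by (simp add: u')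
  ultimately show "monom_comp P (monom_comp P s i t) (i - 1 + j) r =
      monom_comp P s i (monom_comp P t j r)"
    unfolding st k monom_comp.simps u(2) u'(2)
    using mask_pre_append[of u w] mask_post_append[of u w]
      mask_pre_append[of u' w'] mask_post_append[of u' w']
      mask_pre_append[of "u @ u'" "w' @ w"] mask_post_append[of "u @ u'" "w' @ w"]
    by (simp add: u(1) u'(1))
  show "monom_sign s i t + monom_sign (monom_comp P s i t) (i - 1 + j) r =
      monom_sign t j r + monom_sign s i (monom_comp P t j r)"
    unfolding st k monom_comp.simps monom_sign.simps u(2) u'(2)
    using mask_pre_append[of u w] mask_post_append[of u w]
      mask_pre_append[of u' w'] mask_post_append[of u' w']
      mask_pre_append[of "u @ u'" "w' @ w"] mask_post_append[of "u @ u'" "w' @ w"]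
    by (simp add: u(1) u'(1) algebra_simps)
qed

text \<open>
  In the parallel axiom the two composites agree up to the sign \<open>\<sigma>\<close> produced by the same axiom for the
  underlying operations. The congruence of signs says that \<open>\<sigma>\<close> and the signs of the normal
  forms add up to the sign \<open>b * c\<close> that the axiom requires for the monomials, whose degrees include
  their insertions.\<close>

lemma monom_comp_par:
  assumes ik: "1 \<le> i" "i < k" "k \<le> m"
    and "is_monom P m a s" "is_monom P n b t" "is_monom P l c r"
  obtains M g w \<sigma> where
    "w \<in> carr P (length M) g"
    "monom_comp P (monom_comp P s k r) i t = (M, g, Some w)"
    "monom_comp P (monom_comp P s i t) (k - 1 + n) r = (M, g, Some (signed (cpt P (length M) g) \<sigma> w))"
    "even (monom_sign s i t + monom_sign (monom_comp P s i t) (k - 1 + n) r + \<sigma>) =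
     even (b * c + monom_sign s k r + monom_sign (monom_comp P s k r) i t)"
proof -
  obtain m1 a1 x m2 b1 y m3 c1 z
    where st: "s = (m1, a1, x)" "t = (m2, b1, y)" "r = (m3, c1, z)" by (cases s, cases t, cases r) auto
  obtain u w0 where u: "m1 = u @ False # w0" "i = falses u + 1"
    using mask_splitE[of i m1] ik assms(4) by (auto simp: st)
  have "1 \<le> k - i" "k - i \<le> falses w0" using ik assms(4) by (auto simp: st u)
  then obtain v w where v: "w0 = v @ False # w" "k - i = falses v + 1"
    by (rule mask_splitE)
  have k: "k = Suc (falses (u @ False # v))" using v u ik by simp
  have k': "k - 1 + n = Suc (falses (u @ m2 @ v))" using k assms(5) by (simp add: st)
  have m1: "m1 = (u @ False # v) @ False # w" by (simp add: u v)
  note pre = mask_pre_append[of u "v @ False # w"] mask_post_append[of u "v @ False # w"]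
    mask_pre_append[of "u @ False # v" w] mask_post_append[of "u @ False # v" w]
    mask_pre_append[of "u @ m2 @ v" w] mask_post_append[of "u @ m2 @ v" w]
    mask_pre_append[of u "v @ m3 @ w"] mask_post_append[of u "v @ m3 @ w"]
  have deg: "b = b1 - trues m2" "c = c1 - trues m3" using assms(5,6) by (auto simp: st)
  have len: "length (u @ m2 @ v @ m3 @ w) = length m1 + length m2 + length m3 - 2" by (simp add: m1)
  obtain q where q: "q \<in> carr P (length (u @ m2 @ v @ m3 @ w)) (a1 + b1 + c1)"
    "unital_pcomp P (length (u @ False # v @ m3 @ w)) (a1 + c1) (length m2) b1 (length u + 1)
      (unital_pcomp P (length m1) a1 (length m3) c1 (length (u @ False # v) + 1) x z) y = Some q"
    "unital_pcomp P (length (u @ m2 @ v @ False # w)) (a1 + b1) (length m3) c1 (length (u @ m2 @ v) + 1)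
      (unital_pcomp P (length m1) a1 (length m2) b1 (length u + 1) x y) z =
      Some (signed (cpt P (length (u @ m2 @ v @ m3 @ w)) (a1 + b1 + c1)) (b1 * c1) q)"
    using assms(4-)
    by (rule_tac unital_pcomp_par[of "length u + 1" "length (u @ False # v) + 1" "length m1" x a1 y
          "length m2" b1 z "length m3" c1 "length (u @ m2 @ v @ False # w)" "a1 + b1"
          "length (u @ m2 @ v) + 1" "length (u @ False # v @ m3 @ w)" "a1 + c1"
          "length (u @ m2 @ v @ m3 @ w)" "a1 + b1 + c1"]) (auto simp: st m1)
  show thesis
  proof (rule that[of q "u @ m2 @ v @ m3 @ w" "a1 + b1 + c1" "b1 * c1"])
    show "q \<in> carr P (length (u @ m2 @ v @ m3 @ w)) (a1 + b1 + c1)" by (rule q)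
    show "monom_comp P (monom_comp P s k r) i t = (u @ m2 @ v @ m3 @ w, a1 + b1 + c1, Some q)"
      unfolding st k u(2) monom_comp.simps using pre q(2) by (simp add: m1 algebra_simps)
    show "monom_comp P (monom_comp P s i t) (k - 1 + n) r = (u @ m2 @ v @ m3 @ w, a1 + b1 + c1,
        Some (signed (cpt P (length (u @ m2 @ v @ m3 @ w)) (a1 + b1 + c1)) (b1 * c1) q))"
      unfolding k' unfolding st u(2) monom_comp.simps using pre q(3) by (simp add: m1 algebra_simps)
    have "even ((b1 * trues m1 + trues m2 * trues u) +
        (c1 * (trues u + trues m2 + (trues v + trues w)) + trues m3 * (trues u + trues m2 + trues v)) + b1 * c1) =
      even (b * c + (c1 * trues m1 + trues m3 * (trues u + trues v)) +
        (b1 * (trues u + trues v + trues m3 + trues w) + trues m2 * trues u))"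
      unfolding deg by (auto simp: m1)
    then show "even (monom_sign s i t + monom_sign (monom_comp P s i t) (k - 1 + n) r + b1 * c1) =
      even (b * c + monom_sign s k r + monom_sign (monom_comp P s k r) i t)"
      unfolding k' unfolding st k u(2) monom_comp.simps monom_sign.simps
      using pre by (simp add: m1 algebra_simps)
  qed
qed

end


subsection \<open>Formal combinations of monomials\<close>

text \<open>
  An element of the operad of normal forms should be a sum of monomials, modulo additivity of
  \<open>(m, a, x)\<close> in \<open>x\<close>. To avoid quotients, such a sum is represented by the map that
  evaluates functionals on it; the functionals are additive and take values in a fixed abelian group
  \<open>A\<close>. This loses nothing that is needed here, as the coefficients of a sum are values of such
  functionals.\<close>

locale normal_forms = graded_operad P + A: comm_group A
  for P :: "('a, 'm) goperad_scheme" and A :: "'c monoid"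
begin

definition additive :: "('a monomial \<Rightarrow> 'c) \<Rightarrow> bool" where
  "additive \<phi> \<longleftrightarrow>
     (\<forall>m a x. x \<in> unital_carr P (length m) a \<longrightarrow> \<phi> (m, a, x) \<in> carrier A) \<and>
     (\<forall>m a. (\<lambda>x. \<phi> (m, a, Some x)) \<in> hom (cpt P (length m) a) A)"

lemma additive_closed: "additive \<phi> \<Longrightarrow> is_monom P n d s \<Longrightarrow> \<phi> s \<in> carrier A"
  by (cases s) (auto simp: additive_def)

lemma additive_mult_arg:
  "additive \<phi> \<Longrightarrow> x \<in> carr P (length m) a \<Longrightarrow> y \<in> carr P (length m) a \<Longrightarrow>
    \<phi> (m, a, Some (x \<otimes>\<^bsub>cpt P (length m) a\<^esub> y)) = \<phi> (m, a, Some x) \<otimes>\<^bsub>A\<^esub> \<phi> (m, a, Some y)"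
  using hom_mult[of "\<lambda>x. \<phi> (m, a, Some x)" "cpt P (length m) a" A x y]
  unfolding additive_def by blast

lemma additive_signed_arg:
  "additive \<phi> \<Longrightarrow> x \<in> carr P (length m) a \<Longrightarrow>
    \<phi> (m, a, Some (signed (cpt P (length m) a) k x)) = signed A k (\<phi> (m, a, Some x))"
  using hom_signed[of "\<lambda>x. \<phi> (m, a, Some x)" "cpt P (length m) a" A x k] A.comm_group_axioms
  unfolding additive_def by simp

lemma additiveI:
  assumes "\<And>m a x. x \<in> unital_carr P (length m) a \<Longrightarrow> \<phi> (m, a, x) \<in> carrier A"
    and "\<And>m a x y. x \<in> carr P (length m) a \<Longrightarrow> y \<in> carr P (length m) a \<Longrightarrow>
      \<phi> (m, a, Some (x \<otimes>\<^bsub>cpt P (length m) a\<^esub> y)) = \<phi> (m, a, Some x) \<otimes>\<^bsub>A\<^esub> \<phi> (m, a, Some y)"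
  shows "additive \<phi>"
  using assms unfolding additive_def by (auto intro!: homI)

lemma additive_one: "additive (\<lambda>s. \<one>\<^bsub>A\<^esub>)"
  by (rule additiveI) auto

lemma A_swap:
  "x \<in> carrier A \<Longrightarrow> y \<in> carrier A \<Longrightarrow> z \<in> carrier A \<Longrightarrow> w \<in> carrier A \<Longrightarrow>
    (x \<otimes>\<^bsub>A\<^esub> y) \<otimes>\<^bsub>A\<^esub> (z \<otimes>\<^bsub>A\<^esub> w) = (x \<otimes>\<^bsub>A\<^esub> z) \<otimes>\<^bsub>A\<^esub> (y \<otimes>\<^bsub>A\<^esub> w)"
  by (simp add: A.m_ac)

lemma additive_mult:
  assumes "additive \<phi>" "additive \<psi>"
  shows "additive (\<lambda>s. \<phi> s \<otimes>\<^bsub>A\<^esub> \<psi> s)"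
proof (rule additiveI)
  show "\<phi> (m, a, x) \<otimes>\<^bsub>A\<^esub> \<psi> (m, a, x) \<in> carrier A" if "x \<in> unital_carr P (length m) a" for m a x
    using assms that by (auto simp: additive_def)
  show "\<phi> (m, a, Some (x \<otimes>\<^bsub>cpt P (length m) a\<^esub> y)) \<otimes>\<^bsub>A\<^esub> \<psi> (m, a, Some (x \<otimes>\<^bsub>cpt P (length m) a\<^esub> y)) =
      (\<phi> (m, a, Some x) \<otimes>\<^bsub>A\<^esub> \<psi> (m, a, Some x)) \<otimes>\<^bsub>A\<^esub> (\<phi> (m, a, Some y) \<otimes>\<^bsub>A\<^esub> \<psi> (m, a, Some y))"
    if "x \<in> carr P (length m) a" "y \<in> carr P (length m) a" for m a x y
    unfolding additive_mult_arg[OF assms(1) that] additive_mult_arg[OF assms(2) that]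
    using assms that by (intro A_swap) (auto simp: additive_def)
qed

lemma additive_signed:
  assumes "additive \<phi>"
  shows "additive (\<lambda>s. signed A k (\<phi> s))"
proof (rule additiveI)
  show "signed A k (\<phi> (m, a, x)) \<in> carrier A" if "x \<in> unital_carr P (length m) a" for m a x
    using assms that by (auto simp: additive_def A.comm_group_axioms)
  show "signed A k (\<phi> (m, a, Some (x \<otimes>\<^bsub>cpt P (length m) a\<^esub> y))) =
      signed A k (\<phi> (m, a, Some x)) \<otimes>\<^bsub>A\<^esub> signed A k (\<phi> (m, a, Some y))"
    if "x \<in> carr P (length m) a" "y \<in> carr P (length m) a" for m a x y
    unfolding additive_mult_arg[OF assms(1) that]
    using assms that by (intro signed_mult A.comm_group_axioms) (auto simp: additive_def)
qed

text \<open>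
  Functionals that are not additive are sent to zero, so that the relation between \<open>x\<close>, \<open>y\<close> and their
  sum becomes an equality of functions.\<close>

definition eval_at :: "'a monomial \<Rightarrow> ('a monomial \<Rightarrow> 'c) \<Rightarrow> 'c" where
  "eval_at s = (\<lambda>\<phi>. if additive \<phi> then \<phi> s else \<one>\<^bsub>A\<^esub>)"

inductive combination :: "nat \<Rightarrow> int \<Rightarrow> (('a monomial \<Rightarrow> 'c) \<Rightarrow> 'c) \<Rightarrow> bool" where
  comb_eval: "is_monom P n d s \<Longrightarrow> combination n d (eval_at s)"
| comb_one: "combination n d (\<lambda>\<phi>. \<one>\<^bsub>A\<^esub>)"
| comb_mult: "combination n d f \<Longrightarrow> combination n d g \<Longrightarrow> combination n d (\<lambda>\<phi>. f \<phi> \<otimes>\<^bsub>A\<^esub> g \<phi>)"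
| comb_inv: "combination n d f \<Longrightarrow> combination n d (\<lambda>\<phi>. inv\<^bsub>A\<^esub> (f \<phi>))"

lemma combination_closed [simp]: "combination n d f \<Longrightarrow> f \<phi> \<in> carrier A"
  by (induction rule: combination.induct) (auto simp: eval_at_def intro: additive_closed)

lemma combination_mult:
  assumes "combination n d f" "additive \<phi>" "additive \<psi>"
  shows "f (\<lambda>s. \<phi> s \<otimes>\<^bsub>A\<^esub> \<psi> s) = f \<phi> \<otimes>\<^bsub>A\<^esub> f \<psi>"
  using assms(1)
proof (induction rule: combination.induct)
  case (comb_eval n d s)
  then show ?case using assms additive_mult[OF assms(2,3)] by (simp add: eval_at_def)
next
  case (comb_mult n d f g)
  then show ?case by (simp add: A_swap)
next
  case (comb_inv n d f)
  then show ?case by (simp add: A.inv_mult)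
qed simp

lemma combination_signed:
  assumes "combination n d f" "additive \<phi>"
  shows "f (\<lambda>s. signed A k (\<phi> s)) = signed A k (f \<phi>)"
  using assms(1)
proof (induction rule: combination.induct)
  case (comb_eval n d s)
  then show ?case using assms additive_signed[OF assms(2)] by (simp add: eval_at_def)
next
  case (comb_mult n d f g)
  then show ?case by (simp add: signed_mult A.comm_group_axioms)
next
  case (comb_inv n d f)
  then show ?case by (simp add: signed_def)
qed (simp add: A.comm_group_axioms)

lemma combination_at_one: "combination n d f \<Longrightarrow> f (\<lambda>s. \<one>\<^bsub>A\<^esub>) = \<one>\<^bsub>A\<^esub>"
  by (induction rule: combination.induct) (auto simp: eval_at_def)

lemma combination_signed_comb:
  "combination n d f \<Longrightarrow> combination n d (\<lambda>\<phi>. signed A k (f \<phi>))"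
  by (cases "even k") (auto simp: signed_def intro: comb_inv)

text \<open>
  The composition of two sums of monomials is a double evaluation of a function of two monomials;
  additivity in each argument is what allows evaluating one argument after the other.\<close>

definition biadditive :: "('a monomial \<Rightarrow> 'a monomial \<Rightarrow> 'c) \<Rightarrow> bool" where
  "biadditive K \<longleftrightarrow> (\<forall>s. additive (K s)) \<and> (\<forall>t. additive (\<lambda>s. K s t))"

lemma biadditiveD: "biadditive K \<Longrightarrow> additive (K s)" "biadditive K \<Longrightarrow> additive (\<lambda>s. K s t)"
  unfolding biadditive_def by blast+

lemma biadditiveI: "(\<And>s. additive (K s)) \<Longrightarrow> (\<And>t. additive (\<lambda>s. K s t)) \<Longrightarrow> biadditive K"
  unfolding biadditive_def by blast

lemma biadditive_integrate:
  assumes K: "biadditive K" and g: "combination n b g"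
  shows "additive (\<lambda>s. g (K s))"
proof (rule additiveI)
  show "g (K (m, a, Some (x \<otimes>\<^bsub>cpt P (length m) a\<^esub> y))) = g (K (m, a, Some x)) \<otimes>\<^bsub>A\<^esub> g (K (m, a, Some y))"
    if "x \<in> carr P (length m) a" "y \<in> carr P (length m) a" for m a x y
  proof -
    have "K (m, a, Some (x \<otimes>\<^bsub>cpt P (length m) a\<^esub> y)) =
        (\<lambda>t. K (m, a, Some x) t \<otimes>\<^bsub>A\<^esub> K (m, a, Some y) t)"
      using additive_mult_arg[OF biadditiveD(2)[OF K] that] by (rule ext)
    then show ?thesis by (simp add: combination_mult[OF g biadditiveD(1)[OF K] biadditiveD(1)[OF K]])
  qed
qed (use g in simp)

text \<open>
  Since the elements are finite sums, the order of evaluation may be exchanged. This is what the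
  parallel axiom needs, whose two sides evaluate the inserted operations in opposite orders.\<close>

lemma combination_swap:
  assumes K: "biadditive K" and g: "combination n b g" and h: "combination l c h"
  shows "g (\<lambda>s. h (K s)) = h (\<lambda>t. g (\<lambda>s. K s t))"
proof -
  have K': "biadditive (\<lambda>t s. K s t)" by (intro biadditiveI biadditiveD[OF K])
  show ?thesis
    using g
  proof (induction rule: combination.induct)
    case (comb_eval n b s)
    have "eval_at s (\<lambda>s. K s t) = K s t" for t
      by (simp add: eval_at_def biadditiveD[OF K])
    then show ?case using biadditive_integrate[OF K h] by (simp add: eval_at_def)
  next
    case (comb_one n b)
    then show ?case by (simp add: combination_at_one[OF h])
  next
    case (comb_mult n b f g)
    then show ?case
      using combination_mult[OF h biadditive_integrate[OF K'] biadditive_integrate[OF K'], of n b f n b g]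
      by simp
  next
    case (comb_inv n b f)
    then show ?case
      using combination_signed[OF h biadditive_integrate[OF K' comb_inv(1)], of 1]
      by (simp add: signed_def)
  qed
qed

text \<open>
  The cut-off to monomials of the given arities and degrees is necessary as a functional ranges
  over the monomials of all types.\<close>

definition comp_kernel ::
  "nat \<Rightarrow> int \<Rightarrow> nat \<Rightarrow> int \<Rightarrow> nat \<Rightarrow> ('a monomial \<Rightarrow> 'c) \<Rightarrow> 'a monomial \<Rightarrow> 'a monomial \<Rightarrow> 'c" where
  "comp_kernel m a n b i \<phi> s t =
     (if is_monom P m a s \<and> is_monom P n b t
      then signed A (monom_sign s i t) (\<phi> (monom_comp P s i t)) else \<one>\<^bsub>A\<^esub>)"

lemma biadditive_comp_kernel:
  assumes \<phi>: "additive \<phi>" and i: "1 \<le> i" "i \<le> m"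
  shows "biadditive (comp_kernel m a n b i \<phi>)"
proof -
  have closed: "comp_kernel m a n b i \<phi> s t \<in> carrier A" for s t
    using additive_closed[OF \<phi> is_monom_comp[OF i _ _ refl refl], of a s n b t]
    by (simp add: comp_kernel_def A.comm_group_axioms)
  have right: "comp_kernel m a n b i \<phi> s (m2, b', Some (x \<otimes>\<^bsub>cpt P (length m2) b'\<^esub> y)) =
      comp_kernel m a n b i \<phi> s (m2, b', Some x) \<otimes>\<^bsub>A\<^esub> comp_kernel m a n b i \<phi> s (m2, b', Some y)"
    if xy: "x \<in> carr P (length m2) b'" "y \<in> carr P (length m2) b'" for s m2 b' x y
  proof (cases "is_monom P m a s \<and> falses m2 = n \<and> b' - trues m2 = b")
    case True
    obtain m1 a' u where s: "s = (m1, a', u)" by (cases s)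
    have mon: "is_monom P n b (m2, b', Some z)" if "z \<in> carr P (length m2) b'" for z
      using True that by simp
    have i': "i \<le> falses m1" using True i by (simp add: s)
    obtain p w where m1: "m1 = p @ False # w" "i = falses p + 1"
      by (rule mask_splitE[OF i(1) i'])
    let ?M = "p @ m2 @ w"
    let ?f = "\<lambda>z. \<phi> (monom_comp P s i (m2, b', Some z))"
    have M: "?f z = \<phi> (?M, a' + b', unital_pcomp P (length m1) a' (length m2) b' (length p + 1) u (Some z))" for z
      unfolding s m1(2) using mask_pre_append[of p w] mask_post_append[of p w] by (simp add: m1(1))
    have "?f (x \<otimes>\<^bsub>cpt P (length m2) b'\<^esub> y) = ?f x \<otimes>\<^bsub>A\<^esub> ?f y"
    proof (cases u)
      case None
      then have "length m1 = 1" "a' = 0" using True by (auto simp: s)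
      then have "length ?M = length m2" "a' + b' = b'" using m1(1) by auto
      then show ?thesis
        unfolding M None using additive_mult_arg[OF \<phi>, of x ?M b' y] xy by simp
    next
      case (Some v)
      then have v: "v \<in> carr P (length m1) a'" using True by (simp add: s)
      have L: "length ?M = length m1 + length m2 - 1" by (simp add: m1)
      have P: "length p + 1 \<le> length m1" "1 \<le> length p + 1" by (simp_all add: m1)
      show ?thesis
        unfolding M Some unital_pcomp.simps pcomp_mult_right[OF P(2,1) v xy L refl]
        by (rule additive_mult_arg[OF \<phi>]; rule pcomp_closed[OF P(2,1) v _ L refl]; rule xy)
    qed
    moreover have "?f z \<in> carrier A" if "z \<in> carr P (length m2) b'" for z
      using additive_closed[OF \<phi> is_monom_comp[OF i _ mon[OF that] refl refl]] True by blast
    moreover have "monom_sign s i (m2, b', Some z) = monom_sign s i (m2, b', Some x)" for z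
      by (simp add: s)
    ultimately show ?thesis
      unfolding comp_kernel_def
      using True xy mon[OF xy(1)] mon[OF xy(2)] mon[OF mult_closed[OF xy]]
      by (simp add: signed_mult A.comm_group_axioms del: monom_comp.simps is_monom.simps) (metis)
  next
    case False
    then have "comp_kernel m a n b i \<phi> s (m2, b', z) = \<one>\<^bsub>A\<^esub>" for z
      by (auto simp: comp_kernel_def)
    then show ?thesis by simp
  qed
  have left: "comp_kernel m a n b i \<phi> (m1, a', Some (x \<otimes>\<^bsub>cpt P (length m1) a'\<^esub> y)) t =
      comp_kernel m a n b i \<phi> (m1, a', Some x) t \<otimes>\<^bsub>A\<^esub> comp_kernel m a n b i \<phi> (m1, a', Some y) t"
    if xy: "x \<in> carr P (length m1) a'" "y \<in> carr P (length m1) a'" for t m1 a' x y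
  proof (cases "is_monom P n b t \<and> falses m1 = m \<and> a' - trues m1 = a")
    case True
    obtain m2 b' u where t: "t = (m2, b', u)" by (cases t)
    have mon: "is_monom P m a (m1, a', Some z)" if "z \<in> carr P (length m1) a'" for z
      using True that by simp
    have i': "i \<le> falses m1" using True i by simp
    obtain p w where m1: "m1 = p @ False # w" "i = falses p + 1"
      by (rule mask_splitE[OF i(1) i'])
    let ?M = "p @ m2 @ w"
    let ?f = "\<lambda>z. \<phi> (monom_comp P (m1, a', Some z) i t)"
    have M: "?f z = \<phi> (?M, a' + b', unital_pcomp P (length m1) a' (length m2) b' (length p + 1) (Some z) u)" for z
      unfolding t m1(2) using mask_pre_append[of p w] mask_post_append[of p w] by (simp add: m1(1))
    have L: "length ?M = length m1 + length m2 - 1" by (simp add: m1)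
    have P: "length p + 1 \<le> length m1" "1 \<le> length p + 1" by (simp_all add: m1)
    have "?f (x \<otimes>\<^bsub>cpt P (length m1) a'\<^esub> y) = ?f x \<otimes>\<^bsub>A\<^esub> ?f y"
    proof (cases u)
      case None
      then have "length m2 = 1" "b' = 0" using True by (auto simp: t)
      then have "length ?M = length m1" "a' + b' = a'" using L by auto
      then show ?thesis
        unfolding M None using additive_mult_arg[OF \<phi>, of x ?M a' y] xy by simp
    next
      case (Some v)
      then have v: "v \<in> carr P (length m2) b'" using True by (simp add: t)
      show ?thesis
        unfolding M Some unital_pcomp.simps pcomp_mult_left[OF P(2,1) xy v L refl]
        by (rule additive_mult_arg[OF \<phi>]; rule pcomp_closed[OF P(2,1) _ v L refl]; rule xy)
    qed
    moreover have "?f z \<in> carrier A" if "z \<in> carr P (length m1) a'" for z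
      using additive_closed[OF \<phi> is_monom_comp[OF i mon[OF that] _ refl refl]] True by blast
    moreover have "monom_sign (m1, a', Some z) i t = monom_sign (m1, a', Some x) i t" for z
      by (simp add: t)
    ultimately show ?thesis
      unfolding comp_kernel_def
      using True xy mon[OF xy(1)] mon[OF xy(2)] mon[OF mult_closed[OF xy]]
      by (simp add: signed_mult A.comm_group_axioms del: monom_comp.simps is_monom.simps) (metis)
  next
    case False
    then have "comp_kernel m a n b i \<phi> (m1, a', z) t = \<one>\<^bsub>A\<^esub>" for z
      by (auto simp: comp_kernel_def)
    then show ?thesis by simp
  qed
  show ?thesis
    by (intro biadditiveI additiveI closed left right)
qed

definition comb_comp ::
  "nat \<Rightarrow> int \<Rightarrow> nat \<Rightarrow> int \<Rightarrow> nat \<Rightarrow> (('a monomial \<Rightarrow> 'c) \<Rightarrow> 'c) \<Rightarrow> (('a monomial \<Rightarrow> 'c) \<Rightarrow> 'c) \<Rightarrow>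
    ('a monomial \<Rightarrow> 'c) \<Rightarrow> 'c" where
  "comb_comp m a n b i f g = (\<lambda>\<phi>. if additive \<phi> then f (\<lambda>s. g (comp_kernel m a n b i \<phi> s)) else \<one>\<^bsub>A\<^esub>)"

definition normal_form_operad :: "(('a monomial \<Rightarrow> 'c) \<Rightarrow> 'c) goperad" where
  "normal_form_operad =
     \<lparr>cpt = (\<lambda>n d. \<lparr>carrier = {f. combination n d f}, mult = (\<lambda>f g \<phi>. f \<phi> \<otimes>\<^bsub>A\<^esub> g \<phi>), one = (\<lambda>\<phi>. \<one>\<^bsub>A\<^esub>)\<rparr>),
      pcomp = comb_comp\<rparr>"

lemma normal_form_simps [simp]:
  "f \<in> carr normal_form_operad n d \<longleftrightarrow> combination n d f"
  "mult (cpt normal_form_operad n d) f g = (\<lambda>\<phi>. f \<phi> \<otimes>\<^bsub>A\<^esub> g \<phi>)"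
  "one (cpt normal_form_operad n d) = (\<lambda>\<phi>. \<one>\<^bsub>A\<^esub>)"
  "pcomp normal_form_operad = comb_comp"
  by (simp_all add: normal_form_operad_def)

text \<open>
  Composition is the biadditive extension of the composition of monomials.\<close>

lemma comb_comp_eval_at:
  assumes "is_monom P m a s" "is_monom P n b t" "1 \<le> i" "i \<le> m"
  shows "comb_comp m a n b i (eval_at s) (eval_at t) =
    (\<lambda>\<phi>. signed A (monom_sign s i t) (eval_at (monom_comp P s i t) \<phi>))"
proof
  fix \<phi>
  show "comb_comp m a n b i (eval_at s) (eval_at t) \<phi> =
      signed A (monom_sign s i t) (eval_at (monom_comp P s i t) \<phi>)"
  proof (cases "additive \<phi>")
    case True
    note K = biadditive_comp_kernel[OF True assms(3,4), of a n b]
    have "additive (\<lambda>s. eval_at t (comp_kernel m a n b i \<phi> s))"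
      by (rule biadditive_integrate[OF K comb_eval[OF assms(2)]])
    moreover have "additive (comp_kernel m a n b i \<phi> s)" by (rule biadditiveD(1)[OF K])
    ultimately show ?thesis
      using True assms by (simp add: comb_comp_def eval_at_def comp_kernel_def)
  next
    case False then show ?thesis by (simp add: comb_comp_def eval_at_def A.comm_group_axioms)
  qed
qed

lemma combination_comp:
  assumes f: "combination m a f" and g: "combination n b g" and i: "1 \<le> i" "i \<le> m"
    and N: "N = m + n - 1" "d = a + b"
  shows "combination N d (comb_comp m a n b i f g)"
  using f i N(1,2)
proof (induction rule: combination.induct)
  case (comb_eval m a s)
  from g comb_eval show ?case
  proof (induction rule: combination.induct)
    case (comb_eval n b t)
    then show ?case
      using is_monom_comp[of i m a s n b t N d]
      by (auto simp: comb_comp_eval_at intro!: combination_signed_comb combination.comb_eval simp del: One_nat_def)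
  next
    case (comb_one n b)
    have "comb_comp m a n b i (eval_at s) (\<lambda>\<phi>. \<one>\<^bsub>A\<^esub>) = (\<lambda>\<phi>. \<one>\<^bsub>A\<^esub>)"
      by (auto simp: comb_comp_def eval_at_def)
    then show ?case by (simp add: combination.comb_one)
  next
    case (comb_mult n b g g')
    have K: "additive \<phi> \<Longrightarrow> biadditive (comp_kernel m a n b i \<phi>)" for \<phi>
      using comb_mult.prems by (intro biadditive_comp_kernel) auto
    have "comb_comp m a n b i (eval_at s) (\<lambda>\<phi>. g \<phi> \<otimes>\<^bsub>A\<^esub> g' \<phi>) =
        (\<lambda>\<phi>. comb_comp m a n b i (eval_at s) g \<phi> \<otimes>\<^bsub>A\<^esub> comb_comp m a n b i (eval_at s) g' \<phi>)"
      using biadditive_integrate[OF K comb_mult.hyps(1)] biadditive_integrate[OF K comb_mult.hyps(2)]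
      by (auto simp: comb_comp_def eval_at_def additive_mult)
    then show ?case using comb_mult by (simp add: combination.comb_mult)
  next
    case (comb_inv n b g)
    have K: "additive \<phi> \<Longrightarrow> biadditive (comp_kernel m a n b i \<phi>)" for \<phi>
      using comb_inv.prems by (intro biadditive_comp_kernel) auto
    have "comb_comp m a n b i (eval_at s) (\<lambda>\<phi>. inv\<^bsub>A\<^esub> (g \<phi>)) =
        (\<lambda>\<phi>. inv\<^bsub>A\<^esub> (comb_comp m a n b i (eval_at s) g \<phi>))"
      using biadditive_integrate[OF K comb_inv.hyps]
        additive_signed[OF biadditive_integrate[OF K comb_inv.hyps], of _ 1]
      by (auto simp: comb_comp_def eval_at_def signed_def)
    then show ?case using comb_inv by (simp add: combination.comb_inv)
  qed
next
  case (comb_one m a)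
  have "comb_comp m a n b i (\<lambda>\<phi>. \<one>\<^bsub>A\<^esub>) g = (\<lambda>\<phi>. \<one>\<^bsub>A\<^esub>)" by (auto simp: comb_comp_def)
  then show ?case by (simp add: combination.comb_one)
next
  case (comb_mult m a f f')
  have "comb_comp m a n b i (\<lambda>\<phi>. f \<phi> \<otimes>\<^bsub>A\<^esub> f' \<phi>) g =
      (\<lambda>\<phi>. comb_comp m a n b i f g \<phi> \<otimes>\<^bsub>A\<^esub> comb_comp m a n b i f' g \<phi>)"
    by (auto simp: comb_comp_def)
  then show ?case using comb_mult by (simp add: combination.comb_mult)
next
  case (comb_inv m a f)
  have "comb_comp m a n b i (\<lambda>\<phi>. inv\<^bsub>A\<^esub> (f \<phi>)) g = (\<lambda>\<phi>. inv\<^bsub>A\<^esub> (comb_comp m a n b i f g \<phi>))"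
    by (auto simp: comb_comp_def)
  then show ?case using comb_inv by (simp add: combination.comb_inv)
qed

lemma normal_form_comm_group: "comm_group (cpt normal_form_operad n d)"
proof (rule comm_groupI)
  show "\<exists>g\<in>carr normal_form_operad n d. g \<otimes>\<^bsub>cpt normal_form_operad n d\<^esub> f = \<one>\<^bsub>cpt normal_form_operad n d\<^esub>"
    if "f \<in> carr normal_form_operad n d" for f
    using that by (intro bexI[of _ "\<lambda>\<phi>. inv\<^bsub>A\<^esub> (f \<phi>)"]) (auto intro: comb_inv)
qed (auto intro: combination.intros simp: A.m_ac fun_eq_iff)

lemma normal_form_inv:
  assumes "combination n d f"
  shows "inv\<^bsub>cpt normal_form_operad n d\<^esub> f = (\<lambda>\<phi>. inv\<^bsub>A\<^esub> (f \<phi>))"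
proof -
  interpret comm_group "cpt normal_form_operad n d" by (rule normal_form_comm_group)
  show ?thesis using assms by (intro inv_equality) (auto intro: comb_inv)
qed

lemma normal_form_signed:
  "combination n d f \<Longrightarrow> signed (cpt normal_form_operad n d) k f = (\<lambda>\<phi>. signed A k (f \<phi>))"
  by (auto simp: signed_def normal_form_inv)

lemma comb_comp_seq:
  assumes ij: "1 \<le> i" "i \<le> m" "1 \<le> j" "j \<le> n"
    and f: "combination m a f" and g: "combination n b g" and h: "combination l c h"
  shows "comb_comp (m + n - 1) (a + b) l c (i - 1 + j) (comb_comp m a n b i f g) h =
    comb_comp m a (n + l - 1) (b + c) i f (comb_comp n b l c j g h)" (is "?L = ?R")
proof
  fix \<phi>
  show "?L \<phi> = ?R \<phi>"
  proof (cases "additive \<phi>")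
    case \<phi>: True
    have k: "1 \<le> i - 1 + j" "i - 1 + j \<le> m + n - 1" using ij by auto
    let ?K1 = "comp_kernel (m + n - 1) (a + b) l c (i - 1 + j) \<phi>"
    let ?K2 = "comp_kernel m a (n + l - 1) (b + c) i \<phi>"
    have K1: "biadditive ?K1" by (rule biadditive_comp_kernel[OF \<phi> k])
    have K2: "additive (?K2 s)" for s
      by (rule biadditiveD(1)[OF biadditive_comp_kernel[OF \<phi> ij(1,2)]])
    have inner: "comp_kernel m a n b i (\<lambda>r. h (?K1 r)) s t = h (comp_kernel n b l c j (?K2 s) t)" for s t
    proof (cases "is_monom P m a s \<and> is_monom P n b t")
      case True
      then have st: "is_monom P m a s" "is_monom P n b t" by auto
      have "signed A (monom_sign s i t) (?K1 (monom_comp P s i t) r) =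
          comp_kernel n b l c j (?K2 s) t r" for r
      proof (cases "is_monom P l c r")
        case r: True
        note sm = is_monom_comp[OF ij(1,2) st refl refl] is_monom_comp[OF ij(3,4) st(2) r refl refl]
        have "is_monom P (m + n - 1 + l - 1) (a + b + c) (monom_comp P (monom_comp P s i t) (i - 1 + j) r)"
          by (rule is_monom_comp[OF k sm(1) r refl refl])
        from additive_closed[OF \<phi> this] show ?thesis
          using st r sm monom_comp_seq[OF ij st r]
          by (simp add: comp_kernel_def signed_signed A.comm_group_axioms add.commute del: One_nat_def)
      next
        case False then show ?thesis by (simp add: comp_kernel_def A.comm_group_axioms)
      qed
      then have "comp_kernel n b l c j (?K2 s) t =
          (\<lambda>r. signed A (monom_sign s i t) (?K1 (monom_comp P s i t) r))" by auto
      then have "h (comp_kernel n b l c j (?K2 s) t) =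
          signed A (monom_sign s i t) (h (?K1 (monom_comp P s i t)))"
        by (simp add: combination_signed[OF h biadditiveD(1)[OF K1]] del: One_nat_def)
      then show ?thesis using st by (simp add: comp_kernel_def)
    next
      case False
      have "comp_kernel n b l c j (?K2 s) t = (\<lambda>r. \<one>\<^bsub>A\<^esub>)"
        using False by (auto simp: comp_kernel_def A.comm_group_axioms)
      then show ?thesis using False combination_at_one[OF h] by (auto simp: comp_kernel_def)
    qed
    have "?L \<phi> = f (\<lambda>s. g (comp_kernel m a n b i (\<lambda>r. h (?K1 r)) s))"
      using \<phi> biadditive_integrate[OF K1 h] by (simp add: comb_comp_def)
    also have "\<dots> = f (\<lambda>s. g (\<lambda>t. h (comp_kernel n b l c j (?K2 s) t)))"
      using inner by presburger
    also have "\<dots> = ?R \<phi>" using \<phi> K2 by (simp add: comb_comp_def)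
    finally show ?thesis .
  qed (simp add: comb_comp_def)
qed

lemma comb_comp_par:
  assumes ik: "1 \<le> i" "i < k" "k \<le> m"
    and f: "combination m a f" and g: "combination n b g" and h: "combination l c h"
  shows "comb_comp (m + n - 1) (a + b) l c (k - 1 + n) (comb_comp m a n b i f g) h =
    (\<lambda>\<phi>. signed A (b * c) (comb_comp (m + l - 1) (a + c) n b i (comb_comp m a l c k f h) g \<phi>))"
    (is "?L = ?R")
proof
  fix \<phi>
  show "?L \<phi> = ?R \<phi>"
  proof (cases "additive \<phi>")
    case \<phi>: True
    have i: "i \<le> m" "1 \<le> k" and k: "1 \<le> k - 1 + n" "k - 1 + n \<le> m + n - 1" and i': "i \<le> m + l - 1"
      using ik by auto
    let ?K1 = "comp_kernel (m + n - 1) (a + b) l c (k - 1 + n) \<phi>"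
    let ?K2 = "comp_kernel (m + l - 1) (a + c) n b i \<phi>"
    have K1: "biadditive ?K1" by (rule biadditive_comp_kernel[OF \<phi> k])
    have K2: "biadditive ?K2" by (rule biadditive_comp_kernel[OF \<phi> ik(1) i'])
    let ?W1 = "\<lambda>s t. comp_kernel m a n b i (\<lambda>r. h (?K1 r)) s t"
    let ?W2 = "\<lambda>s r. comp_kernel m a l c k (\<lambda>t. g (?K2 t)) s r"
    have swap: "g (?W1 s) = signed A (b * c) (h (?W2 s))" for s
    proof (cases "is_monom P m a s")
      case s: True
      define W where "W = (\<lambda>t r. if is_monom P n b t \<and> is_monom P l c r
        then signed A (monom_sign s i t) (?K1 (monom_comp P s i t) r) else \<one>\<^bsub>A\<^esub>)"
      have W': "W t r = (if is_monom P n b t \<and> is_monom P l c r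
        then signed A (b * c) (signed A (monom_sign s k r) (?K2 (monom_comp P s k r) t)) else \<one>\<^bsub>A\<^esub>)" for t r
      proof (cases "is_monom P n b t \<and> is_monom P l c r")
        case True
        then have tr: "is_monom P n b t" "is_monom P l c r" by auto
        note sm = is_monom_comp[OF ik(1) i(1) s tr(1) refl refl] is_monom_comp[OF i(2) ik(3) s tr(2) refl refl]
        obtain M e w \<sigma> where M: "w \<in> carr P (length M) e"
          "monom_comp P (monom_comp P s k r) i t = (M, e, Some w)"
          "monom_comp P (monom_comp P s i t) (k - 1 + n) r = (M, e, Some (signed (cpt P (length M) e) \<sigma> w))"
          "even (monom_sign s i t + monom_sign (monom_comp P s i t) (k - 1 + n) r + \<sigma>) =
           even (b * c + monom_sign s k r + monom_sign (monom_comp P s k r) i t)"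
          by (rule monom_comp_par[OF ik s tr])
        have "\<phi> (M, e, Some w) \<in> carrier A" using \<phi> M(1) by (simp add: additive_def)
        then show ?thesis
          using tr sm M(2,3) signed_parity[OF M(4)]
          by (simp add: W_def comp_kernel_def signed_signed additive_signed_arg[OF \<phi> M(1)]
              A.comm_group_axioms add.assoc del: One_nat_def)
      qed (auto simp: W_def)
      have Wt: "W t = (if is_monom P n b t then (\<lambda>r. signed A (monom_sign s i t) (?K1 (monom_comp P s i t) r)) else (\<lambda>r. \<one>\<^bsub>A\<^esub>))" for t
        by (auto simp: W_def comp_kernel_def A.comm_group_axioms)
      have Wr: "(\<lambda>t. W t r) = (if is_monom P l c r then
          (\<lambda>t. signed A (b * c) (signed A (monom_sign s k r) (?K2 (monom_comp P s k r) t))) else (\<lambda>t. \<one>\<^bsub>A\<^esub>))" for r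
        unfolding W' by (auto simp: comp_kernel_def A.comm_group_axioms)
      have Wbi: "biadditive W"
      proof (rule biadditiveI)
        show "additive (W t)" for t
          unfolding Wt by (simp add: additive_signed additive_one biadditiveD(1)[OF K1] del: One_nat_def)
        show "additive (\<lambda>t. W t r)" for r
          unfolding Wr by (simp add: additive_signed additive_one biadditiveD(1)[OF K2] del: One_nat_def)
      qed
      have "?W1 s t = h (W t)" for t
      proof (cases "is_monom P n b t")
        case True
        show ?thesis
          using True s combination_signed[OF h biadditiveD(1)[OF K1], of "monom_sign s i t" "monom_comp P s i t"]
          by (simp add: Wt comp_kernel_def[of m a n b] del: One_nat_def)
      next
        case False
        then show ?thesis using combination_at_one[OF h] by (simp add: Wt comp_kernel_def[of m a n b])
      qed
      moreover have "signed A (b * c) (?W2 s r) = g (\<lambda>t. W t r)" for r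
      proof (cases "is_monom P l c r")
        case True
        have "additive (?K2 (monom_comp P s k r))" by (rule biadditiveD(1)[OF K2])
        from combination_signed[OF g this, of "monom_sign s k r"]
          combination_signed[OF g additive_signed[OF this], of "b * c" "monom_sign s k r"]
        show ?thesis using True s by (simp add: Wr comp_kernel_def[of m a l c] del: One_nat_def)
      next
        case False
        then show ?thesis
          using combination_at_one[OF g] by (simp add: Wr comp_kernel_def A.comm_group_axioms)
      qed
      moreover have "additive (?W2 s)"
        by (rule biadditiveD(1)[OF biadditive_comp_kernel[OF biadditive_integrate[OF K2 g] i(2) ik(3)]])
      then have "signed A (b * c) (h (?W2 s)) = h (\<lambda>r. signed A (b * c) (?W2 s r))"
        by (rule combination_signed[OF h, symmetric])
      ultimately show ?thesis using combination_swap[OF Wbi g h] by simp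
    next
      case False
      then have "?W1 s = (\<lambda>t. \<one>\<^bsub>A\<^esub>)" "?W2 s = (\<lambda>t. \<one>\<^bsub>A\<^esub>)" by (auto simp: comp_kernel_def)
      then show ?thesis using combination_at_one[OF g] combination_at_one[OF h] by (simp add: A.comm_group_axioms)
    qed
    have "?L \<phi> = f (\<lambda>s. g (?W1 s))"
      using \<phi> biadditive_integrate[OF K1 h] by (simp add: comb_comp_def)
    also have "\<dots> = f (\<lambda>s. signed A (b * c) (h (?W2 s)))"
      unfolding swap ..
    also have "\<dots> = signed A (b * c) (f (\<lambda>s. h (?W2 s)))"
      by (rule combination_signed[OF f biadditive_integrate[OF biadditive_comp_kernel[OF
              biadditive_integrate[OF K2 g] i(2) ik(3)] h]])
    also have "\<dots> = ?R \<phi>"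
      using \<phi> biadditive_integrate[OF K2 g] by (simp add: comb_comp_def)
    finally show ?thesis .
  qed (simp add: comb_comp_def A.comm_group_axioms)
qed

theorem graded_operad_normal_form: "graded_operad normal_form_operad"
proof (rule graded_operad.intro, goal_cases)
  case (1 n d) show ?case by (rule normal_form_comm_group)
next
  case (2 i m g n b a)
  then have g: "combination n b g" by simp
  show ?case
    using combination_comp[OF _ g 2(1,2) refl refl]
    by (auto intro!: homI simp: comb_comp_def fun_eq_iff simp del: One_nat_def)
next
  case (3 i m f a n b)
  then have f: "combination m a f" by simp
  show ?case
  proof (rule homI)
    show "pcomp normal_form_operad m a n b i f g \<in> carr normal_form_operad (m + n - 1) (a + b)"
      if "g \<in> carr normal_form_operad n b" for g
      using combination_comp[OF f _ 3(1,2) refl refl] that by (simp del: One_nat_def)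
    show "pcomp normal_form_operad m a n b i f (g \<otimes>\<^bsub>cpt normal_form_operad n b\<^esub> g') =
        pcomp normal_form_operad m a n b i f g \<otimes>\<^bsub>cpt normal_form_operad (m + n - 1) (a + b)\<^esub>
        pcomp normal_form_operad m a n b i f g'"
      if "g \<in> carr normal_form_operad n b" "g' \<in> carr normal_form_operad n b" for g g'
    proof -
      have gg: "combination n b g" "combination n b g'" using that by auto
      show ?thesis
        using combination_mult[OF f biadditive_integrate[OF biadditive_comp_kernel[OF _ 3(1,2)] gg(1)]
            biadditive_integrate[OF biadditive_comp_kernel[OF _ 3(1,2)] gg(2)]]
        by (auto simp: comb_comp_def fun_eq_iff)
    qed
  qed
next
  case (4 i m j n f a g b h l c)
  then have "combination m a f" "combination n b g" "combination l c h" by auto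
  then show ?case unfolding normal_form_simps by (rule comb_comp_seq[OF 4(1-4)])
next
  case (5 i k m f a g n b h l c)
  then have c: "combination m a f" "combination n b g" "combination l c h" by auto
  have "combination (m + l - 1) (a + c) (comb_comp m a l c k f h)"
    using 5(1-3) by (intro combination_comp[OF c(1,3)]) auto
  then have "combination (m + n + l - 2) (a + b + c)
      (comb_comp (m + l - 1) (a + c) n b i (comb_comp m a l c k f h) g)"
    using 5(1-3) by (intro combination_comp[OF _ c(2)]) auto
  then show ?case
    by (simp only: normal_form_simps normal_form_signed comb_comp_par[OF 5(1-3) c])
qed

end


subsection \<open>Reading off coefficients\<close>

text \<open>
  A morphism out of the coproduct becomes a morphism out of \<open>Q\<close> by composition with the inverse of
  the natural isomorphism.\<close>

lemma operad_iso_inverse: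
  assumes P: "graded_operad P" and h: "operad_iso P R h"
  obtains g where "operad_hom R P g" "\<And>n d x. x \<in> carr P n d \<Longrightarrow> g n d (h n d x) = x"
proof -
  have hom: "operad_hom P R h" and bij: "\<And>n d. bij_betw (h n d) (carr P n d) (carr R n d)"
    using h by (auto simp: operad_iso_def)
  let ?g = "\<lambda>n d. inv_into (carr P n d) (h n d)"
  have gh: "?g n d (h n d x) = x" if "x \<in> carr P n d" for n d x
    using bij that by (auto simp: bij_betw_def)
  have ex: "\<exists>x\<in>carr P n d. y = h n d x" if "y \<in> carr R n d" for y n d
    using bij[of n d] that by (auto simp: bij_betw_def)
  have "?g n d \<in> hom (cpt R n d) (cpt P n d)" for n d
  proof (rule homI)
    show "?g n d y \<in> carr P n d" if "y \<in> carr R n d" for y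
      using ex[OF that] gh by auto
    show "?g n d (y \<otimes>\<^bsub>cpt R n d\<^esub> y') = ?g n d y \<otimes>\<^bsub>cpt P n d\<^esub> ?g n d y'"
      if "y \<in> carr R n d" "y' \<in> carr R n d" for y y'
      using ex[OF that(1)] ex[OF that(2)] gh
        monoid.m_closed[OF graded_operad.cpt_group(4)[OF P]]
      by (auto simp flip: hom_mult[OF operad_homD(1)[OF hom]])
  qed
  moreover have "?g (m + n - 1) (a + b) (pcomp R m a n b i y y') =
      pcomp P m a n b i (?g m a y) (?g n b y')"
    if i: "1 \<le> i" "i \<le> m" and y: "y \<in> carr R m a" "y' \<in> carr R n b" for m a n b i y y'
  proof -
    obtain x x' where x: "x \<in> carr P m a" "y = h m a x" "x' \<in> carr P n b" "y' = h n b x'"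
      using ex[OF y(1)] ex[OF y(2)] by blast
    have "pcomp R m a n b i y y' = h (m + n - 1) (a + b) (pcomp P m a n b i x x')"
      unfolding x using operad_homD(2)[OF hom i x(1,3) refl refl] by simp
    then show ?thesis
      using gh[OF graded_operad.pcomp_closed[OF P i x(1,3) refl refl]] gh[OF x(1)] gh[OF x(3)] x
      by simp
  qed
  ultimately have "operad_hom R P ?g" unfolding operad_hom_def by blast
  then show thesis using that gh by blast
qed

text \<open>
  The masks of length \<open>L\<close> with \<open>\<kappa>\<close> exactly in the input \<open>a\<close>, respectively in \<open>a < b\<close>.\<close>

definition mask1 :: "nat \<Rightarrow> nat \<Rightarrow> bool list" where
  "mask1 L a = replicate (a - 1) False @ True # replicate (L - a) False"

definition mask2 :: "nat \<Rightarrow> nat \<Rightarrow> nat \<Rightarrow> bool list" where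
  "mask2 L a b = replicate (a - 1) False @ True # replicate (b - a - 1) False @ True # replicate (L - b) False"

lemma replicate_False_eq:
  "replicate p False @ True # w = replicate q False @ True # w' \<longleftrightarrow> p = q \<and> w = w'"
proof (induction p arbitrary: q)
  case 0 show ?case by (cases q) auto
next
  case (Suc p) then show ?case by (cases q) auto
qed

lemma count_replicate_False [simp]:
  "falses (replicate n False) = n" "count_list (replicate n False) True = 0"
  by (induction n) auto

lemma length_mask1 [simp]: "1 \<le> a \<Longrightarrow> a \<le> L \<Longrightarrow> length (mask1 L a) = L"
  by (simp add: mask1_def)

lemma length_mask2 [simp]: "1 \<le> a \<Longrightarrow> a < b \<Longrightarrow> b \<le> L \<Longrightarrow> length (mask2 L a b) = L"
  by (simp add: mask2_def)

lemma count_mask1: "1 \<le> a \<Longrightarrow> a \<le> L \<Longrightarrow> falses (mask1 L a) = L - 1 \<and> trues (mask1 L a) = 1"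
  by (simp add: mask1_def)

lemma count_mask2: "1 \<le> a \<Longrightarrow> a < b \<Longrightarrow> b \<le> L \<Longrightarrow> falses (mask2 L a b) = L - 2 \<and> trues (mask2 L a b) = 2"
  by (simp add: mask2_def)

lemma mask1_inj: "1 \<le> a \<Longrightarrow> 1 \<le> a' \<Longrightarrow> mask1 L a = mask1 L a' \<longleftrightarrow> a = a'"
  by (auto simp: mask1_def replicate_False_eq)

lemma mask2_inj:
  "1 \<le> a \<Longrightarrow> a < b \<Longrightarrow> 1 \<le> a' \<Longrightarrow> a' < b' \<Longrightarrow> mask2 L a b = mask2 L a' b' \<longleftrightarrow> a = a' \<and> b = b'"
  by (auto simp: mask2_def replicate_False_eq)

lemma plug_replicate:
  assumes "1 \<le> i" "i \<le> L"
  shows "mask_pre (replicate L False) i = replicate (i - 1) False"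
    "mask_post (replicate L False) i = replicate (L - i) False"
proof -
  have "replicate L False = replicate (i - 1) False @ False # replicate (L - i) False"
  proof -
    have "L = (i - 1) + Suc (L - i)" using assms by simp
    then have "replicate L False = replicate ((i - 1) + Suc (L - i)) False" by simp
    also have "\<dots> = replicate (i - 1) False @ False # replicate (L - i) False"
      unfolding replicate_add by simp
    finally show ?thesis .
  qed
  moreover have "i = Suc (falses (replicate (i - 1) False))" using assms by simp
  moreover have "mask_pre (u @ False # w) (Suc (falses u)) = u"
    "mask_post (u @ False # w) (Suc (falses u)) = w" for u w
    by (rule mask_pre_append, rule mask_post_append)
  ultimately show "mask_pre (replicate L False) i = replicate (i - 1) False"
    "mask_post (replicate L False) i = replicate (L - i) False"
    by metis+
qed

text \<open>
  After \<open>\<kappa>\<close> has been inserted into the input \<open>j\<close> of an operation, its \<open>i\<close>-th free input is the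
  original input \<open>i\<close> if \<open>i < j\<close>, and the original input \<open>i + 1\<close> otherwise.\<close>

lemma plug_mask1_left:
  assumes "1 \<le> i" "i < j" "j \<le> L"
  shows "mask_pre (mask1 L j) i = replicate (i - 1) False"
    "mask_pre (mask1 L j) i @ True # mask_post (mask1 L j) i = mask2 L i j"
proof -
  let ?u = "replicate (i - 1) False" and ?w = "replicate (j - i - 1) False @ True # replicate (L - j) False"
  have "j - 1 = (i - 1) + Suc (j - i - 1)" using assms by simp
  then have "replicate (j - 1) False = ?u @ False # replicate (j - i - 1) False"
    by (metis replicate_add replicate_Suc)
  then have m: "mask1 L j = ?u @ False # ?w" by (simp add: mask1_def)
  have i: "i = Suc (falses ?u)" using assms by simp
  have "mask_pre (?u @ False # ?w) (Suc (falses ?u)) = ?u" "mask_post (?u @ False # ?w) (Suc (falses ?u)) = ?w"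
    by (rule mask_pre_append, rule mask_post_append)
  then show "mask_pre (mask1 L j) i = replicate (i - 1) False"
    "mask_pre (mask1 L j) i @ True # mask_post (mask1 L j) i = mask2 L i j"
    unfolding m i[symmetric] by (simp_all add: mask2_def)
qed

lemma plug_mask1_right:
  assumes "1 \<le> j" "j \<le> i" "i < L"
  shows "trues (mask_pre (mask1 L j) i) = 1"
    "mask_pre (mask1 L j) i @ True # mask_post (mask1 L j) i = mask2 L j (i + 1)"
proof -
  let ?u = "replicate (j - 1) False @ True # replicate (i - j) False" and ?w = "replicate (L - i - 1) False"
  have "L - j = (i - j) + Suc (L - i - 1)" using assms by simp
  then have "replicate (L - j) False = replicate (i - j) False @ False # ?w"
    by (metis replicate_add replicate_Suc)
  then have m: "mask1 L j = ?u @ False # ?w" by (simp add: mask1_def)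
  have i: "i = Suc (falses ?u)" using assms by simp
  have "mask_pre (?u @ False # ?w) (Suc (falses ?u)) = ?u" "mask_post (?u @ False # ?w) (Suc (falses ?u)) = ?w"
    by (rule mask_pre_append, rule mask_post_append)
  then show "trues (mask_pre (mask1 L j) i) = 1"
    "mask_pre (mask1 L j) i @ True # mask_post (mask1 L j) i = mask2 L j (i + 1)"
    unfolding m i[symmetric] by (simp_all add: mask2_def)
qed

context normal_forms
begin

definition base_form :: "nat \<Rightarrow> int \<Rightarrow> 'a \<Rightarrow> ('a monomial \<Rightarrow> 'c) \<Rightarrow> 'c" where
  "base_form n d x = eval_at (replicate n False, d, Some x)"

definition kappa_form :: "('a monomial \<Rightarrow> 'c) \<Rightarrow> 'c" where
  "kappa_form = eval_at ([True], 0, None)"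

lemma is_monom_base: "x \<in> carr P n d \<Longrightarrow> is_monom P n d (replicate n False, d, Some x)"
  by simp

lemma is_monom_kappa: "is_monom P 0 (-1) ([True], 0, None)"
  by simp

lemma base_form_hom: "operad_hom P normal_form_operad base_form"
  unfolding operad_hom_def
proof (intro conjI allI impI)
  show "base_form n d \<in> hom (cpt P n d) (cpt normal_form_operad n d)" for n d
  proof (rule homI)
    show "base_form n d x \<in> carr normal_form_operad n d" if "x \<in> carr P n d" for x
      unfolding base_form_def normal_form_simps by (rule comb_eval[OF is_monom_base[OF that]])
    show "base_form n d (x \<otimes>\<^bsub>cpt P n d\<^esub> y) =
        base_form n d x \<otimes>\<^bsub>cpt normal_form_operad n d\<^esub> base_form n d y"
      if "x \<in> carr P n d" "y \<in> carr P n d" for x y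
      using additive_mult_arg[of _ x "replicate n False" d y] that
      by (auto simp: base_form_def eval_at_def fun_eq_iff)
  qed
  fix m a n b i x y
  assume "1 \<le> i \<and> i \<le> m \<and> x \<in> carr P m a \<and> y \<in> carr P n b"
  then have i: "1 \<le> i" "i \<le> m" and xy: "x \<in> carr P m a" "y \<in> carr P n b" by auto
  have "replicate (i - 1) False @ replicate n False @ replicate (m - i) False = replicate (m + n - 1) False"
    using i by (simp flip: replicate_add)
  then show "base_form (m + n - 1) (a + b) (pcomp P m a n b i x y) =
      pcomp normal_form_operad m a n b i (base_form m a x) (base_form n b y)"
    using i unfolding base_form_def normal_form_simps
      comb_comp_eval_at[OF is_monom_base[OF xy(1)] is_monom_base[OF xy(2)] i]
    by (simp add: plug_replicate[OF i] signed_def)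
qed

lemma kappa_form_closed: "kappa_form \<in> carr normal_form_operad 0 (-1)"
  unfolding kappa_form_def normal_form_simps by (rule comb_eval[OF is_monom_kappa])

lemma plug_one:
  assumes "x \<in> carr P n d" "1 \<le> i" "i \<le> n"
  shows "comb_comp n d 0 (-1) i (base_form n d x) kappa_form = eval_at (mask1 n i, d, Some x)"
  unfolding base_form_def kappa_form_def comb_comp_eval_at[OF is_monom_base[OF assms(1)] is_monom_kappa assms(2,3)]
  by (simp add: plug_replicate[OF assms(2,3)] mask1_def signed_def)

text \<open>
  The sign in the second case records that the later insertion is to the right of the earlier one,
  whereas normal forms insert from right to left.\<close>

lemma plug_two:
  assumes z: "z \<in> carr P L d" and j: "1 \<le> j" "j \<le> L" and i: "1 \<le> i" "i < L"
  shows "comb_comp (L - 1) (d - 1) 0 (-1) i (comb_comp L d 0 (-1) j (base_form L d z) kappa_form) kappa_form =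
    (if i < j then eval_at (mask2 L i j, d, Some z)
     else (\<lambda>\<phi>. inv\<^bsub>A\<^esub> (eval_at (mask2 L j (i + 1), d, Some z) \<phi>)))"
proof -
  have m: "is_monom P (L - 1) (d - 1) (mask1 L j, d, Some z)"
    using z j count_mask1[OF j] by simp
  have i': "i \<le> L - 1" using i by simp
  show ?thesis
    unfolding plug_one[OF z j] unfolding kappa_form_def comb_comp_eval_at[OF m is_monom_kappa i(1) i']
    using plug_mask1_left[of i j L] plug_mask1_right[of j i L] i j
    by (auto simp: signed_def)
qed

end

text \<open>
  The part of the structure of a curved operad that does not involve the differential.\<close>

locale kappa_presentation = graded_operad Q
  for Q :: "('a, 'm) goperad_scheme" +
  fixes S :: "nat \<Rightarrow> int \<Rightarrow> 'a set" and k :: 'a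
  assumes S: "suboperad S Q" and k: "k \<in> carr Q 0 (-1)" and iso: "natural_iso Q S k"
begin

lemma S_carr: "x \<in> S n d \<Longrightarrow> x \<in> carr Q n d"
  by (rule suboperadD(3)[OF S])

text \<open>
  The coefficient of a mask \<open>M\<close>: a homomorphism that reads off the operation into which \<open>\<kappa>\<close> is
  inserted as prescribed by \<open>M\<close>, for elements with one or two insertions.\<close>

lemma coefficient:
  assumes D: "D = e - trues M" and n: "n = falses M"
  obtains c where "c \<in> hom (cpt Q n D) (cpt Q (length M) e)"
    and "\<And>i x. x \<in> S (n + 1) (D + 1) \<Longrightarrow> 1 \<le> i \<Longrightarrow> i \<le> n + 1 \<Longrightarrow>
      c (pcomp Q (n + 1) (D + 1) 0 (-1) i x k) =
      (if M = mask1 (n + 1) i then x else \<one>\<^bsub>cpt Q (length M) e\<^esub>)"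
    and "\<And>i j z. z \<in> S (n + 2) (D + 2) \<Longrightarrow> 1 \<le> i \<Longrightarrow> i \<le> n + 1 \<Longrightarrow> 1 \<le> j \<Longrightarrow> j \<le> n + 2 \<Longrightarrow>
      c (pcomp Q (n + 1) (D + 1) 0 (-1) i (pcomp Q (n + 2) (D + 2) 0 (-1) j z k) k) =
      (if i < j then (if M = mask2 (n + 2) i j then z else \<one>\<^bsub>cpt Q (length M) e\<^esub>)
       else (if M = mask2 (n + 2) j (i + 1) then inv\<^bsub>cpt Q (length M) e\<^esub> z else \<one>\<^bsub>cpt Q (length M) e\<^esub>))"
proof -
  let ?B = "restrict_operad Q S"
  define H where "H = cpt Q (length M) e"
  interpret H: comm_group H by (simp add: H_def)
  have B: "graded_operad ?B" by (rule graded_operad_restrict[OF S])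
  interpret N: normal_forms ?B H
    by (intro normal_forms.intro B H.comm_group_axioms)
  have N: "graded_operad N.normal_form_operad" by (rule N.graded_operad_normal_form)
  obtain kap where kap: "operad_hom kappa_operad N.normal_form_operad kap" "kap 0 (-1) kappa_gen = N.kappa_form"
  proof (rule free_universal[OF N, of kappa_gens "\<lambda>n d g. N.kappa_form"])
    show "N.kappa_form \<in> carr N.normal_form_operad n d" if "g \<in> kappa_gens n d" for n d g
      using that N.kappa_form_closed by (simp add: kappa_gens_def split: if_splits)
    fix h assume "operad_hom (free_operad kappa_gens) N.normal_form_operad h"
      "\<And>n d g. g \<in> kappa_gens n d \<Longrightarrow> h n d (free_gen kappa_gens n d g) = N.kappa_form"
    then show thesis
      using that[of h] by (simp add: kappa_operad_def kappa_gen_def kappa_gens_def)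
  qed
  have kgen: "kappa_gen \<in> carr kappa_operad 0 (-1)"
    unfolding kappa_gen_def kappa_operad_def by (rule free_gen_closed) (simp add: kappa_gens_def)
  let ?C = "coprod_operad ?B kappa_operad"
  obtain f where f: "operad_hom ?C N.normal_form_operad f"
    and f_inl: "\<And>n d x. x \<in> carr ?B n d \<Longrightarrow> f n d (coprod_inl ?B kappa_operad n d x) = N.base_form n d x"
    and f_inr: "\<And>n d y. y \<in> carr kappa_operad n d \<Longrightarrow> f n d (coprod_inr ?B kappa_operad n d y) = kap n d y"
    by (rule coprod_universal[OF N N.base_form_hom kap(1)]) (rule that)
  obtain h where h: "operad_iso ?C Q h"
    and h_inl: "\<And>n d x. x \<in> S n d \<Longrightarrow> h n d (coprod_inl ?B kappa_operad n d x) = x"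
    and h_inr: "h 0 (-1) (coprod_inr ?B kappa_operad 0 (-1) kappa_gen) = k"
    using iso unfolding natural_iso_def by blast
  obtain g where g: "operad_hom Q ?C g" and gh: "\<And>n d x. x \<in> carr ?C n d \<Longrightarrow> g n d (h n d x) = x"
    by (rule operad_iso_inverse[OF graded_operad_coprod h]) (rule that)
  define \<pi> where "\<pi> = (\<lambda>n d x. f n d (g n d x))"
  have \<pi>: "operad_hom Q N.normal_form_operad \<pi>"
    unfolding \<pi>_def by (rule operad_hom_comp[OF g f])
  have \<pi>_base: "\<pi> n d x = N.base_form n d x" if "x \<in> S n d" for n d x
  proof -
    have x: "x \<in> carr ?B n d" using that by simp
    have "coprod_inl ?B kappa_operad n d x \<in> carr ?C n d"
      by (rule operad_homD(3)[OF coprod_inl_hom[OF B] x])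
    from gh[OF this] show ?thesis using h_inl[OF that] f_inl[OF x] by (simp add: \<pi>_def)
  qed
  have \<pi>_kappa: "\<pi> 0 (-1) k = N.kappa_form"
  proof -
    have "graded_operad kappa_operad" unfolding kappa_operad_def by (rule graded_operad_free)
    then have "coprod_inr ?B kappa_operad 0 (-1) kappa_gen \<in> carr ?C 0 (-1)"
      by (rule operad_homD(3)[OF coprod_inr_hom kgen])
    from gh[OF this] show ?thesis using h_inr f_inr[OF kgen] kap(2) by (simp add: \<pi>_def)
  qed
  \<comment> \<open>The functional that picks the monomials with mask \<open>M\<close> and degree \<open>e\<close>; zero is a default value on the identity.\<close>
  define \<phi> where "\<phi> = (\<lambda>(m, a, x). if m = M \<and> a = e then (case x of None \<Rightarrow> \<one>\<^bsub>H\<^esub> | Some u \<Rightarrow> u) else \<one>\<^bsub>H\<^esub>)"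
  have \<phi>: "N.additive \<phi>"
    by (rule N.additiveI) (auto simp: \<phi>_def H_def intro: S_carr split: option.splits)
  have pk1: "\<pi> n D (pcomp Q (n + 1) (D + 1) 0 (-1) i x k) =
      N.comb_comp (n + 1) (D + 1) 0 (-1) i (\<pi> (n + 1) (D + 1) x) N.kappa_form"
    if "x \<in> carr Q (n + 1) (D + 1)" "1 \<le> i" "i \<le> n + 1" for i x n D
    using operad_homD(2)[OF \<pi> that(2,3,1) k, of n D] by (simp add: \<pi>_kappa)
  show thesis
  proof (rule that[of "\<lambda>q. \<pi> n D q \<phi>"])
    show "(\<lambda>q. \<pi> n D q \<phi>) \<in> hom (cpt Q n D) (cpt Q (length M) e)"
    proof (rule homI)
      show "\<pi> n D x \<phi> \<in> carr Q (length M) e" if "x \<in> carr Q n D" for x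
        using operad_homD(3)[OF \<pi> that] by (simp flip: H_def)
      show "\<pi> n D (x \<otimes>\<^bsub>cpt Q n D\<^esub> y) \<phi> = \<pi> n D x \<phi> \<otimes>\<^bsub>cpt Q (length M) e\<^esub> \<pi> n D y \<phi>"
        if "x \<in> carr Q n D" "y \<in> carr Q n D" for x y
        using hom_mult[OF operad_homD(1)[OF \<pi>] that] by (simp flip: H_def)
    qed
    show "\<pi> n D (pcomp Q (n + 1) (D + 1) 0 (-1) i x k) \<phi> =
        (if M = mask1 (n + 1) i then x else \<one>\<^bsub>cpt Q (length M) e\<^esub>)"
      if x: "x \<in> S (n + 1) (D + 1)" and i: "1 \<le> i" "i \<le> n + 1" for i x
    proof -
      have "D + 1 = e" if "M = mask1 (n + 1) i" using D count_mask1[OF i] that by simp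
      moreover have "\<pi> n D (pcomp Q (n + 1) (D + 1) 0 (-1) i x k) = N.eval_at (mask1 (n + 1) i, D + 1, Some x)"
        using pk1[OF S_carr[OF x] i] N.plug_one[of x "n + 1" "D + 1" i] \<pi>_base[OF x] x i by simp
      then have "\<pi> n D (pcomp Q (n + 1) (D + 1) 0 (-1) i x k) \<phi> = \<phi> (mask1 (n + 1) i, D + 1, Some x)"
        using \<phi> by (simp add: N.eval_at_def)
      ultimately show ?thesis by (auto simp: \<phi>_def H_def)
    qed
    show "\<pi> n D (pcomp Q (n + 1) (D + 1) 0 (-1) i (pcomp Q (n + 2) (D + 2) 0 (-1) j z k) k) \<phi> =
      (if i < j then (if M = mask2 (n + 2) i j then z else \<one>\<^bsub>cpt Q (length M) e\<^esub>)
       else (if M = mask2 (n + 2) j (i + 1) then inv\<^bsub>cpt Q (length M) e\<^esub> z else \<one>\<^bsub>cpt Q (length M) e\<^esub>))"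
      if z: "z \<in> S (n + 2) (D + 2)" and ij: "1 \<le> i" "i \<le> n + 1" "1 \<le> j" "j \<le> n + 2" for i j z
    proof -
      have c: "pcomp Q (n + 2) (D + 2) 0 (-1) j z k \<in> carr Q (n + 1) (D + 1)"
        using ij by (intro pcomp_closed S_carr[OF z] k) auto
      have "\<pi> (n + 1) (D + 1) (pcomp Q (n + 2) (D + 2) 0 (-1) j z k) =
          N.comb_comp (n + 2) (D + 2) 0 (-1) j (N.base_form (n + 2) (D + 2) z) N.kappa_form"
        using operad_homD(2)[OF \<pi> ij(3,4) S_carr[OF z] k, of "n + 1" "D + 1"] \<pi>_base[OF z] \<pi>_kappa by simp
      then have "\<pi> n D (pcomp Q (n + 1) (D + 1) 0 (-1) i (pcomp Q (n + 2) (D + 2) 0 (-1) j z k) k) =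
          N.comb_comp (n + 1) (D + 1) 0 (-1) i
            (N.comb_comp (n + 2) (D + 2) 0 (-1) j (N.base_form (n + 2) (D + 2) z) N.kappa_form) N.kappa_form"
        using pk1[OF c ij(1,2)] by simp
      also have "\<dots> = (if i < j then N.eval_at (mask2 (n + 2) i j, D + 2, Some z)
          else (\<lambda>\<phi>. inv\<^bsub>H\<^esub> (N.eval_at (mask2 (n + 2) j (i + 1), D + 2, Some z) \<phi>)))"
        using N.plug_two[of z "n + 2" "D + 2" j i] z ij by (simp add: add.commute)
      finally have eq: "\<pi> n D (pcomp Q (n + 1) (D + 1) 0 (-1) i (pcomp Q (n + 2) (D + 2) 0 (-1) j z k) k) \<phi> =
          (if i < j then \<phi> (mask2 (n + 2) i j, D + 2, Some z)
           else inv\<^bsub>H\<^esub> (\<phi> (mask2 (n + 2) j (i + 1), D + 2, Some z)))"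
        using \<phi> by (simp add: N.eval_at_def)
      have "D + 2 = e" if "i < j" "M = mask2 (n + 2) i j"
        using D count_mask2[of i j "n + 2"] that ij by simp
      moreover have "D + 2 = e" if "\<not> i < j" "M = mask2 (n + 2) j (i + 1)"
        using D count_mask2[of j "i + 1" "n + 2"] that ij by simp
      ultimately show ?thesis
        unfolding eq using H.inv_one by (auto simp: \<phi>_def H_def)
    qed
  qed
qed

text \<open>
  The element \<open>x\<close> is the coefficient of the mask with \<open>\<kappa>\<close> in the first input. In the coefficient of the
  mask with \<open>\<kappa>\<close> in the inputs \<open>a < b\<close>, inserting into \<open>b\<close> first contributes \<open>z b\<close>, and
  inserting into \<open>a\<close> first contributes \<open>- z a\<close>.\<close>

theorem kappa_insertions_independent:
  assumes N: "1 \<le> N" and x: "x \<in> S N d" and z: "\<And>j. j \<in> {1..N + 1} \<Longrightarrow> z j \<in> S (N + 1) (d + 1)"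
    and zero: "finprod (cpt Q (N - 1) (d - 1)) (\<lambda>i. pcomp Q N d 0 (-1) i
        (x \<otimes>\<^bsub>cpt Q N d\<^esub> finprod (cpt Q N d) (\<lambda>j. pcomp Q (N + 1) (d + 1) 0 (-1) j (z j) k) {1..N + 1}) k)
        {1..N} = \<one>\<^bsub>cpt Q (N - 1) (d - 1)\<^esub>"
  shows "x = \<one>\<^bsub>cpt Q N d\<^esub>" and "\<And>j. j \<in> {1..N + 1} \<Longrightarrow> z j = z 1"
proof -
  obtain n where n: "N = n + 1" using N by (metis le_add_diff_inverse2)
  define D where "D = d - 1"
  have d: "d = D + 1" "d + 1 = D + 2" by (simp_all add: D_def)
  have x': "x \<in> S (n + 1) (D + 1)" using x by (simp add: n D_def)
  have z': "z j \<in> S (n + 2) (D + 2)" if "j \<in> {1..n + 2}" for j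
    using z[of j] that by (simp add: n D_def add.commute)
  let ?u = "\<lambda>i. pcomp Q (n + 1) (D + 1) 0 (-1) i x k"
  let ?y = "\<lambda>j. pcomp Q (n + 2) (D + 2) 0 (-1) j (z j) k"
  let ?v = "\<lambda>i j. pcomp Q (n + 1) (D + 1) 0 (-1) i (?y j) k"
  have y: "?y j \<in> carr Q (n + 1) (D + 1)" if "j \<in> {1..n + 2}" for j
    using that by (intro pcomp_closed S_carr[OF z'[OF that]] k) auto
  have u: "?u i \<in> carr Q n D" if "i \<in> {1..n + 1}" for i
    using that by (intro pcomp_closed S_carr[OF x'] k) auto
  have v: "?v i j \<in> carr Q n D" if "i \<in> {1..n + 1}" "j \<in> {1..n + 2}" for i j
    using that by (intro pcomp_closed y k) auto
  interpret G: comm_group "cpt Q n D" by simp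
  have expand: "finprod (cpt Q n D) (\<lambda>i. ?u i \<otimes>\<^bsub>cpt Q n D\<^esub> finprod (cpt Q n D) (?v i) {1..n + 2}) {1..n + 1} =
      \<one>\<^bsub>cpt Q n D\<^esub>"
  proof -
    have "pcomp Q (n + 1) (D + 1) 0 (-1) i (x \<otimes>\<^bsub>cpt Q (n + 1) (D + 1)\<^esub>
          finprod (cpt Q (n + 1) (D + 1)) ?y {1..n + 2}) k =
        ?u i \<otimes>\<^bsub>cpt Q n D\<^esub> finprod (cpt Q n D) (?v i) {1..n + 2}" if i: "i \<in> {1..n + 1}" for i
    proof -
      have i': "1 \<le> i" "i \<le> n + 1" and nD: "n = n + 1 + 0 - 1" "D = D + 1 + - 1" using i by auto
      have fy: "finprod (cpt Q (n + 1) (D + 1)) ?y {1..n + 2} \<in> carr Q (n + 1) (D + 1)"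
        using y by (rule finprod_in_carr)
      show ?thesis
        unfolding pcomp_mult_left[OF i' S_carr[OF x'] fy k nD]
        by (subst pcomp_finprod_left[OF i' y k nD]) auto
    qed
    then have "finprod (cpt Q n D) (\<lambda>i. ?u i \<otimes>\<^bsub>cpt Q n D\<^esub> finprod (cpt Q n D) (?v i) {1..n + 2}) {1..n + 1} =
      finprod (cpt Q n D) (\<lambda>i. pcomp Q (n + 1) (D + 1) 0 (-1) i (x \<otimes>\<^bsub>cpt Q (n + 1) (D + 1)\<^esub>
          finprod (cpt Q (n + 1) (D + 1)) ?y {1..n + 2}) k) {1..n + 1}"
      using u v by (intro G.finprod_eq[symmetric]) (auto intro!: G.m_closed G.finprod_in_carrier)
    also have "\<dots> = \<one>\<^bsub>cpt Q n D\<^esub>" using zero by (simp add: n d add.commute)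
    finally show ?thesis .
  qed
  have apply_c: "finprod H (\<lambda>i. c (?u i) \<otimes>\<^bsub>H\<^esub> finprod H (\<lambda>j. c (?v i j)) {1..n + 2}) {1..n + 1} = \<one>\<^bsub>H\<^esub>"
    if c: "c \<in> hom (cpt Q n D) H" and H: "comm_group H" for c and H :: "'a monoid"
  proof -
    interpret H: comm_group H by fact
    have uv: "?u i \<otimes>\<^bsub>cpt Q n D\<^esub> finprod (cpt Q n D) (?v i) {1..n + 2} \<in> carr Q n D" if "i \<in> {1..n + 1}" for i
      using u v that by (auto intro!: G.m_closed G.finprod_in_carrier)
    have cuv: "c (?u i) \<in> carrier H" "j \<in> {1..n + 2} \<Longrightarrow> c (?v i j) \<in> carrier H" if "i \<in> {1..n + 1}" for i j
      using hom_in_carrier[OF c] u v that by auto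
    have "c (?u i \<otimes>\<^bsub>cpt Q n D\<^esub> finprod (cpt Q n D) (?v i) {1..n + 2}) =
        c (?u i) \<otimes>\<^bsub>H\<^esub> finprod H (\<lambda>j. c (?v i j)) {1..n + 2}" if i: "i \<in> {1..n + 1}" for i
    proof -
      have fv: "finprod (cpt Q n D) (?v i) {1..n + 2} \<in> carr Q n D"
        using v[OF i] by (rule finprod_in_carr)
      have "c (finprod (cpt Q n D) (?v i) {1..n + 2}) = finprod H (\<lambda>j. c (?v i j)) {1..n + 2}"
        using v[OF i] by (rule hom_finprod[OF c comm_group_cpt H])
      then show ?thesis using hom_mult[OF c u[OF i] fv] by simp
    qed
    then have "finprod H (\<lambda>i. c (?u i) \<otimes>\<^bsub>H\<^esub> finprod H (\<lambda>j. c (?v i j)) {1..n + 2}) {1..n + 1} =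
        finprod H (\<lambda>i. c (?u i \<otimes>\<^bsub>cpt Q n D\<^esub> finprod (cpt Q n D) (?v i) {1..n + 2})) {1..n + 1}"
      using cuv by (intro H.finprod_eq[symmetric]) (auto intro!: H.m_closed H.finprod_in_carrier)
    also have "\<dots> = c \<one>\<^bsub>cpt Q n D\<^esub>"
      unfolding expand[symmetric] using uv by (rule hom_finprod[OF c comm_group_cpt H, symmetric])
    also have "\<dots> = \<one>\<^bsub>H\<^esub>" by (rule hom_to_one[OF c comm_group_cpt H])
    finally show ?thesis .
  qed

  show "x = \<one>\<^bsub>cpt Q N d\<^esub>"
  proof -
    let ?M = "mask1 (n + 1) 1"
    have M: "n = falses ?M" "D = D + 1 - trues ?M" "length ?M = n + 1"
      using count_mask1[of 1 "n + 1"] by auto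
    let ?H = "cpt Q (n + 1) (D + 1)"
    interpret H: comm_group ?H by simp
    obtain c where c: "c \<in> hom (cpt Q n D) ?H"
      and c1: "\<And>i x. x \<in> S (n + 1) (D + 1) \<Longrightarrow> 1 \<le> i \<Longrightarrow> i \<le> n + 1 \<Longrightarrow>
        c (pcomp Q (n + 1) (D + 1) 0 (-1) i x k) = (if ?M = mask1 (n + 1) i then x else \<one>\<^bsub>?H\<^esub>)"
      and c2: "\<And>i j z. z \<in> S (n + 2) (D + 2) \<Longrightarrow> 1 \<le> i \<Longrightarrow> i \<le> n + 1 \<Longrightarrow> 1 \<le> j \<Longrightarrow> j \<le> n + 2 \<Longrightarrow>
      c (pcomp Q (n + 1) (D + 1) 0 (-1) i (pcomp Q (n + 2) (D + 2) 0 (-1) j z k) k) =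
      (if i < j then (if ?M = mask2 (n + 2) i j then z else \<one>\<^bsub>?H\<^esub>)
       else (if ?M = mask2 (n + 2) j (i + 1) then inv\<^bsub>?H\<^esub> z else \<one>\<^bsub>?H\<^esub>))"
      using coefficient[OF M(2,1)] unfolding M(3) by blast
    have "?M \<noteq> mask2 (n + 2) i j" if "1 \<le> i" "i < j" "j \<le> n + 2" for i j
      using that M(3) length_mask2[of i j "n + 2"] by (metis add_left_cancel n_not_Suc_n numeral_2_eq_2 One_nat_def)
    then have c2': "c (?v i j) = \<one>\<^bsub>?H\<^esub>" if "i \<in> {1..n + 1}" "j \<in> {1..n + 2}" for i j
      using c2[OF z'[OF that(2)], of i j] that by auto
    have c1': "c (?u i) = (if i = 1 then x else \<one>\<^bsub>?H\<^esub>)" if "i \<in> {1..n + 1}" for i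
      using c1[OF x', of i] that mask1_inj[of 1 i "n + 1"] by auto
    have "finprod ?H (\<lambda>i. c (?u i) \<otimes>\<^bsub>?H\<^esub> finprod ?H (\<lambda>j. c (?v i j)) {1..n + 2}) {1..n + 1} =
        finprod ?H (\<lambda>i. if i = 1 then x else \<one>\<^bsub>?H\<^esub>) {1..n + 1}"
    proof (rule H.finprod_eq)
      fix i assume i: "i \<in> {1..n + 1}"
      have "finprod ?H (\<lambda>j. c (?v i j)) {1..n + 2} = \<one>\<^bsub>?H\<^esub>"
        using c2'[OF i] by (rule H.finprod_one_eqI)
      then show "c (?u i) \<otimes>\<^bsub>?H\<^esub> finprod ?H (\<lambda>j. c (?v i j)) {1..n + 2} = (if i = 1 then x else \<one>\<^bsub>?H\<^esub>)"
        using c1'[OF i] S_carr[OF x'] by simp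
    qed (use S_carr[OF x'] in auto)
    also have "\<dots> = x" using S_carr[OF x'] by (intro H.finprod_delta) auto
    finally show ?thesis using apply_c[OF c comm_group_cpt] by (simp add: n d)
  qed

  have eq: "z b = z a" if ab: "1 \<le> a" "a < b" "b \<le> n + 2" for a b
  proof -
    let ?M = "mask2 (n + 2) a b"
    have M: "n = falses ?M" "D = D + 2 - trues ?M" "length ?M = n + 2"
      using count_mask2[OF ab] ab by auto
    let ?H = "cpt Q (n + 2) (D + 2)"
    interpret H: comm_group ?H by simp
    obtain c where c: "c \<in> hom (cpt Q n D) ?H"
      and c1: "\<And>i x. x \<in> S (n + 1) (D + 1) \<Longrightarrow> 1 \<le> i \<Longrightarrow> i \<le> n + 1 \<Longrightarrow>
        c (pcomp Q (n + 1) (D + 1) 0 (-1) i x k) = (if ?M = mask1 (n + 1) i then x else \<one>\<^bsub>?H\<^esub>)"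
      and c2: "\<And>i j z. z \<in> S (n + 2) (D + 2) \<Longrightarrow> 1 \<le> i \<Longrightarrow> i \<le> n + 1 \<Longrightarrow> 1 \<le> j \<Longrightarrow> j \<le> n + 2 \<Longrightarrow>
      c (pcomp Q (n + 1) (D + 1) 0 (-1) i (pcomp Q (n + 2) (D + 2) 0 (-1) j z k) k) =
      (if i < j then (if ?M = mask2 (n + 2) i j then z else \<one>\<^bsub>?H\<^esub>)
       else (if ?M = mask2 (n + 2) j (i + 1) then inv\<^bsub>?H\<^esub> z else \<one>\<^bsub>?H\<^esub>))"
      using coefficient[OF M(2,1)] unfolding M(3) by blast
    have za: "z a \<in> carrier ?H" "z b \<in> carrier ?H"
      using S_carr[OF z'[of a]] S_carr[OF z'[of b]] ab by auto
    have c1': "c (?u i) = \<one>\<^bsub>?H\<^esub>" if "i \<in> {1..n + 1}" for i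
    proof -
      have "?M \<noteq> mask1 (n + 1) i" using that M(3) length_mask1[of i "n + 1"] by auto
      then show ?thesis using c1[OF x', of i] that by simp
    qed
    \<comment> \<open>The contribution of \<open>b\<close> filled before \<open>a\<close>, and that of \<open>a\<close> filled before \<open>b\<close>; in the latter case \<open>b\<close> is by then the free input number \<open>b - 1\<close>.\<close>
    let ?p = "\<lambda>i j. if j = b then (if i = a then z b else \<one>\<^bsub>?H\<^esub>) else \<one>\<^bsub>?H\<^esub>"
    let ?q = "\<lambda>i j. if j = a then (if i = b - 1 then inv\<^bsub>?H\<^esub> (z a) else \<one>\<^bsub>?H\<^esub>) else \<one>\<^bsub>?H\<^esub>"
    have c2': "c (?v i j) = ?p i j \<otimes>\<^bsub>?H\<^esub> ?q i j" if ij: "i \<in> {1..n + 1}" "j \<in> {1..n + 2}" for i j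
    proof (cases "i < j")
      case True
      then have "c (?v i j) = (if a = i \<and> b = j then z j else \<one>\<^bsub>?H\<^esub>)"
        using c2[OF z'[OF ij(2)], of i j] ij mask2_inj[of a b i j "n + 2"] ab by auto
      then show ?thesis using True za ab by auto
    next
      case False
      then have "c (?v i j) = (if a = j \<and> b = i + 1 then inv\<^bsub>?H\<^esub> (z j) else \<one>\<^bsub>?H\<^esub>)"
        using c2[OF z'[OF ij(2)], of i j] ij mask2_inj[of a b j "i + 1" "n + 2"] ab by auto
      then show ?thesis using False za ab by auto
    qed
    have inner: "finprod ?H (\<lambda>j. c (?v i j)) {1..n + 2} =
        (if i = a then z b else \<one>\<^bsub>?H\<^esub>) \<otimes>\<^bsub>?H\<^esub> (if i = b - 1 then inv\<^bsub>?H\<^esub> (z a) else \<one>\<^bsub>?H\<^esub>)"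
      if i: "i \<in> {1..n + 1}" for i
    proof -
      have "finprod ?H (\<lambda>j. c (?v i j)) {1..n + 2} = finprod ?H (\<lambda>j. ?p i j \<otimes>\<^bsub>?H\<^esub> ?q i j) {1..n + 2}"
        using c2'[OF i]
      proof (rule H.finprod_eq)
        show "?p i j \<otimes>\<^bsub>?H\<^esub> ?q i j \<in> carrier ?H" for j by (rule H.m_closed) (use za in simp_all)
      qed
      also have "\<dots> = finprod ?H (?p i) {1..n + 2} \<otimes>\<^bsub>?H\<^esub> finprod ?H (?q i) {1..n + 2}"
        using za by (intro H.finprod_mult) auto
      also have "finprod ?H (?p i) {1..n + 2} = (if i = a then z b else \<one>\<^bsub>?H\<^esub>)"
        using za ab by (intro H.finprod_delta) auto
      also have "finprod ?H (?q i) {1..n + 2} = (if i = b - 1 then inv\<^bsub>?H\<^esub> (z a) else \<one>\<^bsub>?H\<^esub>)"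
        using za ab by (intro H.finprod_delta) auto
      finally show ?thesis .
    qed
    have "finprod ?H (\<lambda>i. c (?u i) \<otimes>\<^bsub>?H\<^esub> finprod ?H (\<lambda>j. c (?v i j)) {1..n + 2}) {1..n + 1} =
        finprod ?H (\<lambda>i. (if i = a then z b else \<one>\<^bsub>?H\<^esub>) \<otimes>\<^bsub>?H\<^esub> (if i = b - 1 then inv\<^bsub>?H\<^esub> (z a) else \<one>\<^bsub>?H\<^esub>)) {1..n + 1}"
    proof (rule H.finprod_eq)
      fix i assume i: "i \<in> {1..n + 1}"
      show c: "(if i = a then z b else \<one>\<^bsub>?H\<^esub>) \<otimes>\<^bsub>?H\<^esub> (if i = b - 1 then inv\<^bsub>?H\<^esub> (z a) else \<one>\<^bsub>?H\<^esub>) \<in> carrier ?H"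
        by (rule H.m_closed) (use za in simp_all)
      show "c (?u i) \<otimes>\<^bsub>?H\<^esub> finprod ?H (\<lambda>j. c (?v i j)) {1..n + 2} =
          (if i = a then z b else \<one>\<^bsub>?H\<^esub>) \<otimes>\<^bsub>?H\<^esub> (if i = b - 1 then inv\<^bsub>?H\<^esub> (z a) else \<one>\<^bsub>?H\<^esub>)"
        unfolding c1'[OF i] inner[OF i] by (rule H.l_one[OF c])
    qed
    also have "\<dots> = finprod ?H (\<lambda>i. if i = a then z b else \<one>\<^bsub>?H\<^esub>) {1..n + 1} \<otimes>\<^bsub>?H\<^esub>
        finprod ?H (\<lambda>i. if i = b - 1 then inv\<^bsub>?H\<^esub> (z a) else \<one>\<^bsub>?H\<^esub>) {1..n + 1}"
      using za by (intro H.finprod_mult) auto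
    also have "\<dots> = z b \<otimes>\<^bsub>?H\<^esub> inv\<^bsub>?H\<^esub> (z a)"
    proof -
      have "finprod ?H (\<lambda>i. if i = a then z b else \<one>\<^bsub>?H\<^esub>) {1..n + 1} = z b"
        using za ab by (intro H.finprod_delta) auto
      moreover have "finprod ?H (\<lambda>i. if i = b - 1 then inv\<^bsub>?H\<^esub> (z a) else \<one>\<^bsub>?H\<^esub>) {1..n + 1} = inv\<^bsub>?H\<^esub> (z a)"
        using za ab by (intro H.finprod_delta) auto
      ultimately show ?thesis by simp
    qed
    finally have "z b \<otimes>\<^bsub>?H\<^esub> inv\<^bsub>?H\<^esub> (z a) = \<one>\<^bsub>?H\<^esub>"
      using apply_c[OF c comm_group_cpt] by simp
    from H.inv_equality[OF this] show ?thesis using za by simp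
  qed
  show "z j = z 1" if "j \<in> {1..N + 1}" for j
  proof (cases "j = 1")
    case False
    then show ?thesis using that by (intro eq) (auto simp: n)
  qed simp
qed

end


section \<open>Elements of weight at most one\<close>

context graded_operad
begin

context
  fixes S :: "nat \<Rightarrow> int \<Rightarrow> 'a set" and k :: 'a
  assumes S: "suboperad S P" and k: "k \<in> carr P 0 (-1)"
begin

inductive weight_one :: "nat \<Rightarrow> int \<Rightarrow> 'a \<Rightarrow> bool" where
  w1_insert: "z \<in> S (n + 1) (d + 1) \<Longrightarrow> 1 \<le> j \<Longrightarrow> j \<le> n + 1 \<Longrightarrow>
    weight_one n d (pcomp P (n + 1) (d + 1) 0 (-1) j z k)"
| w1_kappa: "weight_one 0 (-1) k"
| w1_one: "weight_one n d \<one>\<^bsub>cpt P n d\<^esub>"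
| w1_mult: "weight_one n d x \<Longrightarrow> weight_one n d y \<Longrightarrow> weight_one n d (x \<otimes>\<^bsub>cpt P n d\<^esub> y)"
| w1_inv: "weight_one n d x \<Longrightarrow> weight_one n d (inv\<^bsub>cpt P n d\<^esub> x)"

lemma weight_one_signed: "weight_one n d x \<Longrightarrow> weight_one n d (signed (cpt P n d) c x)"
  by (simp add: signed_def w1_inv)

lemma weight_one_carr: "weight_one n d x \<Longrightarrow> x \<in> carr P n d"
proof (induction rule: weight_one.induct)
  case (w1_insert z n d j)
  then show ?case by (intro pcomp_closed k suboperadD(3)[OF S]) auto
qed (simp_all add: k mult_closed inv_in_carr one_in_carr)

lemma weight_one_insert':
  "z \<in> S M e \<Longrightarrow> 1 \<le> j \<Longrightarrow> j \<le> M \<Longrightarrow> M = n + 1 \<Longrightarrow> e = d + 1 \<Longrightarrow>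
    weight_one n d (pcomp P M e 0 (-1) j z k)"
  using w1_insert by simp

text \<open>
  Composing commutes the insertion of \<open>k\<close> to the outside: by the parallel axiom when another operation
  is composed at a different input, and by the sequential axiom in \<open>weight_one_comp_right\<close>.\<close>

lemma weight_one_comp_left:
  assumes "weight_one m a x" and y: "y \<in> S n b" and "1 \<le> i" "i \<le> m" and "N = m + n - 1" "d = a + b"
  shows "weight_one N d (pcomp P m a n b i x y)"
  using assms(1) assms(3-)
proof (induction rule: weight_one.induct)
  case (w1_insert z m a j)
  note yc = suboperadD(3)[OF S y] and zc = suboperadD(3)[OF S w1_insert(1)]
  have N: "N + 1 = m + 1 + n - 1" "d + 1 = a + 1 + b" using w1_insert by auto
  show ?case
  proof (cases "i < j")
    case True
    have u: "pcomp P (m + 1) (a + 1) n b i z y \<in> S (N + 1) (d + 1)"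
      using w1_insert True N by (intro suboperadD(2)[OF S _ _ _ y]) auto
    let ?w = "pcomp P m a n b i (pcomp P (m + 1) (a + 1) 0 (-1) j z k) y"
    have wc: "?w \<in> carr P N d"
      using w1_insert by (intro pcomp_closed[OF _ _ pcomp_closed[OF _ _ zc k] yc]) auto
    have "pcomp P (N + 1) (d + 1) 0 (-1) (j - 1 + n) (pcomp P (m + 1) (a + 1) n b i z y) k =
        signed (cpt P N d) (b * -1) ?w"
      using w1_insert True N by (intro pcomp_par' zc yc k) auto
    then have "?w = signed (cpt P N d) (b * -1)
        (pcomp P (N + 1) (d + 1) 0 (-1) (j - 1 + n) (pcomp P (m + 1) (a + 1) n b i z y) k)"
      using wc by (simp add: signed_def)
    moreover have "weight_one N d (pcomp P (N + 1) (d + 1) 0 (-1) (j - 1 + n) (pcomp P (m + 1) (a + 1) n b i z y) k)"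
      using w1_insert True N by (intro weight_one_insert'[OF u]) auto
    ultimately show ?thesis by (metis weight_one_signed)
  next
    case False
    \<comment> \<open>The \<open>i\<close>-th input left after the insertion at \<open>j \<le> i\<close> is the input \<open>i + 1\<close> of \<open>z\<close>.\<close>
    have u: "pcomp P (m + 1) (a + 1) n b (i + 1) z y \<in> S (N + 1) (d + 1)"
      using w1_insert N by (intro suboperadD(2)[OF S _ _ _ y]) auto
    have "pcomp P m a n b i (pcomp P (m + 1) (a + 1) 0 (-1) j z k) y =
        signed (cpt P N d) (-1 * b) (pcomp P (N + 1) (d + 1) 0 (-1) j (pcomp P (m + 1) (a + 1) n b (i + 1) z y) k)"
      using w1_insert False N by (intro pcomp_par' zc yc k) auto
    moreover have "weight_one N d (pcomp P (N + 1) (d + 1) 0 (-1) j (pcomp P (m + 1) (a + 1) n b (i + 1) z y) k)"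
      using w1_insert False N by (intro weight_one_insert'[OF u]) auto
    ultimately show ?thesis by (simp add: weight_one_signed)
  qed
next
  case (w1_one m a)
  then show ?case
    using pcomp_one_left[OF w1_one(1,2) suboperadD(3)[OF S y] w1_one(3,4)] by (simp add: weight_one.w1_one)
next
  case (w1_mult m a x x')
  then show ?case
    using pcomp_mult_left[OF _ _ weight_one_carr weight_one_carr suboperadD(3)[OF S y], of i m a x x' N d]
    by (simp add: weight_one.w1_mult)
next
  case (w1_inv m a x)
  then show ?case
    using pcomp_inv_left[OF _ _ weight_one_carr suboperadD(3)[OF S y], of i m a x N d]
    by (simp add: weight_one.w1_inv)
qed simp

lemma weight_one_comp_right:
  assumes "weight_one n b y" and x: "x \<in> S m a" and "1 \<le> i" "i \<le> m" and "N = m + n - 1" "d = a + b"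
  shows "weight_one N d (pcomp P m a n b i x y)"
  using assms(1) assms(3-)
proof (induction rule: weight_one.induct)
  case (w1_insert z n b j)
  note xc = suboperadD(3)[OF S x] and zc = suboperadD(3)[OF S w1_insert(1)]
  have u: "pcomp P m a (n + 1) (b + 1) i x z \<in> S (N + 1) (d + 1)"
    using w1_insert by (intro suboperadD(2)[OF S _ _ x]) auto
  have "pcomp P (N + 1) (d + 1) 0 (-1) (i - 1 + j) (pcomp P m a (n + 1) (b + 1) i x z) k =
      pcomp P m a n b i x (pcomp P (n + 1) (b + 1) 0 (-1) j z k)"
    using w1_insert by (intro pcomp_seq' xc zc k) auto
  moreover have "weight_one N d (pcomp P (N + 1) (d + 1) 0 (-1) (i - 1 + j) (pcomp P m a (n + 1) (b + 1) i x z) k)"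
    using w1_insert by (intro weight_one_insert'[OF u]) auto
  ultimately show ?case by simp
next
  case w1_kappa
  then show ?case by (intro weight_one_insert'[OF x]) auto
next
  case (w1_one n b)
  then show ?case
    using pcomp_one_right[OF w1_one(1,2) suboperadD(3)[OF S x] w1_one(3,4)] by (simp add: weight_one.w1_one)
next
  case (w1_mult n b y y')
  then show ?case
    using pcomp_mult_right[OF _ _ suboperadD(3)[OF S x] weight_one_carr weight_one_carr, of i n b y y' N d]
    by (simp add: weight_one.w1_mult)
next
  case (w1_inv n b y)
  then show ?case
    using pcomp_inv_right[OF _ _ suboperadD(3)[OF S x] weight_one_carr, of i n b y N d]
    by (simp add: weight_one.w1_inv)
qed

text \<open>
  The weights of the factors add up, and those of a nonzero composite are not negative. So an element of
  weight one involves exactly one insertion, and an element of weight zero involves none.\<close>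

lemma low_weights:
  "weight_part P S k w n d x \<Longrightarrow>
    (w < 0 \<longrightarrow> x = \<one>\<^bsub>cpt P n d\<^esub>) \<and> (w = 0 \<longrightarrow> x \<in> S n d) \<and> (w = 1 \<longrightarrow> weight_one n d x)"
proof (induction rule: weight_part.induct)
  case (wp_zero w n d)
  then show ?case using subgroup.one_closed[OF suboperadD(1)[OF S]] by (simp add: w1_one)
next
  case (wp_add w n d x y)
  then show ?case
    using subgroup.m_closed[OF suboperadD(1)[OF S]] monoid.l_one[OF cpt_group(4) one_in_carr, of n d]
    by (auto simp: w1_mult)
next
  case (wp_neg w n d x)
  then show ?case
    using subgroup.m_inv_closed[OF suboperadD(1)[OF S]] monoid.inv_one[OF cpt_group(4), of n d]
    by (auto simp: w1_inv)
next
  case (wp_comp v m a x w n b y i)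
  note i = wp_comp(3,4)
  note xc = weight_part_carr[OF S k wp_comp(1)] and yc = weight_part_carr[OF S k wp_comp(2)]
  consider "v < 0" | "w < 0" | "v \<ge> 0" "w \<ge> 0" by linarith
  then show ?case
  proof cases
    case 1
    then have "pcomp P m a n b i x y = \<one>\<^bsub>cpt P (m + n - 1) (a + b)\<^esub>"
      using wp_comp.IH(1) pcomp_one_left[OF i yc refl refl] by simp
    then show ?thesis
      using subgroup.one_closed[OF suboperadD(1)[OF S]] by (simp add: w1_one del: One_nat_def)
  next
    case 2
    then have "pcomp P m a n b i x y = \<one>\<^bsub>cpt P (m + n - 1) (a + b)\<^esub>"
      using wp_comp.IH(2) pcomp_one_right[OF i xc refl refl] by simp
    then show ?thesis
      using subgroup.one_closed[OF suboperadD(1)[OF S]] by (simp add: w1_one del: One_nat_def)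
  next
    case 3
    show ?thesis
    proof (intro conjI impI)
      show "v + w < 0 \<Longrightarrow> pcomp P m a n b i x y = \<one>\<^bsub>cpt P (m + n - 1) (a + b)\<^esub>" using 3 by simp
      assume "v + w = 0"
      then have "v = 0" "w = 0" using 3 by auto
      then show "pcomp P m a n b i x y \<in> S (m + n - 1) (a + b)"
        using wp_comp.IH by (intro suboperadD(2)[OF S i]) auto
    next
      assume "v + w = 1"
      then consider "v = 1" "w = 0" | "v = 0" "w = 1" using 3 by linarith
      then show "weight_one (m + n - 1) (a + b) (pcomp P m a n b i x y)"
      proof cases
        case 1
        then show ?thesis using wp_comp.IH by (intro weight_one_comp_left[OF _ _ i refl refl]) auto
      next
        case 2
        then show ?thesis using wp_comp.IH by (intro weight_one_comp_right[OF _ _ i refl refl]) auto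
      qed
    qed
  qed
qed (auto intro: w1_kappa)

text \<open>
  Outside arity zero and degree \<open>-1\<close>, where \<open>k\<close> itself has weight one, the insertions into a fixed
  input can be collected into a single one.\<close>

lemma weight_one_expand:
  assumes "weight_one n d x" "\<not> (n = 0 \<and> d = -1)"
  shows "\<exists>z. (\<forall>j\<in>{1..n + 1}. z j \<in> S (n + 1) (d + 1)) \<and>
    x = finprod (cpt P n d) (\<lambda>j. pcomp P (n + 1) (d + 1) 0 (-1) j (z j) k) {1..n + 1}"
  using assms
proof (induction rule: weight_one.induct)
  case (w1_insert z n d j)
  interpret comm_group "cpt P n d" by simp
  let ?z = "\<lambda>i. if i = j then z else \<one>\<^bsub>cpt P (n + 1) (d + 1)\<^esub>"
  have z: "?z i \<in> S (n + 1) (d + 1)" for i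
    using w1_insert subgroup.one_closed[OF suboperadD(1)[OF S]] by simp
  have nd: "n = n + 1 + 0 - 1" "d = d + 1 + -1" by auto
  have t: "pcomp P (n + 1) (d + 1) 0 (-1) i z k \<in> carr P n d" if "i \<in> {1..n + 1}" for i
    using that by (intro pcomp_closed suboperadD(3)[OF S w1_insert(1)] k) auto
  have "finprod (cpt P n d) (\<lambda>i. pcomp P (n + 1) (d + 1) 0 (-1) i (?z i) k) {1..n + 1} =
      finprod (cpt P n d) (\<lambda>i. if i = j then pcomp P (n + 1) (d + 1) 0 (-1) j z k else \<one>\<^bsub>cpt P n d\<^esub>) {1..n + 1}"
    using t pcomp_one_left[OF _ _ k nd] w1_insert by (intro finprod_eq) auto
  also have "\<dots> = pcomp P (n + 1) (d + 1) 0 (-1) j z k"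
    using t w1_insert by (intro finprod_delta) auto
  finally show ?case using z by (intro exI[of _ ?z]) auto
next
  case (w1_one n d)
  interpret comm_group "cpt P n d" by simp
  have nd: "n = n + 1 + 0 - 1" "d = d + 1 + -1" by auto
  have "finprod (cpt P n d) (\<lambda>i. pcomp P (n + 1) (d + 1) 0 (-1) i \<one>\<^bsub>cpt P (n + 1) (d + 1)\<^esub> k) {1..n + 1} =
      \<one>\<^bsub>cpt P n d\<^esub>"
    using pcomp_one_left[OF _ _ k nd] by (intro finprod_one_eqI) auto
  then show ?case
    using subgroup.one_closed[OF suboperadD(1)[OF S]]
    by (intro exI[of _ "\<lambda>i. \<one>\<^bsub>cpt P (n + 1) (d + 1)\<^esub>"]) auto
next
  case (w1_mult n d x y)
  interpret comm_group "cpt P n d" by simp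
  obtain z z' where z: "\<forall>j\<in>{1..n + 1}. z j \<in> S (n + 1) (d + 1)"
    "x = finprod (cpt P n d) (\<lambda>j. pcomp P (n + 1) (d + 1) 0 (-1) j (z j) k) {1..n + 1}"
    and z': "\<forall>j\<in>{1..n + 1}. z' j \<in> S (n + 1) (d + 1)"
    "y = finprod (cpt P n d) (\<lambda>j. pcomp P (n + 1) (d + 1) 0 (-1) j (z' j) k) {1..n + 1}"
    using w1_mult by blast
  have nd: "n = n + 1 + 0 - 1" "d = d + 1 + -1" by auto
  have t: "pcomp P (n + 1) (d + 1) 0 (-1) i u k \<in> carr P n d"
    if "i \<in> {1..n + 1}" "u \<in> S (n + 1) (d + 1)" for i u
    using that by (intro pcomp_closed suboperadD(3)[OF S that(2)] k) auto
  have "x \<otimes>\<^bsub>cpt P n d\<^esub> y = finprod (cpt P n d) (\<lambda>j. pcomp P (n + 1) (d + 1) 0 (-1) j (z j) k \<otimes>\<^bsub>cpt P n d\<^esub>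
      pcomp P (n + 1) (d + 1) 0 (-1) j (z' j) k) {1..n + 1}"
    unfolding z(2) z'(2) using t z(1) z'(1) by (intro finprod_mult[symmetric]) auto
  also have "\<dots> = finprod (cpt P n d) (\<lambda>j. pcomp P (n + 1) (d + 1) 0 (-1) j
      (z j \<otimes>\<^bsub>cpt P (n + 1) (d + 1)\<^esub> z' j) k) {1..n + 1}"
  proof (rule finprod_eq)
    fix j assume j: "j \<in> {1..n + 1}"
    then show "pcomp P (n + 1) (d + 1) 0 (-1) j (z j) k \<otimes>\<^bsub>cpt P n d\<^esub> pcomp P (n + 1) (d + 1) 0 (-1) j (z' j) k =
      pcomp P (n + 1) (d + 1) 0 (-1) j (z j \<otimes>\<^bsub>cpt P (n + 1) (d + 1)\<^esub> z' j) k"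
      using z(1) z'(1) by (intro pcomp_mult_left[symmetric] suboperadD(3)[OF S] k nd) auto
    show "pcomp P (n + 1) (d + 1) 0 (-1) j (z j \<otimes>\<^bsub>cpt P (n + 1) (d + 1)\<^esub> z' j) k \<in> carr P n d"
      using t[OF j] z(1) z'(1) j subgroup.m_closed[OF suboperadD(1)[OF S]] by blast
  qed
  finally show ?case
    using z(1) z'(1) subgroup.m_closed[OF suboperadD(1)[OF S]]
    by (intro exI[of _ "\<lambda>j. z j \<otimes>\<^bsub>cpt P (n + 1) (d + 1)\<^esub> z' j"]) blast
next
  case (w1_inv n d x)
  interpret comm_group "cpt P n d" by simp
  obtain z where z: "\<forall>j\<in>{1..n + 1}. z j \<in> S (n + 1) (d + 1)"
    "x = finprod (cpt P n d) (\<lambda>j. pcomp P (n + 1) (d + 1) 0 (-1) j (z j) k) {1..n + 1}"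
    using w1_inv by blast
  have nd: "n = n + 1 + 0 - 1" "d = d + 1 + -1" by auto
  have t: "pcomp P (n + 1) (d + 1) 0 (-1) i u k \<in> carr P n d"
    if "i \<in> {1..n + 1}" "u \<in> S (n + 1) (d + 1)" for i u
    using that by (intro pcomp_closed suboperadD(3)[OF S that(2)] k) auto
  have "inv\<^bsub>cpt P n d\<^esub> x = finprod (cpt P n d) (\<lambda>j. inv\<^bsub>cpt P n d\<^esub> (pcomp P (n + 1) (d + 1) 0 (-1) j (z j) k)) {1..n + 1}"
    unfolding z(2) using t z(1) by (intro finprod_inverse[symmetric]) auto
  also have "\<dots> = finprod (cpt P n d) (\<lambda>j. pcomp P (n + 1) (d + 1) 0 (-1) j
      (inv\<^bsub>cpt P (n + 1) (d + 1)\<^esub> (z j)) k) {1..n + 1}"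
  proof (rule finprod_eq)
    fix j assume j: "j \<in> {1..n + 1}"
    then show "inv\<^bsub>cpt P n d\<^esub> (pcomp P (n + 1) (d + 1) 0 (-1) j (z j) k) =
      pcomp P (n + 1) (d + 1) 0 (-1) j (inv\<^bsub>cpt P (n + 1) (d + 1)\<^esub> (z j)) k"
      using z(1) by (intro pcomp_inv_left[symmetric] suboperadD(3)[OF S] k nd) auto
    show "pcomp P (n + 1) (d + 1) 0 (-1) j (inv\<^bsub>cpt P (n + 1) (d + 1)\<^esub> (z j)) k \<in> carr P n d"
      using t[OF j] z(1) j subgroup.m_inv_closed[OF suboperadD(1)[OF S]] by blast
  qed
  finally show ?case
    using z(1) subgroup.m_inv_closed[OF suboperadD(1)[OF S]]
    by (intro exI[of _ "\<lambda>j. inv\<^bsub>cpt P (n + 1) (d + 1)\<^esub> (z j)"]) blast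
qed simp

end

end

section \<open>Flat sequences and morphisms from the curved A-infinity operad\<close>

text \<open>
  The summands of \<open>mc_sum\<close> in which the inserted operation is not \<open>m 0\<close>. In arity \<open>n\<close> they involve the operations
  \<open>m 1, \<dots>, m n\<close> only, whereas the other summands involve \<open>m (n + 1)\<close> and \<open>m 0\<close>.\<close>

definition mc_head :: "('a, 'm) goperad_scheme \<Rightarrow> (nat \<Rightarrow> 'a) \<Rightarrow> nat \<Rightarrow> 'a" where
  "mc_head P m n = finprod (cpt P n (-2))
     (\<lambda>(p, q, r). pcomp P (p + 1 + r) (-1) q (-1) (p + 1) (m (p + 1 + r)) (m q)) {(p, q, r) \<in> triples n. q > 0}"

context graded_operad
begin

lemma mc_head_cong:
  assumes m': "\<And>n. m' n \<in> carr P n (-1)" and eq: "\<And>i. i \<le> n \<Longrightarrow> m i = m' i"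
  shows "mc_head P m n = mc_head P m' n"
  unfolding mc_head_def
proof (rule comm_group.finprod_eq[OF comm_group_cpt])
  fix t assume "t \<in> {(p, q, r) \<in> triples n. q > 0}"
  then obtain p q r where t: "t = (p, q, r)" "p + q + r = n" "q > 0" by (auto simp: triples_def)
  then have "p + 1 + r \<le> n" "q \<le> n" by auto
  then show "(case t of (p, q, r) \<Rightarrow> pcomp P (p + 1 + r) (-1) q (-1) (p + 1) (m (p + 1 + r)) (m q)) =
      (case t of (p, q, r) \<Rightarrow> pcomp P (p + 1 + r) (-1) q (-1) (p + 1) (m' (p + 1 + r)) (m' q))"
    unfolding t(1) prod.case by (simp only: eq)
  show "(case t of (p, q, r) \<Rightarrow> pcomp P (p + 1 + r) (-1) q (-1) (p + 1) (m' (p + 1 + r)) (m' q)) \<in> carr P n (-2)"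
    unfolding t(1) prod.case using t(2) by (intro mc_term_closed[of m', OF m'])
qed

lemma mc_sum_split:
  assumes m: "\<And>n. m n \<in> carr P n (-1)"
  shows "mc_sum P m n = mc_head P m n \<otimes>\<^bsub>cpt P n (-2)\<^esub>
    finprod (cpt P n (-2)) (\<lambda>i. pcomp P (n + 1) (-1) 0 (-1) i (m (n + 1)) (m 0)) {1..n + 1}"
proof -
  let ?H = "cpt P n (-2)"
  interpret comm_group ?H by simp
  let ?f = "\<lambda>(p, q, r). pcomp P (p + 1 + r) (-1) q (-1) (p + 1) (m (p + 1 + r)) (m q)"
  let ?I = "{(p, q, r) \<in> triples n. q > 0}" and ?J = "{(p, q, r) \<in> triples n. q = 0}"
  have f: "?f t \<in> carrier ?H" if "t \<in> triples n" for t
    using that by (auto simp: triples_def intro!: mc_term_closed[of m, OF m] simp del: One_nat_def)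
  have fin: "finite ?I" "finite ?J" by (auto intro: finite_subset[OF _ finite_triples[of n]])
  have "triples n = ?I \<union> ?J" by auto
  then have "mc_sum P m n = finprod ?H ?f (?I \<union> ?J)" by (simp add: mc_sum_def)
  also have "\<dots> = finprod ?H ?f ?I \<otimes>\<^bsub>?H\<^esub> finprod ?H ?f ?J"
    using f fin by (intro finprod_Un_disjoint) auto
  also have "finprod ?H ?f ?J = finprod ?H (\<lambda>i. ?f (i - 1, 0, n + 1 - i)) {1..n + 1}"
  proof (rule finprod_bij)
    show "bij_betw (\<lambda>i. (i - 1, 0, n + 1 - i)) {1..n + 1} ?J"
      by (rule bij_betw_byWitness[where f' = "\<lambda>(p, q, r). p + 1"]) (auto simp: triples_def)
  qed (use f in auto)
  also have "\<dots> = finprod ?H (\<lambda>i. pcomp P (n + 1) (-1) 0 (-1) i (m (n + 1)) (m 0)) {1..n + 1}"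
    by (intro finprod_eq) (auto intro!: pcomp_closed m)
  finally show ?thesis by (simp add: mc_head_def)
qed

lemma mc_head_in:
  assumes S: "suboperad S P" and m: "\<And>i. 1 \<le> i \<Longrightarrow> i \<le> n \<Longrightarrow> m i \<in> S i (-1)"
  shows "mc_head P m n \<in> S n (-2)"
  unfolding mc_head_def
proof (rule subgroup_finprod[OF comm_group_cpt suboperadD(1)[OF S]])
  fix t assume "t \<in> {(p, q, r) \<in> triples n. q > 0}"
  then obtain p q r where t: "t = (p, q, r)" "p + q + r = n" "q > 0" by (auto simp: triples_def)
  show "(case t of (p, q, r) \<Rightarrow> pcomp P (p + 1 + r) (-1) q (-1) (p + 1) (m (p + 1 + r)) (m q)) \<in> S n (-2)"
    unfolding t(1) prod.case using t(2,3) by (intro suboperadD(2)[OF S] m) auto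
qed

end

lemma operad_hom_mc_sum:
  assumes P: "graded_operad P" and R: "graded_operad R" and f: "operad_hom P R f"
    and m: "\<And>n. m n \<in> carr P n (-1)"
  shows "f n (-2) (mc_sum P m n) = mc_sum R (\<lambda>i. f i (-1) (m i)) n"
proof -
  interpret P: graded_operad P by fact
  interpret R: graded_operad R by fact
  interpret H: comm_group "cpt R n (-2)" by simp
  let ?t = "\<lambda>(p, q, r). pcomp P (p + 1 + r) (-1) q (-1) (p + 1) (m (p + 1 + r)) (m q)"
  have "f n (-2) (mc_sum P m n) = finprod (cpt R n (-2)) (\<lambda>t. f n (-2) (?t t)) (triples n)"
    unfolding mc_sum_def
    by (rule hom_finprod[OF operad_homD(1)[OF f]])
      (auto simp: triples_def intro!: P.mc_term_closed[of m, OF m] simp del: One_nat_def)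
  also have "\<dots> = mc_sum R (\<lambda>i. f i (-1) (m i)) n"
    unfolding mc_sum_def
  proof (rule H.finprod_eq)
    fix t assume "t \<in> triples n"
    then obtain p q r where t: "t = (p, q, r)" "p + q + r = n" by (auto simp: triples_def)
    show "f n (-2) (?t t) = (case t of (p, q, r) \<Rightarrow> pcomp R (p + 1 + r) (-1) q (-1) (p + 1)
        (f (p + 1 + r) (-1) (m (p + 1 + r))) (f q (-1) (m q)))"
      unfolding t(1) prod.case using t(2) by (intro operad_homD(2)[OF f] m) auto
    show "(case t of (p, q, r) \<Rightarrow> pcomp R (p + 1 + r) (-1) q (-1) (p + 1)
        (f (p + 1 + r) (-1) (m (p + 1 + r))) (f q (-1) (m q))) \<in> carr R n (-2)"
      unfolding t(1) prod.case using t(2)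
      by (intro R.mc_term_closed[of "\<lambda>i. f i (-1) (m i)"] operad_homD(3)[OF f] m)
  qed
  finally show ?thesis .
qed

context curv_object
begin

sublocale kappa_presentation Q "base Q" "kappa Q"
  by unfold_locales (rule base_suboperad kappa_in base_kappa_iso)+

lemma derivation_odiff: "derivation Q (odiff Q)"
  unfolding derivation_def leibniz_def using odiff_hom odiff_pcomp by blast

lemma odiff_low_weights:
  obtains D0 D1 where
    "\<And>n d x. x \<in> carr Q n d \<Longrightarrow> odiff Q n d x = D0 n d x \<otimes>\<^bsub>cpt Q n (d - 1)\<^esub> D1 n d x"
    "\<And>n d x. x \<in> base Q n d \<Longrightarrow> D0 n d x \<in> base Q n (d - 1)"
    "\<And>n d x. x \<in> base Q n d \<Longrightarrow> weight_one (base Q) (kappa Q) n (d - 1) (D1 n d x)"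
    "weight_one (base Q) (kappa Q) 0 (-2) (D0 0 (-1) (kappa Q))"
    "D1 0 (-1) (kappa Q) = \<one>\<^bsub>cpt Q 0 (-2)\<^esub>"
proof -
  obtain D where D: "diff_decomp Q D"
    and triv: "\<And>w n d x. x \<in> carr Q n d \<Longrightarrow> w \<notin> {0, 1} \<Longrightarrow> D w n d x = \<one>\<^bsub>cpt Q n (d - 1)\<^esub>"
    and kap: "D 1 0 (-1) (kappa Q) = \<one>\<^bsub>cpt Q 0 (-2)\<^esub>"
    using diff_weights by blast
  have hom: "D w n d \<in> hom (cpt Q n d) (cpt Q n (d - 1))" for w n d
    using D by (simp add: diff_decomp_def)
  have raise: "weight_part Q (base Q) (kappa Q) (v + w) n (d - 1) (D w n d x)"
    if "weight_part Q (base Q) (kappa Q) v n d x" for w v n d x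
    using D that by (simp add: diff_decomp_def)
  note low = low_weights[OF base_suboperad kappa_in]
  show thesis
  proof (rule that[of "D 0" "D 1"])
    fix n d x
    show "odiff Q n d x = D 0 n d x \<otimes>\<^bsub>cpt Q n (d - 1)\<^esub> D 1 n d x" if x: "x \<in> carr Q n d"
    proof -
      let ?H = "cpt Q n (d - 1)" and ?I = "{w. D w n d x \<noteq> \<one>\<^bsub>cpt Q n (d - 1)\<^esub>}"
      interpret H: comm_group ?H by simp
      have c: "D w n d x \<in> carrier ?H" for w using hom_in_carrier[OF hom x] .
      have sub: "?I \<subseteq> {0, 1}" using triv[OF x] by blast
      have "odiff Q n d x = finprod ?H (\<lambda>w. D w n d x) ?I"
        using D x unfolding diff_decomp_def by blast
      also have "\<dots> = finprod ?H (\<lambda>w. D w n d x) {0, 1}"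
        using sub c by (intro H.finprod_mono_neutral_cong_left) auto
      also have "\<dots> = D 0 n d x \<otimes>\<^bsub>?H\<^esub> D 1 n d x"
        using c by (simp add: H.finprod_insert)
      finally show ?thesis .
    qed
    assume x: "x \<in> base Q n d"
    have "weight_part Q (base Q) (kappa Q) 0 n d x" by (rule wp_base) (rule x)
    from raise[OF this, of 0] raise[OF this, of 1]
    show "D 0 n d x \<in> base Q n (d - 1)" "weight_one (base Q) (kappa Q) n (d - 1) (D 1 n d x)"
      using low by auto
  next
    have "weight_part Q (base Q) (kappa Q) 1 0 (-1) (kappa Q)" by (rule wp_kappa)
    from raise[OF this, of 0] show "weight_one (base Q) (kappa Q) 0 (-2) (D 0 0 (-1) (kappa Q))"
      using low by auto
  qed (rule kap)
qed

text \<open>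
  The components of weight zero and one of the differential; the excluded case is the one in which
  the component of weight one could contain a multiple of \<open>\<kappa>\<close> itself.\<close>

lemma odiff_base:
  assumes x: "x \<in> base Q n d" and nd: "\<not> (n = 0 \<and> d = 0)"
  obtains y z where "y \<in> base Q n (d - 1)" "\<And>j. j \<in> {1..n + 1} \<Longrightarrow> z j \<in> base Q (n + 1) d"
    "odiff Q n d x = y \<otimes>\<^bsub>cpt Q n (d - 1)\<^esub>
      finprod (cpt Q n (d - 1)) (\<lambda>j. pcomp Q (n + 1) d 0 (-1) j (z j) (kappa Q)) {1..n + 1}"
proof (rule odiff_low_weights)
  fix D0 D1
  assume D: "\<And>n d x. x \<in> carr Q n d \<Longrightarrow> odiff Q n d x = D0 n d x \<otimes>\<^bsub>cpt Q n (d - 1)\<^esub> D1 n d x"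
    and D0: "\<And>n d x. x \<in> base Q n d \<Longrightarrow> D0 n d x \<in> base Q n (d - 1)"
    and D1: "\<And>n d x. x \<in> base Q n d \<Longrightarrow> weight_one (base Q) (kappa Q) n (d - 1) (D1 n d x)"
  have "\<not> (n = 0 \<and> d - 1 = -1)" using nd by auto
  from weight_one_expand[OF base_suboperad kappa_in D1[OF x] this]
  obtain z where "\<forall>j\<in>{1..n + 1}. z j \<in> base Q (n + 1) d"
    "D1 n d x = finprod (cpt Q n (d - 1)) (\<lambda>j. pcomp Q (n + 1) d 0 (-1) j (z j) (kappa Q)) {1..n + 1}"
    by auto
  then show thesis using that[OF D0[OF x], of z] D[OF S_carr[OF x]] by simp
qed

text \<open>
  Because the component \<open>d\<^sub>1 \<kappa>\<close> of weight two vanishes, \<open>d \<kappa>\<close> has weight one. Its degree is \<open>-2\<close>, so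
  it contains no multiple of \<open>\<kappa>\<close> itself.\<close>

lemma odiff_kappa:
  obtains y where "y \<in> base Q 1 (-1)" "odiff Q 0 (-1) (kappa Q) = pcomp Q 1 (-1) 0 (-1) 1 y (kappa Q)"
proof (rule odiff_low_weights)
  fix D0 D1
  assume D: "\<And>n d x. x \<in> carr Q n d \<Longrightarrow> odiff Q n d x = D0 n d x \<otimes>\<^bsub>cpt Q n (d - 1)\<^esub> D1 n d x"
    and D0: "weight_one (base Q) (kappa Q) 0 (-2) (D0 0 (-1) (kappa Q))"
    and D1: "D1 0 (-1) (kappa Q) = \<one>\<^bsub>cpt Q 0 (-2)\<^esub>"
  interpret comm_group "cpt Q 0 (-2)" by simp
  have "odiff Q 0 (-1) (kappa Q) = D0 0 (-1) (kappa Q)"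
    using D[OF kappa_in] D1 weight_one_carr[OF base_suboperad kappa_in D0] by simp
  moreover obtain z where z: "\<forall>j\<in>{1..0 + 1}. z j \<in> base Q (0 + 1) (-2 + 1)"
    "D0 0 (-1) (kappa Q) = finprod (cpt Q 0 (-2)) (\<lambda>j. pcomp Q (0 + 1) (-2 + 1) 0 (-1) j (z j) (kappa Q)) {1..0 + 1}"
    using weight_one_expand[OF base_suboperad kappa_in D0] by auto
  have z1: "z 1 \<in> base Q 1 (-1)" using z(1) by simp
  have "pcomp Q 1 (-1) 0 (-1) 1 (z 1) (kappa Q) \<in> carr Q 0 (-2)"
    by (rule pcomp_closed[OF _ _ S_carr[OF z1] kappa_in]) auto
  then have "D0 0 (-1) (kappa Q) = pcomp Q 1 (-1) 0 (-1) 1 (z 1) (kappa Q)"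
    using z(2) by (simp add: finprod_insert)
  ultimately show thesis using that[OF z1] by simp
qed

text \<open>
  The sequences that are to be the images of the generators \<open>\<mu>\<^sub>n\<close>.\<close>

definition curved_structure :: "(nat \<Rightarrow> 'a) \<Rightarrow> bool" where
  "curved_structure m \<longleftrightarrow> m 0 = kappa Q \<and> (\<forall>n>0. m n \<in> base Q n (-1)) \<and>
     (\<forall>n. curvature Q (odiff Q) m n = \<one>\<^bsub>cpt Q n (-2)\<^esub>)"

lemma curvature_eq:
  assumes m: "\<And>n. m n \<in> carr Q n (-1)"
  shows "curvature Q (odiff Q) m n = (odiff Q n (-1) (m n) \<otimes>\<^bsub>cpt Q n (-2)\<^esub> mc_head Q m n) \<otimes>\<^bsub>cpt Q n (-2)\<^esub>
    finprod (cpt Q n (-2)) (\<lambda>i. pcomp Q (n + 1) (-1) 0 (-1) i (m (n + 1)) (m 0)) {1..n + 1}"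
proof -
  interpret comm_group "cpt Q n (-2)" by simp
  have "odiff Q n (-1) (m n) \<in> carr Q n (-2)" using derivationD(3)[OF derivation_odiff m, of n] by simp
  moreover have "mc_head Q m n \<in> carr Q n (-2)" by (rule mc_head_in[OF suboperad_carr m])
  moreover have "finprod (cpt Q n (-2)) (\<lambda>i. pcomp Q (n + 1) (-1) 0 (-1) i (m (n + 1)) (m 0)) {1..n + 1} \<in> carr Q n (-2)"
    by (intro finprod_in_carrier pcomp_closed m) auto
  ultimately show ?thesis unfolding curvature_def mc_sum_split[of m, OF m] by (simp add: m_assoc)
qed

lemma curvature_cong:
  assumes "\<And>n. m n \<in> carr Q n (-1)" "\<And>n. m' n \<in> carr Q n (-1)" "\<And>i. i \<le> n + 1 \<Longrightarrow> m i = m' i"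
  shows "curvature Q (odiff Q) m n = curvature Q (odiff Q) m' n"
proof -
  have "mc_head Q m n = mc_head Q m' n" by (rule mc_head_cong[OF assms(2)]) (simp add: assms(3))
  then show ?thesis
    unfolding curvature_eq[of m, OF assms(1)] curvature_eq[of m', OF assms(2)] by (simp add: assms(3))
qed

lemma curved_structure_carr: "curved_structure m \<Longrightarrow> m n \<in> carr Q n (-1)"
  unfolding curved_structure_def using kappa_in S_carr by (cases "n = 0") auto

text \<open>
  If two such sequences agree up to \<open>p\<close>, then the vanishing of their curvatures in arity \<open>p\<close> shows that
  the difference \<open>x\<close> of their members of arity \<open>p + 1\<close> satisfies \<open>\<Sum>\<^sub>i x \<circ>\<^sub>i \<kappa> = 0\<close>, whence
  \<open>x = 0\<close> by independence.\<close>

lemma curved_structure_unique: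
  assumes m: "curved_structure m" and m': "curved_structure m'"
  shows "m n = m' n"
proof (induction n rule: less_induct)
  case (less n)
  show ?case
  proof (cases n)
    case 0 then show ?thesis using m m' by (simp add: curved_structure_def)
  next
    case (Suc p)
    have n: "n = p + 1" using Suc by simp
    have eq: "m i = m' i" if "i \<le> p" for i using less that n by simp
    let ?H = "cpt Q p (-2)"
    interpret H: comm_group ?H by simp
    interpret B: comm_group "cpt Q n (-1)" by simp
    let ?T = "\<lambda>x. finprod ?H (\<lambda>i. pcomp Q n (-1) 0 (-1) i x (kappa Q)) {1..n}"
    let ?c = "odiff Q p (-1) (m p) \<otimes>\<^bsub>?H\<^esub> mc_head Q m p"
    note mc = curved_structure_carr[OF m] and mc' = curved_structure_carr[OF m']
    have k: "m 0 = kappa Q" "m' 0 = kappa Q" using m m' by (auto simp: curved_structure_def)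
    have t: "pcomp Q n (-1) 0 (-1) i x (kappa Q) \<in> carr Q p (-2)" if "i \<in> {1..n}" "x \<in> carr Q n (-1)" for i x
      using that n by (intro pcomp_closed that(2) kappa_in) auto
    have T: "?T x \<in> carr Q p (-2)" if "x \<in> carr Q n (-1)" for x
      using t that by (intro H.finprod_in_carrier)
    have c: "?c \<in> carr Q p (-2)"
      using derivationD(3)[OF derivation_odiff mc, of p] mc_head_in[OF suboperad_carr mc] by (simp add: mult_closed)
    have "mc_head Q m' p = mc_head Q m p" by (rule mc_head_cong[OF mc]) (simp add: eq)
    then have "?c \<otimes>\<^bsub>?H\<^esub> ?T (m n) = \<one>\<^bsub>?H\<^esub>" "?c \<otimes>\<^bsub>?H\<^esub> ?T (m' n) = \<one>\<^bsub>?H\<^esub>"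
      using m m' curvature_eq[of m p, OF mc] curvature_eq[of m' p, OF mc'] eq[of p] k
      by (simp_all add: curved_structure_def n)
    then have "?T (m n) \<otimes>\<^bsub>?H\<^esub> ?c = \<one>\<^bsub>?H\<^esub>" "?T (m' n) \<otimes>\<^bsub>?H\<^esub> ?c = \<one>\<^bsub>?H\<^esub>"
      using H.m_comm[OF c T[OF mc]] H.m_comm[OF c T[OF mc']] by simp_all
    from H.inv_equality[OF this(1) c T[OF mc]] H.inv_equality[OF this(2) c T[OF mc']]
    have TT: "?T (m n) = ?T (m' n)" by simp
    have b: "m n \<in> base Q n (-1)" "m' n \<in> base Q n (-1)" using m m' n by (auto simp: curved_structure_def)
    let ?x = "m n \<otimes>\<^bsub>cpt Q n (-1)\<^esub> inv\<^bsub>cpt Q n (-1)\<^esub> (m' n)"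
    have x: "?x \<in> base Q n (-1)"
      using b subgroup.m_closed[OF suboperadD(1)[OF S]] subgroup.m_inv_closed[OF suboperadD(1)[OF S]] by blast
    let ?z = "\<one>\<^bsub>cpt Q (n + 1) (-1 + 1)\<^esub>"
    have z1: "pcomp Q (n + 1) (-1 + 1) 0 (-1) j ?z (kappa Q) = \<one>\<^bsub>cpt Q n (-1)\<^esub>" if "j \<in> {1..n + 1}" for j
      using that by (intro pcomp_one_left kappa_in) auto
    have P1: "finprod (cpt Q n (-1)) (\<lambda>j. pcomp Q (n + 1) (-1 + 1) 0 (-1) j ?z (kappa Q)) {1..n + 1} = \<one>\<^bsub>cpt Q n (-1)\<^esub>"
      using z1 by (rule B.finprod_one_eqI)
    have "?T ?x = ?T (m n) \<otimes>\<^bsub>?H\<^esub> inv\<^bsub>?H\<^esub> (?T (m' n))"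
    proof -
      have "pcomp Q n (-1) 0 (-1) i ?x (kappa Q) = pcomp Q n (-1) 0 (-1) i (m n) (kappa Q) \<otimes>\<^bsub>?H\<^esub>
          inv\<^bsub>?H\<^esub> (pcomp Q n (-1) 0 (-1) i (m' n) (kappa Q))" if i: "i \<in> {1..n}" for i
      proof -
        have i': "1 \<le> i" "i \<le> n" and p: "p = n + 0 - 1" "(-2 :: int) = -1 + -1" using i n by auto
        show ?thesis
          unfolding pcomp_mult_left[OF i' mc inv_in_carr[OF mc'] kappa_in p]
            pcomp_inv_left[OF i' mc' kappa_in p] ..
      qed
      then have "?T ?x = finprod ?H (\<lambda>i. pcomp Q n (-1) 0 (-1) i (m n) (kappa Q) \<otimes>\<^bsub>?H\<^esub>
          inv\<^bsub>?H\<^esub> (pcomp Q n (-1) 0 (-1) i (m' n) (kappa Q))) {1..n}"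
        using t[OF _ mc] t[OF _ mc'] by (intro H.finprod_eq) (auto intro!: H.m_closed)
      also have "\<dots> = ?T (m n) \<otimes>\<^bsub>?H\<^esub> finprod ?H (\<lambda>i. inv\<^bsub>?H\<^esub> (pcomp Q n (-1) 0 (-1) i (m' n) (kappa Q))) {1..n}"
        using t[OF _ mc] t[OF _ mc'] by (intro H.finprod_mult) auto
      also have "finprod ?H (\<lambda>i. inv\<^bsub>?H\<^esub> (pcomp Q n (-1) 0 (-1) i (m' n) (kappa Q))) {1..n} = inv\<^bsub>?H\<^esub> (?T (m' n))"
        using t[OF _ mc'] by (intro H.finprod_inverse) auto
      finally show ?thesis .
    qed
    also have "\<dots> = \<one>\<^bsub>?H\<^esub>" using TT T[OF mc'] by simp
    finally have "?T ?x = \<one>\<^bsub>?H\<^esub>" .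
    moreover have "?x \<otimes>\<^bsub>cpt Q n (-1)\<^esub> \<one>\<^bsub>cpt Q n (-1)\<^esub> = ?x" using S_carr[OF x] by simp
    ultimately have "finprod (cpt Q (n - 1) (-1 - 1)) (\<lambda>i. pcomp Q n (-1) 0 (-1) i
        (?x \<otimes>\<^bsub>cpt Q n (-1)\<^esub> finprod (cpt Q n (-1)) (\<lambda>j. pcomp Q (n + 1) (-1 + 1) 0 (-1) j ?z (kappa Q)) {1..n + 1})
        (kappa Q)) {1..n} = \<one>\<^bsub>cpt Q (n - 1) (-1 - 1)\<^esub>"
      unfolding P1 by (simp add: n)
    then have "?x = \<one>\<^bsub>cpt Q n (-1)\<^esub>"
      using kappa_insertions_independent(1)[OF _ x, of "\<lambda>j. ?z"] subgroup.one_closed[OF suboperadD(1)[OF S]] n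
      by auto
    from B.inv_equality[OF this] show ?thesis using mc[of n] mc'[of n] by simp
  qed
qed

text \<open>
  An initial segment of such a sequence, continued by zero. The curvature in arity \<open>i\<close> involves
  the operations up to arity \<open>i + 1\<close>, so that operations up to arity \<open>n + 1\<close> can be required to have no
  curvature up to arity \<open>n\<close>.\<close>

definition partial_structure :: "nat \<Rightarrow> (nat \<Rightarrow> 'a) \<Rightarrow> bool" where
  "partial_structure n m \<longleftrightarrow> m 0 = kappa Q \<and> (\<forall>i. 1 \<le> i \<longrightarrow> i \<le> n + 1 \<longrightarrow> m i \<in> base Q i (-1)) \<and>
     (\<forall>i>n + 1. m i = \<one>\<^bsub>cpt Q i (-1)\<^esub>) \<and> (\<forall>i\<le>n. curvature Q (odiff Q) m i = \<one>\<^bsub>cpt Q i (-2)\<^esub>)"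

lemma partial_structure_base: "partial_structure n m \<Longrightarrow> i > 0 \<Longrightarrow> m i \<in> base Q i (-1)"
  using subgroup.one_closed[OF suboperadD(1)[OF S]] unfolding partial_structure_def by (cases "i \<le> n + 1") auto

lemma partial_structure_carr: "partial_structure n m \<Longrightarrow> m i \<in> carr Q i (-1)"
  using partial_structure_base[of n m i] S_carr kappa_in unfolding partial_structure_def by (cases "i = 0") auto

lemma partial_structure_0: "\<exists>m. partial_structure 0 m"
proof (rule odiff_kappa)
  fix y assume y: "y \<in> base Q 1 (-1)" and dk: "odiff Q 0 (-1) (kappa Q) = pcomp Q 1 (-1) 0 (-1) 1 y (kappa Q)"
  let ?m = "\<lambda>i. if i = 0 then kappa Q else if i = 1 then inv\<^bsub>cpt Q 1 (-1)\<^esub> y else \<one>\<^bsub>cpt Q i (-1)\<^esub>"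
  let ?H = "cpt Q 0 (-2)"
  interpret H: comm_group ?H by simp
  have yk: "pcomp Q 1 (-1) 0 (-1) 1 y (kappa Q) \<in> carr Q 0 (-2)"
    by (rule pcomp_closed[OF _ _ S_carr[OF y] kappa_in]) auto
  have iy: "pcomp Q 1 (-1) 0 (-1) 1 (inv\<^bsub>cpt Q 1 (-1)\<^esub> y) (kappa Q) = inv\<^bsub>?H\<^esub> (pcomp Q 1 (-1) 0 (-1) 1 y (kappa Q))"
    by (rule pcomp_inv_left[OF _ _ S_carr[OF y] kappa_in]) auto
  have "triples 0 = {(0, 0, 0)}" by (auto simp: triples_def)
  then have "mc_sum Q ?m 0 = inv\<^bsub>?H\<^esub> (pcomp Q 1 (-1) 0 (-1) 1 y (kappa Q))"
    unfolding mc_sum_def using yk iy by (simp add: H.finprod_insert)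
  then have "curvature Q (odiff Q) ?m 0 = \<one>\<^bsub>?H\<^esub>"
    using yk dk by (simp add: curvature_def)
  moreover have "inv\<^bsub>cpt Q 1 (-1)\<^esub> y \<in> base Q 1 (-1)"
    using subgroup.m_inv_closed[OF suboperadD(1)[OF S] y] .
  ultimately have "partial_structure 0 ?m" by (auto simp: partial_structure_def)
  then show ?thesis by blast
qed

text \<open>
  The inductive step of the construction. Under the Bianchi identity in arity \<open>n\<close> only the
  curvature in arity \<open>n + 1\<close> survives, composed with \<open>\<kappa>\<close>; independence then gives it the form
  \<open>\<Sum>\<^sub>j z \<circ>\<^sub>j \<kappa>\<close>, and \<open>- z\<close> is the next operation.\<close>

lemma partial_structure_Suc:
  assumes m: "partial_structure n m"
  shows "\<exists>m'. partial_structure (Suc n) m' \<and> (\<forall>i\<le>n + 1. m' i = m i)"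
proof -
  let ?N = "n + 1"
  let ?H = "cpt Q ?N (-2)" and ?G = "cpt Q n (-3)" and ?B = "cpt Q (n + 2) (-1)"
  interpret H: comm_group ?H by simp
  interpret G: comm_group ?G by simp
  note base = partial_structure_base[OF m] and carr = partial_structure_carr[OF m]
  have k: "m 0 = kappa Q" using m by (simp add: partial_structure_def)
  have flat: "curvature Q (odiff Q) m i = \<one>\<^bsub>cpt Q i (-2)\<^esub>" if "i \<le> n" for i
    using m that by (simp add: partial_structure_def)
  have top: "m (n + 2) = \<one>\<^bsub>?B\<^esub>" using m by (simp add: partial_structure_def)
  note D = derivation_odiff
  have Dm: "odiff Q i (-1) (m i) \<in> carr Q i (-2)" for i
    using derivationD(3)[OF D carr, of i] by simp
  have curv: "curvature Q (odiff Q) m i \<in> carr Q i (-2)" for i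
    unfolding curvature_def by (intro mult_closed Dm mc_sum_closed carr)

  \<comment> \<open>The summands with \<open>q > 0\<close>, and the whole second sum of the identity, only contain curvatures in arities up to \<open>n\<close>.\<close>
  have insert_zero: "finprod ?G (\<lambda>i. pcomp Q ?N (-2) 0 (-1) i (curvature Q (odiff Q) m ?N) (kappa Q)) {1..?N} = \<one>\<^bsub>?G\<^esub>"
  proof -
    let ?L = "\<lambda>(p, q, r). pcomp Q (p + 1 + r) (-2) q (-1) (p + 1) (curvature Q (odiff Q) m (p + 1 + r)) (m q)"
    let ?R = "\<lambda>(p, q, r). pcomp Q (p + 1 + r) (-1) q (-2) (p + 1) (m (p + 1 + r)) (curvature Q (odiff Q) m q)"
    have L: "?L t \<in> carrier ?G" if "t \<in> triples n" for t
      using that by (auto simp: triples_def intro!: pcomp_closed curv carr simp del: One_nat_def)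
    have R1: "?R t = \<one>\<^bsub>?G\<^esub>" if mem: "t \<in> triples n" for t
    proof -
      obtain p q r where t: "t = (p, q, r)" "p + q + r = n" using mem by (auto simp: triples_def)
      have "q \<le> n" using t(2) by simp
      show ?thesis unfolding t(1) prod.case flat[OF \<open>q \<le> n\<close>]
        using t(2) by (intro pcomp_one_right carr) auto
    qed
    have L1: "?L t = \<one>\<^bsub>?G\<^esub>" if t: "t \<in> triples n" "t \<notin> {(p, q, r). q = 0}" for t
    proof -
      obtain p q r where t: "t = (p, q, r)" "p + q + r = n" "q > 0" using t by (auto simp: triples_def)
      have "p + 1 + r \<le> n" using t(2,3) by simp
      show ?thesis unfolding t(1) prod.case flat[OF \<open>p + 1 + r \<le> n\<close>]
        using t(2) by (intro pcomp_one_left carr) auto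
    qed
    have "odiff Q n (-2) (mc_sum Q m n) = \<one>\<^bsub>?G\<^esub>"
    proof -
      interpret K: comm_group "cpt Q n (-2)" by simp
      note s = mc_sum_closed[of m, OF carr, of n]
      have "odiff Q n (-1) (m n) \<otimes>\<^bsub>cpt Q n (-2)\<^esub> mc_sum Q m n = \<one>\<^bsub>cpt Q n (-2)\<^esub>"
        using flat[of n] by (simp add: curvature_def)
      then have "inv\<^bsub>cpt Q n (-2)\<^esub> (odiff Q n (-1) (m n)) = mc_sum Q m n"
        using Dm s K.inv_equality K.m_comm by metis
      moreover have "odiff Q n (-2) (odiff Q n (-1) (m n)) = \<one>\<^bsub>?G\<^esub>"
        using odiff_odiff[OF carr, of n] by simp
      moreover have "odiff Q n (-2) \<in> hom (cpt Q n (-2)) ?G"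
        using derivationD(1)[OF D, of n "-2"] by simp
      ultimately show ?thesis
        using hom_inv[of "odiff Q n (-2)" "cpt Q n (-2)" ?G, OF _ _ _ Dm] by simp
    qed
    then have "finprod ?G ?L (triples n) \<otimes>\<^bsub>?G\<^esub> inv\<^bsub>?G\<^esub> (finprod ?G ?R (triples n)) = \<one>\<^bsub>?G\<^esub>"
      using bianchi[OF D carr, of n] by simp
    moreover have "finprod ?G ?R (triples n) = \<one>\<^bsub>?G\<^esub>" using R1 by (rule G.finprod_one_eqI)
    moreover have "finprod ?G ?L (triples n) \<in> carrier ?G" using L by (rule G.finprod_in_carrier)
    ultimately have "finprod ?G ?L (triples n) = \<one>\<^bsub>?G\<^esub>" by simp
    moreover have "finprod ?G ?L (triples n) = finprod ?G ?L (triples n \<inter> {(p, q, r). q = 0})"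
      using L L1 by (intro G.finprod_mono_neutral_cong_right) auto
    moreover have "finprod ?G ?L (triples n \<inter> {(p, q, r). q = 0}) = finprod ?G (\<lambda>i. ?L (i - 1, 0, ?N - i)) {1..?N}"
    proof (rule G.finprod_bij)
      show "bij_betw (\<lambda>i. (i - 1, 0, ?N - i)) {1..?N} (triples n \<inter> {(p, q, r). q = 0})"
        by (rule bij_betw_byWitness[where f' = "\<lambda>(p, q, r). p + 1"]) (auto simp: triples_def)
    qed (use L in auto)
    moreover have "finprod ?G (\<lambda>i. ?L (i - 1, 0, ?N - i)) {1..?N} =
        finprod ?G (\<lambda>i. pcomp Q ?N (-2) 0 (-1) i (curvature Q (odiff Q) m ?N) (kappa Q)) {1..?N}"
    proof (rule G.finprod_eq)
      fix i assume i: "i \<in> {1..?N}"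
      then have "i - 1 + 1 + (?N - i) = ?N" "i - 1 + 1 = i" by auto
      then show "?L (i - 1, 0, ?N - i) = pcomp Q ?N (-2) 0 (-1) i (curvature Q (odiff Q) m ?N) (kappa Q)"
        unfolding prod.case k by simp
      show "pcomp Q ?N (-2) 0 (-1) i (curvature Q (odiff Q) m ?N) (kappa Q) \<in> carrier ?G"
        using i by (intro pcomp_closed curv kappa_in) auto
    qed
    ultimately show ?thesis by simp
  qed

  have mN: "m ?N \<in> base Q ?N (-1)" by (rule base) simp
  obtain y z where y: "y \<in> base Q ?N (-2)" and z: "\<And>j. j \<in> {1..?N + 1} \<Longrightarrow> z j \<in> base Q (?N + 1) (-1)"
    and dm: "odiff Q ?N (-1) (m ?N) = y \<otimes>\<^bsub>?H\<^esub>
      finprod ?H (\<lambda>j. pcomp Q (?N + 1) (-1) 0 (-1) j (z j) (kappa Q)) {1..?N + 1}"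
    using odiff_base[OF mN] by auto
  let ?Z = "\<lambda>z. finprod ?H (\<lambda>j. pcomp Q (?N + 1) (-1) 0 (-1) j (z j) (kappa Q)) {1..?N + 1}"
  have zk: "pcomp Q (?N + 1) (-1) 0 (-1) j u (kappa Q) \<in> carr Q ?N (-2)"
    if "j \<in> {1..?N + 1}" "u \<in> base Q (?N + 1) (-1)" for j u
    using that by (intro pcomp_closed S_carr[OF that(2)] kappa_in) auto
  have Z: "?Z w \<in> carr Q ?N (-2)" if "\<And>j. j \<in> {1..?N + 1} \<Longrightarrow> w j \<in> base Q (?N + 1) (-1)" for w
    using zk that by (intro H.finprod_in_carrier) auto
  have Zc: "?Z z \<in> carr Q ?N (-2)" by (rule Z) (rule z)
  have head: "mc_head Q m ?N \<in> base Q ?N (-2)"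
    by (rule mc_head_in[OF S]) (auto intro: base)
  note yc = S_carr[OF y] and hc = S_carr[OF head]

  have tail: "finprod ?H (\<lambda>i. pcomp Q (?N + 1) (-1) 0 (-1) i (m (?N + 1)) (m 0)) {1..?N + 1} = \<one>\<^bsub>?H\<^esub>"
  proof (rule H.finprod_one_eqI)
    fix i assume i: "i \<in> {1..?N + 1}"
    have t: "m (?N + 1) = \<one>\<^bsub>cpt Q (?N + 1) (-1)\<^esub>" using top by simp
    show "pcomp Q (?N + 1) (-1) 0 (-1) i (m (?N + 1)) (m 0) = \<one>\<^bsub>?H\<^esub>"
      unfolding t k using i by (intro pcomp_one_left kappa_in) auto
  qed
  have swap: "(u \<otimes>\<^bsub>?H\<^esub> v) \<otimes>\<^bsub>?H\<^esub> w = (u \<otimes>\<^bsub>?H\<^esub> w) \<otimes>\<^bsub>?H\<^esub> v"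
    if "u \<in> carrier ?H" "v \<in> carrier ?H" "w \<in> carrier ?H" for u v w
    unfolding H.m_assoc[OF that] H.m_assoc[OF that(1,3,2)] H.m_comm[OF that(2,3)] ..
  \<comment> \<open>The part of weight zero of the curvature in arity \<open>n + 1\<close>.\<close>
  let ?x = "y \<otimes>\<^bsub>?H\<^esub> mc_head Q m ?N"
  have x: "?x \<in> base Q ?N (-2)" by (rule subgroup.m_closed[OF suboperadD(1)[OF S] y head])
  have "curvature Q (odiff Q) m ?N = ?x \<otimes>\<^bsub>?H\<^esub> ?Z z"
    unfolding curvature_eq[of m, OF carr] tail dm swap[OF yc Zc hc]
    using yc hc Zc by (intro H.r_one H.m_closed)
  then have "finprod (cpt Q (?N - 1) (-2 - 1)) (\<lambda>i. pcomp Q ?N (-2) 0 (-1) i (?x \<otimes>\<^bsub>?H\<^esub>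
      finprod ?H (\<lambda>j. pcomp Q (?N + 1) (-2 + 1) 0 (-1) j (z j) (kappa Q)) {1..?N + 1}) (kappa Q)) {1..?N} =
      \<one>\<^bsub>cpt Q (?N - 1) (-2 - 1)\<^esub>"
    using insert_zero by simp
  note indep = kappa_insertions_independent[OF _ x _ this]
  have x1: "?x = \<one>\<^bsub>?H\<^esub>" by (rule indep(1)) (use z in auto)
  have z1: "z j = z 1" if "j \<in> {1..?N + 1}" for j by (rule indep(2)) (use z that in auto)
  have zb: "z 1 \<in> base Q (?N + 1) (-1)" by (rule z) simp

  \<comment> \<open>All \<open>z j\<close> are equal, so the curvature is cancelled by the new summands \<open>?u \<circ>\<^sub>j \<kappa>\<close>.\<close>
  let ?u = "inv\<^bsub>cpt Q (?N + 1) (-1)\<^esub> (z 1)"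
  define m' where "m' = m(n + 2 := ?u)"
  have ub: "?u \<in> base Q (?N + 1) (-1)" by (rule subgroup.m_inv_closed[OF suboperadD(1)[OF S] zb])
  have old: "m' i = m i" if "i \<le> n + 1" for i using that by (simp add: m'_def)
  have m'_carr: "m' i \<in> carr Q i (-1)" for i
    using carr[of i] S_carr[OF ub] by (simp add: m'_def)
  have head': "mc_head Q m' ?N = mc_head Q m ?N" by (rule mc_head_cong[OF carr]) (simp add: old)
  have tail': "finprod ?H (\<lambda>i. pcomp Q (?N + 1) (-1) 0 (-1) i (m' (?N + 1)) (m' 0)) {1..?N + 1} = inv\<^bsub>?H\<^esub> (?Z z)"
  proof -
    have "finprod ?H (\<lambda>i. pcomp Q (?N + 1) (-1) 0 (-1) i (m' (?N + 1)) (m' 0)) {1..?N + 1} =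
        finprod ?H (\<lambda>i. inv\<^bsub>?H\<^esub> (pcomp Q (?N + 1) (-1) 0 (-1) i (z i) (kappa Q))) {1..?N + 1}"
    proof (rule H.finprod_eq)
      fix i assume i: "i \<in> {1..?N + 1}"
      have "m' (?N + 1) = ?u" "m' 0 = kappa Q" using k by (simp_all add: m'_def)
      then show "pcomp Q (?N + 1) (-1) 0 (-1) i (m' (?N + 1)) (m' 0) =
          inv\<^bsub>?H\<^esub> (pcomp Q (?N + 1) (-1) 0 (-1) i (z i) (kappa Q))"
        unfolding z1[OF i] using i by (simp only:) (intro pcomp_inv_left S_carr[OF zb] kappa_in; simp)
      show "inv\<^bsub>?H\<^esub> (pcomp Q (?N + 1) (-1) 0 (-1) i (z i) (kappa Q)) \<in> carrier ?H"
        using zk[OF i z[OF i]] by simp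
    qed
    also have "\<dots> = inv\<^bsub>?H\<^esub> (?Z z)" using zk z by (intro H.finprod_inverse) auto
    finally show ?thesis .
  qed
  have "curvature Q (odiff Q) m' ?N = \<one>\<^bsub>?H\<^esub>"
  proof -
    have mN': "m' ?N = m ?N" by (rule old) simp
    have "curvature Q (odiff Q) m' ?N = ((y \<otimes>\<^bsub>?H\<^esub> ?Z z) \<otimes>\<^bsub>?H\<^esub> mc_head Q m ?N) \<otimes>\<^bsub>?H\<^esub> inv\<^bsub>?H\<^esub> (?Z z)"
      unfolding curvature_eq[of m', OF m'_carr] tail' head' mN' dm ..
    also have "\<dots> = (?x \<otimes>\<^bsub>?H\<^esub> ?Z z) \<otimes>\<^bsub>?H\<^esub> inv\<^bsub>?H\<^esub> (?Z z)"
      unfolding swap[OF yc Zc hc] ..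
    also have "\<dots> = \<one>\<^bsub>?H\<^esub>"
      unfolding x1 H.l_one[OF Zc] by (rule H.r_inv[OF Zc])
    finally show ?thesis .
  qed
  moreover have "curvature Q (odiff Q) m' i = \<one>\<^bsub>cpt Q i (-2)\<^esub>" if "i \<le> n" for i
    using curvature_cong[of m' m i, OF m'_carr carr old] flat[OF that] that by simp
  ultimately have "\<forall>i\<le>Suc n. curvature Q (odiff Q) m' i = \<one>\<^bsub>cpt Q i (-2)\<^esub>"
    by (auto simp: le_Suc_eq)
  moreover have "\<forall>i. 1 \<le> i \<longrightarrow> i \<le> Suc n + 1 \<longrightarrow> m' i \<in> base Q i (-1)"
    using base ub by (auto simp: m'_def)
  moreover have "\<forall>i>Suc n + 1. m' i = \<one>\<^bsub>cpt Q i (-1)\<^esub>"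
    using m by (auto simp: m'_def partial_structure_def)
  ultimately have "partial_structure (Suc n) m'"
    using k by (simp add: partial_structure_def m'_def)
  then show ?thesis using old by blast
qed

lemma curved_structure_exists: "\<exists>m. curved_structure m"
proof -
  obtain F where F: "\<And>n. partial_structure n (F n)" and step: "\<And>n i. i \<le> n + 1 \<Longrightarrow> F (Suc n) i = F n i"
    using dependent_nat_choice[of partial_structure "\<lambda>n m m'. \<forall>i\<le>n + 1. m' i = m i"]
      partial_structure_0 partial_structure_Suc by blast
  define m where "m = (\<lambda>i. F i i)"
  have stable: "F (i + j) i = F i i" for i j
  proof (induction j)
    case (Suc j)
    have "F (Suc (i + j)) i = F (i + j) i" by (rule step) simp
    then show ?case using Suc by simp
  qed simp
  have eq: "F n i = m i" if "i \<le> n + 1" for n i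
  proof (cases "i \<le> n")
    case True
    then show ?thesis using stable[of i "n - i"] by (simp add: m_def)
  next
    case False
    then have "i = n + 1" using that by simp
    then show ?thesis using step[of i n] by (simp add: m_def)
  qed
  have m_carr: "m i \<in> carr Q i (-1)" for i
    unfolding m_def by (rule partial_structure_carr[OF F])
  have "curvature Q (odiff Q) m n = \<one>\<^bsub>cpt Q n (-2)\<^esub>" for n
    using curvature_cong[of "F n" m n, OF partial_structure_carr[OF F] m_carr eq] F[of n]
    by (simp add: partial_structure_def)
  moreover have "m 0 = kappa Q" using F[of 0] by (simp add: m_def partial_structure_def)
  moreover have "m n \<in> base Q n (-1)" if "n > 0" for n
    unfolding m_def by (rule partial_structure_base[OF F that])
  ultimately show ?thesis by (auto simp: curved_structure_def)
qed

lemma curvature_one_iff: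
  assumes m: "\<And>n. m n \<in> carr Q n (-1)"
  shows "curvature Q (odiff Q) m n = \<one>\<^bsub>cpt Q n (-2)\<^esub> \<longleftrightarrow>
    odiff Q n (-1) (m n) = inv\<^bsub>cpt Q n (-2)\<^esub> (mc_sum Q m n)"
proof -
  interpret comm_group "cpt Q n (-2)" by simp
  have "odiff Q n (-1) (m n) \<in> carr Q n (-2)" using derivationD(3)[OF derivation_odiff m, of n] by simp
  then show ?thesis
    using mc_sum_closed[of m, OF m, of n] unfolding curvature_def by (metis inv_equality l_inv)
qed

text \<open>
  A morphism of operads commutes with the differentials, and respects the bases, as soon as it does
  so on the generators; on \<open>\<mu>\<^sub>n\<close> the former says that the image sequence has no curvature.\<close>

lemma curv_morphism_from_cA_inf:
  "curv_morphism cA_inf Q \<Phi> \<longleftrightarrow> operad_hom free_mu Q \<Phi> \<and> curved_structure (\<lambda>n. \<Phi> n (-1) (mu n))"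
proof
  assume \<Phi>: "curv_morphism cA_inf Q \<Phi>"
  then have hom: "operad_hom free_mu Q \<Phi>" by (simp add: curv_morphism_def operad_hom_def)
  let ?m = "\<lambda>n. \<Phi> n (-1) (mu n)"
  have m: "?m n \<in> carr Q n (-1)" for n by (rule operad_homD(3)[OF hom mu_closed])
  have "odiff Q n (-1) (?m n) = inv\<^bsub>cpt Q n (-2)\<^esub> (mc_sum Q ?m n)" for n
  proof -
    have "odiff Q n (-1) (?m n) = \<Phi> n (-2) (mu_deriv (\<lambda>_. True) n (-1) (mu n))"
    proof -
      have "\<forall>x\<in>carr cA_inf n (-1). \<Phi> n (-1 - 1) (odiff cA_inf n (-1) x) = odiff Q n (-1) (\<Phi> n (-1) x)"
        using \<Phi> unfolding curv_morphism_def by blast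
      then show ?thesis using mu_closed[of n] by simp
    qed
    also have "\<dots> = \<Phi> n (-2) (inv\<^bsub>cpt free_mu n (-2)\<^esub> (mc_sum free_mu mu n))"
      by (simp add: mu_deriv_mu mc_sum_mu)
    also have "\<dots> = inv\<^bsub>cpt Q n (-2)\<^esub> (mc_sum Q ?m n)"
      using hom_inv[OF operad_homD(1)[OF hom] _ _ free_mu.mc_sum_closed[of mu, OF mu_closed]]
        operad_hom_mc_sum[OF graded_operad_free graded_operad_axioms hom mu_closed] by simp
    finally show ?thesis .
  qed
  then have "curvature Q (odiff Q) ?m n = \<one>\<^bsub>cpt Q n (-2)\<^esub>" for n
    using curvature_one_iff[of ?m, OF m] by simp
  moreover have "?m 0 = kappa Q" using \<Phi> by (simp add: curv_morphism_def)
  moreover have "?m n \<in> base Q n (-1)" if "n > 0" for n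
  proof -
    have "\<Phi> n (-1) ` base cA_inf n (-1) \<subseteq> base Q n (-1)" using \<Phi> unfolding curv_morphism_def by blast
    then show ?thesis using mu_in_base[OF that] by (simp add: image_subset_iff)
  qed
  ultimately show "operad_hom free_mu Q \<Phi> \<and> curved_structure ?m"
    using hom by (simp add: curved_structure_def)
next
  assume "operad_hom free_mu Q \<Phi> \<and> curved_structure (\<lambda>n. \<Phi> n (-1) (mu n))"
  then have hom: "operad_hom free_mu Q \<Phi>" and m: "curved_structure (\<lambda>n. \<Phi> n (-1) (mu n))" by auto
  let ?m = "\<lambda>n. \<Phi> n (-1) (mu n)"
  have mc: "?m n \<in> carr Q n (-1)" for n by (rule operad_homD(3)[OF hom mu_closed])
  have gen: "\<Phi> n (-2) (mu_deriv (\<lambda>_. True) n (-1) (mu n)) = odiff Q n (-1) (?m n)" for n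
  proof -
    have "\<Phi> n (-2) (mu_deriv (\<lambda>_. True) n (-1) (mu n)) = \<Phi> n (-2) (inv\<^bsub>cpt free_mu n (-2)\<^esub> (mc_sum free_mu mu n))"
      by (simp add: mu_deriv_mu mc_sum_mu)
    also have "\<dots> = inv\<^bsub>cpt Q n (-2)\<^esub> (mc_sum Q ?m n)"
      using hom_inv[OF operad_homD(1)[OF hom] _ _ free_mu.mc_sum_closed[of mu, OF mu_closed]]
        operad_hom_mc_sum[OF graded_operad_free graded_operad_axioms hom mu_closed] by simp
    also have "\<dots> = odiff Q n (-1) (?m n)"
      using curvature_one_iff[of ?m, OF mc] m by (simp add: curved_structure_def)
    finally show ?thesis .
  qed
  have d: "\<Phi> n (d - 1) (mu_deriv (\<lambda>_. True) n d x) = odiff Q n d (\<Phi> n d x)" if "x \<in> carr free_mu n d" for n d x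
    using free_generated[OF derivation_intertwined_suboperad[OF graded_operad_free graded_operad_axioms hom
          derivation_mu_deriv[of "\<lambda>_. True"] derivation_odiff] _ that]
    by (force dest!: mu_gens_cases simp: mu_closed gen)
  have b: "\<Phi> n d x \<in> base Q n d" if x: "x \<in> mu_base n d" for n d x
  proof -
    have "suboperad (\<lambda>n d. {x \<in> carr free_mu n d. \<Phi> n d x \<in> base Q n d}) free_mu"
    proof (rule suboperadI)
      fix n d
      note f = operad_homD(1)[OF hom, of n d] and sub = suboperadD(1)[OF S, of n d]
      show "subgroup {x \<in> carr free_mu n d. \<Phi> n d x \<in> base Q n d} (cpt free_mu n d)"
      proof (rule group.subgroupI[OF free_mu.cpt_group(1)])
        have "\<one>\<^bsub>cpt free_mu n d\<^esub> \<in> {x \<in> carr free_mu n d. \<Phi> n d x \<in> base Q n d}"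
          using hom_to_one[OF f] subgroup.one_closed[OF sub] free_mu.one_in_carr by simp
        then show "{x \<in> carr free_mu n d. \<Phi> n d x \<in> base Q n d} \<noteq> {}" by blast
        show "inv\<^bsub>cpt free_mu n d\<^esub> x \<in> {x \<in> carr free_mu n d. \<Phi> n d x \<in> base Q n d}"
          if "x \<in> {x \<in> carr free_mu n d. \<Phi> n d x \<in> base Q n d}" for x
          using that hom_inv[OF f, of x] subgroup.m_inv_closed[OF sub] free_mu.inv_in_carr by simp
        show "x \<otimes>\<^bsub>cpt free_mu n d\<^esub> y \<in> {x \<in> carr free_mu n d. \<Phi> n d x \<in> base Q n d}"
          if "x \<in> {x \<in> carr free_mu n d. \<Phi> n d x \<in> base Q n d}"
            "y \<in> {x \<in> carr free_mu n d. \<Phi> n d x \<in> base Q n d}" for x y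
          using that hom_mult[OF f, of x y] subgroup.m_closed[OF sub] free_mu.mult_closed by simp
      qed blast
    next
      fix m a n b i x y
      assume "1 \<le> i" "i \<le> m" "x \<in> {x \<in> carr free_mu m a. \<Phi> m a x \<in> base Q m a}"
        "y \<in> {x \<in> carr free_mu n b. \<Phi> n b x \<in> base Q n b}"
      then show "pcomp free_mu m a n b i x y \<in>
          {x \<in> carr free_mu (m + n - 1) (a + b). \<Phi> (m + n - 1) (a + b) x \<in> base Q (m + n - 1) (a + b)}"
        using operad_homD(2)[OF hom, of i m x a y n b, OF _ _ _ _ refl refl]
          suboperadD(2)[OF S, of i m _ a _ n b, OF _ _ _ _ refl refl]
          free_mu.pcomp_closed[of i m x a y n b, OF _ _ _ _ refl refl] by simp
    qed
    from mu_base_least[OF this _ x] show ?thesis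
      using m by (simp add: curved_structure_def mu_closed)
  qed
  show "curv_morphism cA_inf Q \<Phi>"
    using hom m d b by (auto simp: curv_morphism_def operad_hom_def curved_structure_def)
qed

theorem initial_morphism:
  "\<exists>\<Phi>. curv_morphism cA_inf Q \<Phi> \<and>
    (\<forall>\<Psi>. curv_morphism cA_inf Q \<Psi> \<longrightarrow> (\<forall>n d. \<forall>x\<in>carr cA_inf n d. \<Psi> n d x = \<Phi> n d x))"
proof -
  obtain m where m: "curved_structure m" using curved_structure_exists by blast
  obtain \<Phi> where \<Phi>: "operad_hom free_mu Q \<Phi>"
    and gen: "\<And>n d g. g \<in> mu_gens n d \<Longrightarrow> \<Phi> n d (free_gen mu_gens n d g) = m n"
  proof (rule free_universal[OF graded_operad_axioms, of mu_gens "\<lambda>n d g. m n"])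
    show "m n \<in> carr Q n d" if "g \<in> mu_gens n d" for n d g
      using mu_gens_cases[OF that] curved_structure_carr[OF m] by simp
  qed (rule that)
  have "\<Phi> n (-1) (mu n) = m n" for n
    using gen[of "()" n "-1"] by (simp add: mu_gens_def mu_def)
  then have "curv_morphism cA_inf Q \<Phi>" using curv_morphism_from_cA_inf \<Phi> m by simp
  moreover have "\<Psi> n d x = \<Phi> n d x" if \<Psi>: "curv_morphism cA_inf Q \<Psi>" and x: "x \<in> carr cA_inf n d" for \<Psi> n d x
  proof (rule free_hom_unique[of mu_gens Q])
    show "operad_hom free_mu Q \<Psi>" using \<Psi> curv_morphism_from_cA_inf by blast
    have \<Psi>m: "\<Psi> n (-1) (mu n) = m n" for n
      using curved_structure_unique[OF _ m] \<Psi> curv_morphism_from_cA_inf by blast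
    fix n d u assume "u \<in> mu_gens n d"
    then show "\<Psi> n d (free_gen mu_gens n d u) = \<Phi> n d (free_gen mu_gens n d u)"
      using gen \<Psi>m mu_gens_cases by metis
  qed (use \<Phi> x in \<open>simp_all add: graded_operad_axioms\<close>)
  ultimately show ?thesis by blast
qed

end

theorem theorem1p2:
  shows "curv_object cA_inf \<and>
    (\<forall>Q :: 'a curved. curv_object Q \<longrightarrow>
      (\<exists>\<Phi>. curv_morphism cA_inf Q \<Phi> \<and>
        (\<forall>\<Psi>. curv_morphism cA_inf Q \<Psi> \<longrightarrow>
          (\<forall>n d. \<forall>x\<in>carr cA_inf n d. \<Psi> n d x = \<Phi> n d x))))"
  using curv_object_cA_inf curv_object.initial_morphism by blast

end
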